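(* Let $p\in(1,\infty)$, let $(\mu_t)_{t\ge0}\subset\mathcal P_p$ and let $(\psi_t)_{t\ge0}$ be a family of functions $\psi_t\colon\mathbb R^d\to\mathbb R^d$. Put $(R(t)f)(x):=\int_{\mathbb R^d}f(\psi_t(x)+y)\,d\mu_t(y)$ for $t\ge0$, $f\in C_b$, $x\in\mathbb R^d$. Suppose that $(R(t))_{t\ge0}$ is a semigroup on $C_b$ and that: (i) $\lim_{t\downarrow0}\int|y|^p\,d\mu_t(y)=0$; (ii) there exist $r>0$ and $c\ge0$ with $\mu_t(\{|y|>r\})\le ct$ for all $t\in[0,1]$; (iii) $\psi_t(0)=0$ for all $t\ge0$; (iv) there exists $L\ge0$ with $|\psi_t(x)-\psi_t(y)-(x-y)|\le Lt|x-y|$ for all $x,y\in\mathbb R^d$, $t\in[0,1]$; (v) for every $f\in C_b^\infty\cap\mathcal L_R$ the limit $R'(0)f:=\lim_{h\downarrow0}\frac{R(h)f-f}{h}\in C_b$ exists, and $C_c^\infty\subset\mathcal L_R$. Let $\varphi\colon[0,\infty)\to[0,\infty]$ be convex and lower semicontinuous with $\varphi(0)=0$, $\varphi(v)>0$ for some $v>0$, and such that $v\mapsto\varphi(v^{1/p})$ is convex on $[0,\infty)$. For $t\ge0$, $f\in C_b$, $x\in\mathbb R^d$ define $$(I(t)f)(x):=\sup_{\nu\in\mathcal P_p}\Big(\int f(\psi_t(x)+z)\,d\nu(z)-\varphi_t(\mathcal W_p(\mu_t,\nu))\Big),$$ $$(J(t)f)(x):=\sup_{b\in\mathbb R^d}\Big(\int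 f(\psi_t(x)+y+bt)\,d\mu_t(y)-\varphi_t(|b|t)\Big).$$ Let $(h_n)_{n\in\mathbb N}\subset(0,\infty)$ with $h_n\to0$ and $\mathcal T_n\subset\mathcal T_{n+1}$ for all $n$, where $\mathcal T_n:=\{kh_n:k\in\mathbb N_0\}$; put $k_n^t:=\max\{k\in\mathbb N_0:kh_n\le t\}$, $I(\pi_n^t)f:=I(h_n)^{k_n^t}f$ and $J(\pi_n^t)f:=J(h_n)^{k_n^t}f$. Then there exists a strongly continuous convex monotone semigroup $(S(t))_{t\ge0}$ on $C_b$ given by $$S(t)f=\lim_{n\to\infty}I(\pi_n^t)f=\lim_{n\to\infty}J(\pi_n^t)f\quad\text{for all }(f,t)\in C_b\times[0,\infty),$$ whose generator $A$ satisfies $C_b^\infty\cap\mathcal L_R\subset D(A)$ and $Af=R'(0)f+\varphi^*(|\nabla f|)$ for all $f\in C_b^\infty\cap\mathcal L_R$.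
   Context: $\mathcal P_p$ is the set of Borel probability measures on $\mathbb R^d$ with finite $p$-th moment and $\mathcal W_p(\mu,\nu)=\big(\inf_{\pi\in\Pi(\mu,\nu)}\int|y-z|^p\,d\pi(y,z)\big)^{1/p}$ is the $p$-Wasserstein distance ($\Pi(\mu,\nu)$: couplings of $\mu$ and $\nu$). $\varphi_t(v):=t\varphi(v/t)$ for $t>0$, $v\ge0$; $\varphi_0(0):=0$ and $\varphi_0(v):=+\infty$ for $v\ne0$. $\varphi^*(w):=\sup_{v\ge0}(vw-\varphi(v))$ for $w\ge0$, which is finite. $C_b$: bounded continuous functions $\mathbb R^d\to\mathbb R$, ordered pointwise (sup norm $\|\cdot\|_\infty$). All limits in $C_b$ are in the mixed topology: $f_n\to f$ iff $\sup_n\|f_n\|_\infty<\infty$ and $f_n\to f$ uniformly on compact sets; limits as $h\downarrow0$ are along all sequences. $C_b^\infty$: bounded infinitely differentiable functions with bounded partial derivatives of all orders; $C_c^\infty$: smooth functions with compact support. $\mathcal L_R$ is the set of $f\in C_b$ for which there are $c\ge0$, $h_0>0$ with $\|R(h)f-f\|_\infty\le ch$ for all $h\in[0,h_0]$. "$(R(t))$ is a semigroup" means $R(t)\colon C_b\to C_b$, $R(0)=\mathrm{id}$, $R(s+t)=R(s)R(t)$. A convex monotone semigroup on $C_b$ is a family of operators $S(t)\colon C_b\to C_b$, $t\ge0$, such that: (S1) each $S(t)$ is convex and monotone, and $S(t)f_n\downarrow0$ pointwise whenever $(f_n)\subset C_b$ decreases pointwise to $0$; (S2) $S(0)f=f$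 and $S(s+t)f=S(s)S(t)f$; (S3) $\sup_{t\in[0,T]}\|S(t)r\|_\infty<\infty$ for all constants $r,T\ge0$; (S4) $\limsup_n(S(s_n)f)(x_n)\le(S(t)f)(x)$ for all $f\in C_b$, $0\le s_n\to t$, $x_n\to x$. It is strongly continuous if $\lim_{t\to0}S(t)f=f$ for all $f\in C_b$. Generator: $Af:=\lim_{h\downarrow0}\frac{S(h)f-f}{h}\in C_b$ with domain $D(A)$ the set of $f\in C_b$ for which this limit exists. *)

theory Defs
  imports "HOL-Probability.Probability"
begin

text \<open>
  The space $C_b$ is the library set \<^const>\<open>bcontfun\<close>. Operator families indexed by \<open>t \<ge> 0\<close>
  are maps on all functions \<open>'a \<Rightarrow> real\<close> indexed by all reals; only their values at \<open>t \<ge> 0\<close>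
  and on \<^const>\<open>bcontfun\<close> matter, and invariance of $C_b$ is always stated explicitly.
\<close>

section \<open>Bounded continuous functions\<close>

definition sup_norm :: "('a \<Rightarrow> real) \<Rightarrow> real" where
  "sup_norm f = (SUP x. \<bar>f x\<bar>)"

definition mixed_lim :: "(nat \<Rightarrow> 'a::euclidean_space \<Rightarrow> real) \<Rightarrow> ('a \<Rightarrow> real) \<Rightarrow> bool" where
  "mixed_lim F f \<longleftrightarrow>
     (\<forall>n. F n \<in> bcontfun) \<and> f \<in> bcontfun \<and>
     bdd_above (range (\<lambda>n. sup_norm (F n))) \<and>
     (\<forall>K. compact K \<longrightarrow> uniform_limit K F f sequentially)"

definition mixed_lim_at_0 :: "(real \<Rightarrow> 'a::euclidean_space \<Rightarrow> real) \<Rightarrow> ('a \<Rightarrow> real) \<Rightarrow> bool" where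
  "mixed_lim_at_0 G f \<longleftrightarrow>
     (\<forall>h. (\<forall>n. 0 < h n) \<and> h \<longlonglongrightarrow> 0 \<longrightarrow> mixed_lim (\<lambda>n. G (h n)) f)"

text \<open>
  Iterated partial derivatives along a list of coordinate directions. Requiring Frechet
  differentiability of all of them makes a function infinitely differentiable.
\<close>

primrec partial_derivs ::
  "'a list \<Rightarrow> ('a::euclidean_space \<Rightarrow> real) \<Rightarrow> 'a \<Rightarrow> real" where
  "partial_derivs [] f = f"
| "partial_derivs (b # bs) f = (\<lambda>x. frechet_derivative (partial_derivs bs f) (at x) b)"

definition smooth :: "('a::euclidean_space \<Rightarrow> real) \<Rightarrow> bool" where
  "smooth f \<longleftrightarrow> (\<forall>bs\<in>lists Basis. \<forall>x. partial_derivs bs f differentiable at x)"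

text \<open>The empty list of directions gives boundedness of the function itself.\<close>

definition Cb_smooth :: "('a::euclidean_space \<Rightarrow> real) set" where
  "Cb_smooth = {f. smooth f \<and> (\<forall>bs\<in>lists Basis. bounded (range (partial_derivs bs f)))}"

definition Cc_smooth :: "('a::euclidean_space \<Rightarrow> real) set" where
  "Cc_smooth = {f. smooth f \<and> compact (closure {x. f x \<noteq> 0})}"

definition grad :: "('a::euclidean_space \<Rightarrow> real) \<Rightarrow> 'a \<Rightarrow> 'a" where
  "grad f x = (\<Sum>b\<in>Basis. frechet_derivative f (at x) b *\<^sub>R b)"

section \<open>Semigroups\<close>

definition Cb_semigroup :: "(real \<Rightarrow> ('a::euclidean_space \<Rightarrow> real) \<Rightarrow> 'a \<Rightarrow> real) \<Rightarrow> bool" where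
  "Cb_semigroup T \<longleftrightarrow>
     (\<forall>t\<ge>0. \<forall>f\<in>bcontfun. T t f \<in> bcontfun) \<and>
     (\<forall>f\<in>bcontfun. T 0 f = f) \<and>
     (\<forall>s\<ge>0. \<forall>t\<ge>0. \<forall>f\<in>bcontfun. T (s + t) f = T s (T t f))"

definition convex_monotone_semigroup ::
  "(real \<Rightarrow> ('a::euclidean_space \<Rightarrow> real) \<Rightarrow> 'a \<Rightarrow> real) \<Rightarrow> bool" where
  "convex_monotone_semigroup S \<longleftrightarrow>
     Cb_semigroup S \<and>
     (\<forall>t\<ge>0. \<forall>f\<in>bcontfun. \<forall>g\<in>bcontfun. \<forall>l\<in>{0..1}. \<forall>x.
        S t (\<lambda>y. l * f y + (1 - l) * g y) x \<le> l * S t f x + (1 - l) * S t g x) \<and>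
     (\<forall>t\<ge>0. \<forall>f\<in>bcontfun. \<forall>g\<in>bcontfun. f \<le> g \<longrightarrow> S t f \<le> S t g) \<and>
     (\<forall>t\<ge>0. \<forall>F :: nat \<Rightarrow> 'a \<Rightarrow> real.
        (\<forall>n. F n \<in> bcontfun) \<and> decseq F \<and> (\<forall>x. (\<lambda>n. F n x) \<longlonglongrightarrow> 0) \<longrightarrow>
        decseq (\<lambda>n. S t (F n)) \<and> (\<forall>x. (\<lambda>n. S t (F n) x) \<longlonglongrightarrow> 0)) \<and>
     (\<forall>r\<ge>0. \<forall>T\<ge>0. bdd_above ((\<lambda>t. sup_norm (S t (\<lambda>_. r))) ` {0..T})) \<and>
     (\<forall>f\<in>bcontfun. \<forall>t\<ge>0. \<forall>x. \<forall>s :: nat \<Rightarrow> real. \<forall>y :: nat \<Rightarrow> 'a.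
        (\<forall>n. 0 \<le> s n) \<and> s \<longlonglongrightarrow> t \<and> y \<longlonglongrightarrow> x \<longrightarrow>
        limsup (\<lambda>n. ereal (S (s n) f (y n))) \<le> ereal (S t f x))"

definition strongly_continuous ::
  "(real \<Rightarrow> ('a::euclidean_space \<Rightarrow> real) \<Rightarrow> 'a \<Rightarrow> real) \<Rightarrow> bool" where
  "strongly_continuous S \<longleftrightarrow> (\<forall>f\<in>bcontfun. mixed_lim_at_0 (\<lambda>t. S t f) f)"

definition has_generator_value ::
  "(real \<Rightarrow> ('a::euclidean_space \<Rightarrow> real) \<Rightarrow> 'a \<Rightarrow> real) \<Rightarrow> ('a \<Rightarrow> real) \<Rightarrow> ('a \<Rightarrow> real) \<Rightarrow> bool" where
  "has_generator_value T f g \<longleftrightarrow> mixed_lim_at_0 (\<lambda>h x. (T h f x - f x) / h) g"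

definition generator_domain ::
  "(real \<Rightarrow> ('a::euclidean_space \<Rightarrow> real) \<Rightarrow> 'a \<Rightarrow> real) \<Rightarrow> ('a \<Rightarrow> real) set" where
  "generator_domain T = {f \<in> bcontfun. \<exists>g. has_generator_value T f g}"

text \<open>
  Used both for the generator $A$ of $S$ and for $R'(0)$; meaningful only on
  \<open>generator_domain T\<close>, where the limit is unique.
\<close>

definition generator ::
  "(real \<Rightarrow> ('a::euclidean_space \<Rightarrow> real) \<Rightarrow> 'a \<Rightarrow> real) \<Rightarrow> ('a \<Rightarrow> real) \<Rightarrow> ('a \<Rightarrow> real)" where
  "generator T f = (THE g. has_generator_value T f g)"

definition lipschitz_set ::
  "(real \<Rightarrow> ('a::euclidean_space \<Rightarrow> real) \<Rightarrow> 'a \<Rightarrow> real) \<Rightarrow> ('a \<Rightarrow> real) set" where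
  "lipschitz_set R = {f \<in> bcontfun.
     \<exists>c\<ge>0. \<exists>h0>0. \<forall>h\<in>{0..h0}. sup_norm (\<lambda>x. R h f x - f x) \<le> c * h}"

section \<open>Wasserstein distance\<close>

definition P_space :: "real \<Rightarrow> 'a::euclidean_space measure set" where
  "P_space p = {\<mu>. prob_space \<mu> \<and> sets \<mu> = sets borel \<and> integrable \<mu> (\<lambda>y. norm y powr p)}"

definition couplings ::
  "'a::euclidean_space measure \<Rightarrow> 'a measure \<Rightarrow> ('a \<times> 'a) measure set" where
  "couplings \<mu> \<nu> = {\<pi>. prob_space \<pi> \<and> sets \<pi> = sets borel \<and>
     distr \<pi> borel fst = \<mu> \<and> distr \<pi> borel snd = \<nu>}"

definition wasserstein :: "real \<Rightarrow> 'a::euclidean_space measure \<Rightarrow> 'a measure \<Rightarrow> real" where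
  "wasserstein p \<mu> \<nu> =
     enn2real (INF \<pi>\<in>couplings \<mu> \<nu>. \<integral>\<^sup>+ u. ennreal (norm (fst u - snd u) powr p) \<partial>\<pi>) powr (1 / p)"

section \<open>Penalty functions\<close>

text \<open>
  A function from $[0,\infty)$ to $[0,\infty]$ is represented by \<open>\<phi> :: real \<Rightarrow> ereal\<close> that is
  nonnegative on \<open>{0..}\<close>; its values at negative arguments are irrelevant.
\<close>

definition ereal_convex_halfline :: "(real \<Rightarrow> ereal) \<Rightarrow> bool" where
  "ereal_convex_halfline \<phi> \<longleftrightarrow>
     (\<forall>v\<ge>0. \<forall>w\<ge>0. \<forall>l\<in>{0..1}.
        \<phi> (l * v + (1 - l) * w) \<le> ereal l * \<phi> v + ereal (1 - l) * \<phi> w)"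

definition ereal_lsc_halfline :: "(real \<Rightarrow> ereal) \<Rightarrow> bool" where
  "ereal_lsc_halfline \<phi> \<longleftrightarrow> (\<forall>v\<ge>0. \<phi> v \<le> Liminf (at v within {0..}) \<phi>)"

definition perspective :: "(real \<Rightarrow> ereal) \<Rightarrow> real \<Rightarrow> real \<Rightarrow> ereal" where
  "perspective \<phi> t v =
     (if t = 0 then (if v = 0 then 0 else \<infinity>) else ereal t * \<phi> (v / t))"

text \<open>
  The supremum is finite under the assumptions on \<open>\<phi>\<close> and \<open>p\<close>, so the conversion to
  \<^typ>\<open>real\<close> loses nothing there.
\<close>

definition conjugate :: "(real \<Rightarrow> ereal) \<Rightarrow> real \<Rightarrow> real" where
  "conjugate \<phi> w = real_of_ereal (SUP v\<in>{0..}. ereal (v * w) - \<phi> v)"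

section \<open>The operators\<close>

definition R_op ::
  "(real \<Rightarrow> 'a::euclidean_space measure) \<Rightarrow> (real \<Rightarrow> 'a \<Rightarrow> 'a) \<Rightarrow>
   real \<Rightarrow> ('a \<Rightarrow> real) \<Rightarrow> 'a \<Rightarrow> real" where
  "R_op \<mu> \<psi> t f x = (\<integral>y. f (\<psi> t x + y) \<partial>\<mu> t)"

text \<open>
  For \<open>f\<close> in $C_b$ both suprema lie between the infimum and the supremum of \<open>f\<close>
  (take \<open>\<nu> = \<mu> t\<close>, resp. \<open>b = 0\<close>, for the lower bound), hence are finite.
\<close>

definition I_op ::
  "real \<Rightarrow> (real \<Rightarrow> ereal) \<Rightarrow> (real \<Rightarrow> 'a::euclidean_space measure) \<Rightarrow> (real \<Rightarrow> 'a \<Rightarrow> 'a) \<Rightarrow>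
   real \<Rightarrow> ('a \<Rightarrow> real) \<Rightarrow> 'a \<Rightarrow> real" where
  "I_op p \<phi> \<mu> \<psi> t f x = real_of_ereal
     (SUP \<nu>\<in>P_space p.
        ereal (\<integral>z. f (\<psi> t x + z) \<partial>\<nu>) - perspective \<phi> t (wasserstein p (\<mu> t) \<nu>))"

definition J_op ::
  "(real \<Rightarrow> ereal) \<Rightarrow> (real \<Rightarrow> 'a::euclidean_space measure) \<Rightarrow> (real \<Rightarrow> 'a \<Rightarrow> 'a) \<Rightarrow>
   real \<Rightarrow> ('a \<Rightarrow> real) \<Rightarrow> 'a \<Rightarrow> real" where
  "J_op \<phi> \<mu> \<psi> t f x = real_of_ereal
     (SUP b.
        ereal (\<integral>y. f (\<psi> t x + y + t *\<^sub>R b) \<partial>\<mu> t) - perspective \<phi> t (norm b * t))"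

definition step_count :: "real \<Rightarrow> real \<Rightarrow> nat" where
  "step_count h t = Max {k. real k * h \<le> t}"

end

theory Submission
  imports Defs
begin

text \<open>
  Every operator at hand is trapped between the reference semigroup and the reference semigroup plus a
  penalty term: \<open>R t f \<le> T f \<le> R t f + t \<phi>\<^sup>*(e\<^bsup>Lt\<^esup> Lip f)\<close>. Together with convexity and monotonicity this
  bound is stable under composition and limits and gives equicontinuity in the mixed topology, so that
  bounded Lipschitz functions suffice.

  Existence of the limit: a drift that is constant over \<open>m\<close> steps is almost a drift over one step of the
  \<open>m\<close>-fold length, because \<open>R\<close> commutes with translations up to an error linear in time; hence \<open>J\<close> increases
  under refinement up to summable errors.

  Equality of the limits: for functions with a quadratic remainder both one-step operators agree up to
  \<open>o(h)\<close>. The iterates of \<open>J\<close> need not be smooth, but by convexity their mollifications are supersolutions of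
  the \<open>J\<close>-scheme, hence of the \<open>I\<close>-scheme.

  Generator: for smooth \<open>f\<close> the iterates \<open>J(h)\<^sup>k f\<close> are sandwiched between expansions
  \<open>R(s)f + s \<phi>\<^sup>*(\<bar>\<nabla>f\<bar>) + o(s)\<close>, \<open>s = kh\<close>, with the same remainder for all \<open>h\<close>.
\<close>

section \<open>Bounded continuous and bounded Lipschitz functions\<close>

text \<open>Nothing is uniform in space: the flow displaces \<open>x\<close> by up to
  \<open>L t |x|\<close>, so every limit is local and mass arriving from far away must be
  controlled. This is done with truncated norms, on which \<open>R t\<close> is bounded
  independently of the truncation level. Uniformity in the number of steps comes from the factor
  \<open>exp (L t)\<close> for Lipschitz constants, since exponentials multiply. The convexity of
  \<open>\<phi> (v powr (1 / p))\<close> forces growth of order \<open>v powr p\<close>; hence only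
  speeds up to \<open>vmax \<Lambda>\<close> matter against \<Lambda>-Lipschitz functions, and a
  step of length \<open>h\<close> shifts by at most \<open>h * vmax \<Lambda>\<close>. Commuting
  such a shift with \<open>R h\<close> costs order \<open>h^2\<close>, so refinement errors sum to
  order \<open>h\<close>. In comparing \<open>I\<close> with \<open>J\<close>, the exponent
  \<open>p > 1\<close> excludes rare long jumps: a transport plan of cost at most
  \<open>(V h) powr p\<close> gains at most a multiple of \<open>h * N powr (1 - p)\<close> from
  jumps longer than \<open>N h\<close>. The order of choices matters there: the mollification radius
  is fixed first, which bounds the second-order constant of all iterates at once, and only then is
  the step made small.\<close>

lemma bcontfunI:
  fixes f :: "'a::topological_space \<Rightarrow> real"
  assumes "continuous_on UNIV f" "\<And>x. \<bar>f x\<bar> \<le> r"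
  shows "f \<in> bcontfun"
  using assms by (intro bcontfun_normI) auto

lemma bcontfun_continuous: "f \<in> bcontfun \<Longrightarrow> continuous_on UNIV f"
  by (auto simp: bcontfun_def)

lemma bcontfun_bound:
  fixes f :: "'a::topological_space \<Rightarrow> real"
  assumes "f \<in> bcontfun"
  obtains r where "r \<ge> 0" "\<And>x. \<bar>f x\<bar> \<le> r"
proof -
  have "bounded (range f)" using assms by (auto simp: bcontfun_def)
  then obtain r where "\<forall>x. \<bar>f x\<bar> \<le> r" by (auto simp: bounded_iff)
  then show ?thesis using that[of "\<bar>r\<bar>"] by (meson abs_ge_self abs_ge_zero order_trans)
qed

lemma bcontfun_mult_left: "f \<in> bcontfun \<Longrightarrow> (\<lambda>x. a * f x) \<in> bcontfun"
  for f :: "'a::topological_space \<Rightarrow> real"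
  using scaleR_cont[of f a] by simp

lemma bcontfun_add_const: "f \<in> bcontfun \<Longrightarrow> (\<lambda>x. f x + c) \<in> bcontfun"
  for f :: "'a::topological_space \<Rightarrow> real"
  by (intro plus_cont const_bcontfun)

lemma bcontfun_shift:
  fixes f :: "'a::euclidean_space \<Rightarrow> real"
  assumes "f \<in> bcontfun"
  shows "(\<lambda>x. f (x + c)) \<in> bcontfun"
proof -
  obtain r where r: "\<And>x. \<bar>f x\<bar> \<le> r" using bcontfun_bound[OF assms] by blast
  have "continuous_on UNIV (\<lambda>x. f (x + c))"
    by (rule continuous_on_compose2[OF bcontfun_continuous[OF assms]]) (auto intro: continuous_intros)
  then show ?thesis using r by (rule bcontfunI)
qed

lemma bcontfun_measurable:
  fixes f :: "'a::euclidean_space \<Rightarrow> real"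
  shows "f \<in> bcontfun \<Longrightarrow> f \<in> borel_measurable borel"
  by (intro borel_measurable_continuous_onI bcontfun_continuous)

lemma integrable_bcontfun_compose:
  fixes f :: "'a::euclidean_space \<Rightarrow> real"
  assumes "finite_measure M" "f \<in> bcontfun" "g \<in> borel_measurable M"
  shows "integrable M (\<lambda>u. f (g u))"
proof -
  interpret finite_measure M by fact
  obtain r where r: "\<And>x. \<bar>f x\<bar> \<le> r" using bcontfun_bound[OF assms(2)] by blast
  show ?thesis
    using measurable_compose[OF assms(3) bcontfun_measurable[OF assms(2)]] r
    by (intro integrable_const_bound[where B=r]) auto
qed

section \<open>Bounded Lipschitz functions with an explicit constant, and approximation by
  them\<close>

definition blip :: "real \<Rightarrow> ('a::euclidean_space \<Rightarrow> real) \<Rightarrow> bool" where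
  "blip \<Lambda> f \<longleftrightarrow> f \<in> bcontfun \<and> \<Lambda>-lipschitz_on UNIV f"

lemma blip_bcontfun: "blip \<Lambda> f \<Longrightarrow> f \<in> bcontfun"
  and blip_nonneg: "blip \<Lambda> f \<Longrightarrow> 0 \<le> \<Lambda>"
  by (auto simp: blip_def lipschitz_on_nonneg)

lemma blip_diff: "blip \<Lambda> f \<Longrightarrow> f x - f y \<le> \<Lambda> * norm (x - y)"
  and blip_abs_diff: "blip \<Lambda> f \<Longrightarrow> \<bar>f x - f y\<bar> \<le> \<Lambda> * norm (x - y)"
  using lipschitz_on_normD[of \<Lambda> UNIV f x y] by (auto simp: blip_def)

lemma blip_add_diff: "blip \<Lambda> f \<Longrightarrow> f (x + c) - f x \<le> \<Lambda> * norm c"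
  "blip \<Lambda> f \<Longrightarrow> \<bar>f (x + c) - f x\<bar> \<le> \<Lambda> * norm c"
  using blip_diff[of \<Lambda> f "x + c" x] blip_abs_diff[of \<Lambda> f "x + c" x] by auto

lemma blipI:
  assumes "0 \<le> \<Lambda>" "\<And>x. \<bar>f x\<bar> \<le> r" "\<And>x y. f x - f y \<le> \<Lambda> * norm (x - y)"
  shows "blip \<Lambda> f"
proof -
  have "\<Lambda>-lipschitz_on UNIV f"
    using assms(1) assms(3)[of x y for x y] assms(3)[of y x for x y]
    by (intro lipschitz_onI) (simp_all add: dist_real_def dist_norm abs_le_iff, metis norm_minus_commute)
  then show ?thesis
    using assms(2) by (auto simp: blip_def intro!: bcontfunI[of _ r] lipschitz_on_continuous_on)
qed

lemma blip_mono: "blip \<Lambda> f \<Longrightarrow> \<Lambda> \<le> \<Lambda>' \<Longrightarrow> blip \<Lambda>' f"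
  by (auto simp: blip_def intro: lipschitz_on_mono)

lemma blip_shift: "blip \<Lambda> f \<Longrightarrow> blip \<Lambda> (\<lambda>x. f (x + c))"
proof -
  assume f: "blip \<Lambda> f"
  obtain r where r: "\<And>x. \<bar>f x\<bar> \<le> r" using bcontfun_bound[OF blip_bcontfun[OF f]] by blast
  show ?thesis using r blip_nonneg[OF f] blip_diff[OF f, of "_ + c" "_ + c"]
    by (intro blipI[where r=r]) auto
qed

lemma blip_add: "blip \<Lambda> f \<Longrightarrow> blip \<Lambda>' g \<Longrightarrow> blip (\<Lambda> + \<Lambda>') (\<lambda>x. f x + g x)"
  by (auto simp: blip_def intro!: lipschitz_on_add plus_cont)

lemma blip_cmult: "0 \<le> a \<Longrightarrow> blip \<Lambda> f \<Longrightarrow> blip (a * \<Lambda>) (\<lambda>x. a * f x)"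
  by (auto simp: blip_def intro!: lipschitz_on_cmult_real_nonneg bcontfun_mult_left)

lemma blip_const: "blip 0 (\<lambda>_. c)"
  by (auto simp: blip_def const_bcontfun intro: lipschitz_on_constant)

text \<open>The weight of \<open>adm_gap\<close>: it lies in the class to which the operators apply,
  yet its image under \<open>R t\<close> grows at most linearly in \<open>x\<close> with constants
  independent of \<open>N\<close> (\<open>R_min_norm_bound\<close>).\<close>

lemma blip_min_norm:
  assumes "0 \<le> N"
  shows "blip 1 (\<lambda>x::'a::euclidean_space. min N (norm x))"
proof (rule blipI)
  show "\<bar>min N (norm x)\<bar> \<le> N" for x :: 'a using assms by (simp add: min_def)
  show "min N (norm x) - min N (norm y) \<le> 1 * norm (x - y)" for x y :: 'a
    using norm_triangle_ineq2[of x y] norm_ge_zero[of "x - y"] unfolding min_def by (smt (verit))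
qed simp

text \<open>Inf-convolution with a multiple of the norm.\<close>

lemma lipschitz_approx:
  fixes f :: "'a::euclidean_space \<Rightarrow> real"
  assumes f: "f \<in> bcontfun" and r: "\<And>x. \<bar>f x\<bar> \<le> r" and \<delta>: "\<delta> > 0"
  obtains g \<Lambda> where "blip \<Lambda> g" "\<forall>x. \<bar>g x\<bar> \<le> r" "\<forall>x. norm x \<le> M \<longrightarrow> \<bar>f x - g x\<bar> \<le> \<delta>"
proof -
  have "uniformly_continuous_on (cball 0 (M + 1)) f"
    using bcontfun_continuous[OF f]
    by (intro compact_uniformly_continuous) (auto intro: continuous_on_subset)
  then obtain d where d: "d > 0"
    "\<And>x y. x \<in> cball 0 (M+1) \<Longrightarrow> y \<in> cball 0 (M+1) \<Longrightarrow> dist y x < d \<Longrightarrow> dist (f y) (f x) < \<delta>"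
    using \<delta> by (auto simp: uniformly_continuous_on_def)
  have r0: "0 \<le> r" using r[of 0] by linarith
  define d' where "d' = min d 1"
  define k where "k = 2 * r / d' + 1"
  have d': "d' > 0" "d' \<le> d" "d' \<le> 1" using d by (auto simp: d'_def)
  have k: "k > 0" "k * d' > 2 * r" using d' r0 by (auto simp: k_def field_simps add_nonneg_pos)
  define F where "F x y = f y + k * norm (x - y)" for x y
  define g where "g x = (INF y. F x y)" for x
  have Flow: "- r \<le> F x y" for x y
  proof -
    have "0 \<le> k * norm (x - y)" using k(1) by simp
    then show ?thesis using r[of y] unfolding F_def by linarith
  qed
  have bdd: "bdd_below (range (F x))" for x
    using Flow by (intro bdd_belowI[of _ "-r"]) auto
  have gle: "g x \<le> F x y" for x y unfolding g_def using bdd by (intro cINF_lower) auto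
  have gge: "c \<le> g x" if "\<And>y. c \<le> F x y" for c x
    unfolding g_def using that by (intro cINF_greatest) auto
  have gf: "g x \<le> f x" for x using gle[of x x] by (simp add: F_def)
  have gr: "\<bar>g x\<bar> \<le> r" for x using gge[OF Flow, of x] gf[of x] r[of x] by linarith
  have lip: "g x - g z \<le> k * norm (x - z)" for x z
  proof -
    have "g x - k * norm (x - z) \<le> g z"
    proof (rule gge)
      fix y
      have "norm (x - y) \<le> norm (x - z) + norm (z - y)" using norm_triangle_ineq[of "x-z" "z-y"] by simp
      then have "k * norm (x - y) \<le> k * norm (x - z) + k * norm (z - y)"
        using k(1) by (metis distrib_left mult_left_mono less_imp_le)
      then show "g x - k * norm (x - z) \<le> F z y" using gle[of x y] by (simp add: F_def)
    qed
    then show ?thesis by simp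
  qed
  have "\<bar>f x - g x\<bar> \<le> \<delta>" if x: "x \<in> cball 0 M" for x
  proof -
    have "f x - \<delta> \<le> g x"
    proof (rule gge)
      fix y
      show "f x - \<delta> \<le> F x y"
      proof (cases "norm (x - y) < d'")
        case True
        have "norm y \<le> norm x + norm (x - y)" by (metis norm_minus_commute norm_triangle_sub)
        then have "dist (f y) (f x) < \<delta>" using True d' x
          by (intro d) (auto simp: dist_norm norm_minus_commute)
        moreover have "0 \<le> k * norm (x - y)" using k(1) by simp
        ultimately show ?thesis unfolding F_def dist_real_def by linarith
      next
        case False
        then have "k * d' \<le> k * norm (x - y)" using k(1) by simp
        then show ?thesis using k(2) r[of x] r[of y] \<delta> unfolding F_def abs_le_iff by linarith
      qed
    qed
    then show ?thesis using gf[of x] by simp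
  qed
  then have "\<forall>x. norm x \<le> M \<longrightarrow> \<bar>f x - g x\<bar> \<le> \<delta>" by simp
  then show ?thesis using that[of k g] blipI[of k g r] gr lip k(1) by auto
qed

text \<open>Convergence on a finite net of mesh \<open>d\<close> spreads to all of \<open>K\<close>,
  because the Lipschitz bound passes to the limit function.\<close>

lemma equilipschitz_uniform_limit:
  fixes F :: "nat \<Rightarrow> 'a::euclidean_space \<Rightarrow> real"
  assumes lip: "\<And>n. \<Lambda>-lipschitz_on UNIV (F n)" and lim: "\<And>x. (\<lambda>n. F n x) \<longlonglongrightarrow> f x"
    and K: "compact K"
  shows "uniform_limit K F f sequentially"
proof (rule uniform_limitI)
  fix e :: real assume e: "e > 0"
  have \<Lambda>: "\<Lambda> \<ge> 0" using lip[of 0] by (rule lipschitz_on_nonneg)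
  define d where "d = e / (3 * (\<Lambda> + 1))"
  have d: "d > 0" "\<Lambda> * d < e / 3"
    using e \<Lambda> by (auto simp: d_def field_simps)
  have Fd: "\<bar>F n x - F n y\<bar> \<le> \<Lambda> * norm (x - y)" for n x y
    using lipschitz_on_normD[OF lip] by auto
  have fd: "\<bar>f x - f y\<bar> \<le> \<Lambda> * norm (x - y)" for x y
    by (rule LIMSEQ_le_const2[where X="\<lambda>n. \<bar>F n x - F n y\<bar>"])
      (use Fd in \<open>auto intro!: tendsto_intros lim\<close>)
  obtain A where A: "A \<subseteq> K" "finite A" "K \<subseteq> (\<Union>c\<in>A. ball c d)"
    using compactE_image[OF K, of K "\<lambda>c. ball c d"] d(1) by (metis UN_I centre_in_ball open_ball subsetI)
  have "\<forall>c\<in>A. \<forall>\<^sub>F n in sequentially. \<bar>F n c - f c\<bar> < e / 3"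
    using tendstoD[OF lim, of "e/3"] e by (auto simp: dist_real_def)
  then have "\<forall>\<^sub>F n in sequentially. \<forall>c\<in>A. \<bar>F n c - f c\<bar> < e / 3"
    using A(2) by (simp add: eventually_ball_finite_distrib)
  then show "\<forall>\<^sub>F n in sequentially. \<forall>x\<in>K. dist (F n x) (f x) < e"
  proof eventually_elim
    case (elim n)
    show ?case
    proof
      fix x assume "x \<in> K"
      then obtain c where c: "c \<in> A" "norm (x - c) < d" using A(3) by (auto simp: dist_norm norm_minus_commute)
      have "\<Lambda> * norm (x - c) \<le> \<Lambda> * d" using c \<Lambda> by (intro mult_left_mono) auto
      moreover have "\<bar>F n c - f c\<bar> < e / 3" using elim c(1) by blast
      ultimately show "dist (F n x) (f x) < e"
        using Fd[of n x c] fd[of x c] d(2) unfolding dist_real_def by linarith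
    qed
  qed
qed

section \<open>Sup norm, step counts and mixed limits\<close>

lemma sup_norm_le: "(\<And>x. \<bar>f x\<bar> \<le> r) \<Longrightarrow> sup_norm f \<le> r"
  unfolding sup_norm_def by (rule cSUP_least) auto

lemma le_sup_norm:
  assumes "\<And>x. \<bar>f x\<bar> \<le> r"
  shows "\<bar>f x\<bar> \<le> sup_norm f"
  unfolding sup_norm_def using assms by (intro cSUP_upper bdd_aboveI[of _ r]) auto

text \<open>\<open>Max\<close> is informative only on finite nonempty sets; here the set is
  recognised as the initial segment up to the floor of \<open>t / h\<close>.\<close>

lemma step_count_properties:
  assumes "0 < h" "0 \<le> t"
  shows "real (step_count h t) * h \<le> t" "t < real (step_count h t) * h + h"
proof -
  have "real k * h \<le> t \<longleftrightarrow> k \<le> nat \<lfloor>t / h\<rfloor>" for k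
    using assms by (simp add: le_nat_iff le_floor_iff pos_le_divide_eq)
  then have eq: "{k. real k * h \<le> t} = {..nat \<lfloor>t / h\<rfloor>}" by auto
  have sc: "step_count h t = nat \<lfloor>t / h\<rfloor>"
    unfolding step_count_def eq by (rule Max_eqI) auto
  have "0 \<le> \<lfloor>t / h\<rfloor>" using assms by simp
  then have *: "real (nat \<lfloor>t / h\<rfloor>) \<le> t / h" "t / h < real (nat \<lfloor>t / h\<rfloor>) + 1" by linarith+
  show "real (step_count h t) * h \<le> t" "t < real (step_count h t) * h + h"
    using * assms(1) unfolding sc by (simp_all add: pos_le_divide_eq pos_divide_less_eq distrib_right)
qed

lemma step_count_eqI:
  assumes "0 < h" "0 \<le> t" "real k * h \<le> t" "t < real k * h + h"
  shows "step_count h t = k"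
proof -
  note * = step_count_properties[OF assms(1,2)]
  have "real (step_count h t) * h < (real k + 1) * h" "real k * h < (real (step_count h t) + 1) * h"
    using * assms by (auto simp: algebra_simps)
  then show ?thesis using assms(1) by simp
qed

lemma mixed_lim_tendsto: "mixed_lim F f \<Longrightarrow> (\<lambda>n. F n x) \<longlonglongrightarrow> f x"
  unfolding mixed_lim_def by (metis compact_sing insertI1 tendsto_uniform_limitI)

lemma mixed_lim_unique: "mixed_lim F f \<Longrightarrow> mixed_lim F g \<Longrightarrow> f = g"
proof
  fix x assume "mixed_lim F f" "mixed_lim F g"
  then have "(\<lambda>n. F n x) \<longlonglongrightarrow> f x" "(\<lambda>n. F n x) \<longlonglongrightarrow> g x"
    by (auto intro: mixed_lim_tendsto)
  then show "f x = g x" by (rule LIMSEQ_unique)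
qed

lemma has_generator_value_unique: "has_generator_value T f g \<Longrightarrow> has_generator_value T f g' \<Longrightarrow> g = g'"
  unfolding has_generator_value_def mixed_lim_at_0_def
  \<comment> \<open>The limit at 0 is phrased through sequences; a single null sequence of positive
    times decides uniqueness.\<close>
  using LIMSEQ_inverse_real_of_nat
  by (auto intro!: mixed_lim_unique dest!: spec[of _ "\<lambda>n. inverse (real (Suc n))"])

lemma generator_eqI: "has_generator_value T f g \<Longrightarrow> generator T f = g"
  unfolding generator_def by (rule the_equality) (auto intro: has_generator_value_unique)

lemma mixed_limI:
  fixes f :: "'a::euclidean_space \<Rightarrow> real"
  assumes "\<And>n. F n \<in> bcontfun" "f \<in> bcontfun" "\<And>n x. \<bar>F n x\<bar> \<le> r"
    "\<And>M e. e > 0 \<Longrightarrow> \<forall>\<^sub>F n in sequentially. \<forall>x\<in>cball 0 M. \<bar>F n x - f x\<bar> \<le> e"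
  shows "mixed_lim F f"
  unfolding mixed_lim_def
proof (intro conjI allI impI)
  show "bdd_above (range (\<lambda>n. sup_norm (F n)))"
    using assms(3) by (intro bdd_aboveI[of _ r]) (auto intro: sup_norm_le)
  show "uniform_limit K F f sequentially" if K: "compact K" for K
  proof (rule uniform_limitI)
    fix e :: real assume e: "e > 0"
    obtain M where "K \<subseteq> cball 0 M" using compact_imp_bounded[OF K]
      by (auto simp: bounded_iff subset_iff)
    moreover have "\<forall>\<^sub>F n in sequentially. \<forall>x\<in>cball 0 M. dist (F n x) (f x) \<le> e / 2"
      using assms(4)[OF half_gt_zero[OF e], of M] by (simp add: dist_real_def)
    ultimately show "\<forall>\<^sub>F n in sequentially. \<forall>x\<in>K. dist (F n x) (f x) < e"
      using e half_gt_zero[OF e] by (elim eventually_mono) (smt (verit) field_sum_of_halves subsetD)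
  qed
qed (use assms in auto)

lemma mixed_limD:
  assumes "mixed_lim F f" "e > 0"
  shows "\<forall>\<^sub>F n in sequentially. \<forall>x\<in>cball 0 M. \<bar>F n x - f x\<bar> \<le> e"
proof -
  have "uniform_limit (cball 0 M) F f sequentially" using assms(1) by (auto simp: mixed_lim_def)
  from uniform_limitD[OF this assms(2)] show ?thesis
    by (auto elim!: eventually_mono simp: dist_real_def less_imp_le)
qed

lemma mixed_lim_bcontfun: "mixed_lim F f \<Longrightarrow> f \<in> bcontfun" "mixed_lim F f \<Longrightarrow> F n \<in> bcontfun"
  by (auto simp: mixed_lim_def)

lemma mixed_lim_bound:
  assumes "mixed_lim F f"
  obtains r where "r \<ge> 0" "\<And>n x. \<bar>F n x\<bar> \<le> r" "\<And>x. \<bar>f x\<bar> \<le> r"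
proof -
  obtain r where r: "\<And>n. sup_norm (F n) \<le> r" using assms by (auto simp: mixed_lim_def bdd_above_def)
  have 1: "\<bar>F n x\<bar> \<le> r" for n x
  proof -
    obtain s where "\<And>x. \<bar>F n x\<bar> \<le> s" using bcontfun_bound[OF mixed_lim_bcontfun(2)[OF assms, of n]] by blast
    then have "\<bar>F n x\<bar> \<le> sup_norm (F n)" by (rule le_sup_norm)
    then show ?thesis using r[of n] by linarith
  qed
  have 2: "\<bar>f x\<bar> \<le> r" for x
    by (rule LIMSEQ_le_const2[OF tendsto_rabs[OF mixed_lim_tendsto[OF assms]]]) (use 1 in auto)
  show ?thesis using that[of r] 1 2 abs_ge_zero[of "f 0"] by (meson order_trans)
qed

section \<open>Functions with a quadratic first-order remainder\<close>

text \<open>A substitute for a bounded second derivative that mentions no differentiability: bounded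
  smooth functions satisfy it with \<open>G = grad g\<close>, mollified Lipschitz functions with an
  explicit \<open>G\<close>. Besides a Lipschitz bound it is all the smoothness that the one-step
  comparison and the generator use.\<close>

definition quadratic_remainder :: "real \<Rightarrow> ('a::euclidean_space \<Rightarrow> 'a) \<Rightarrow> ('a \<Rightarrow> real) \<Rightarrow> bool" where
  "quadratic_remainder K G g \<longleftrightarrow> 0 \<le> K \<and> (\<forall>z c. \<bar>g (z + c) - g z - G z \<bullet> c\<bar> \<le> K * (norm c)\<^sup>2)"

lemma quadratic_remainderD:
  "quadratic_remainder K G g \<Longrightarrow> \<bar>g (z + c) - g z - G z \<bullet> c\<bar> \<le> K * (norm c)\<^sup>2"
  "quadratic_remainder K G g \<Longrightarrow> 0 \<le> K"
  by (auto simp: quadratic_remainder_def)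

text \<open>Comparing the expansions along both sides of the parallelogram spanned by \<open>u\<close> and \<open>e\<close>.\<close>

lemma quadratic_remainder_lipschitz:
  fixes G :: "'a::euclidean_space \<Rightarrow> 'a"
  assumes g: "quadratic_remainder K G g"
  shows "norm (G x - G y) \<le> 6 * K * norm (x - y)"
proof -
  define u where "u = x - y"
  define d where "d = G x - G y"
  have K: "0 \<le> K" using g by (rule quadratic_remainderD)
  show ?thesis
  proof (cases "u = 0 \<or> d = 0")
    case True
    then show ?thesis using K by (auto simp: u_def d_def)
  next
    case False
    define e where "e = (norm u / norm d) *\<^sub>R d"
    have ne: "norm e = norm u" using False by (simp add: e_def)
    have de: "d \<bullet> e = norm u * norm d"
      using False by (simp add: e_def power2_norm_eq_inner[symmetric] power2_eq_square)
    note q = quadratic_remainderD(1)[OF g]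
    have 1: "\<bar>g (x + e) - g x - G x \<bullet> e\<bar> \<le> K * (norm u)\<^sup>2" using q[of x e] ne by simp
    have 2: "\<bar>g (x + e) - g y - G y \<bullet> (u + e)\<bar> \<le> K * (4 * (norm u)\<^sup>2)"
    proof -
      have "norm (u + e) \<le> 2 * norm u" using norm_triangle_ineq[of u e] ne by simp
      then have "(norm (u + e))\<^sup>2 \<le> (2 * norm u)\<^sup>2" by (rule power_mono) simp
      then have "K * (norm (u + e))\<^sup>2 \<le> K * (4 * (norm u)\<^sup>2)" using K
        by (intro mult_left_mono) (auto simp: power_mult_distrib)
      moreover have eq: "y + (u + e) = x + e" by (simp add: u_def)
      ultimately show ?thesis using q[of y "u + e", unfolded eq] by linarith
    qed
    have 3: "\<bar>g x - g y - G y \<bullet> u\<bar> \<le> K * (norm u)\<^sup>2" using q[of y u] by (simp add: u_def)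
    have "d \<bullet> e = (g (x + e) - g y - G y \<bullet> (u + e)) - (g (x + e) - g x - G x \<bullet> e) - (g x - g y - G y \<bullet> u)"
      by (simp add: d_def inner_add_right inner_diff_left)
    then have "norm u * norm d \<le> 6 * K * (norm u)\<^sup>2" using 1 2 3 de by linarith
    then have "norm d \<le> 6 * K * norm u" using False by (simp add: power2_eq_square)
    then show ?thesis by (simp add: d_def u_def)
  qed
qed

text \<open>A step of length \<open>s\<close> along \<open>G z\<close> gains
  \<open>s * norm (G z)\<close> up to \<open>K s^2\<close>, yet at most \<open>\<Lambda> s\<close>;
  dividing by \<open>s\<close> and letting \<open>s\<close> tend to 0 removes
  \<open>K\<close>.\<close>

lemma quadratic_remainder_norm_le:
  fixes G :: "'a::euclidean_space \<Rightarrow> 'a"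
  assumes g: "quadratic_remainder K G g" and l: "blip \<Lambda> g"
  shows "norm (G z) \<le> \<Lambda>"
proof (cases "G z = 0")
  case True then show ?thesis using blip_nonneg[OF l] by simp
next
  case False
  have K: "0 \<le> K" using g by (rule quadratic_remainderD)
  have *: "norm (G z) \<le> \<Lambda> + K * s" if s: "s > 0" for s
  proof -
    define c where "c = (s / norm (G z)) *\<^sub>R G z"
    have nc: "norm c = s" using False s by (simp add: c_def)
    have "G z \<bullet> c = s * norm (G z)"
      using False by (simp add: c_def power2_norm_eq_inner[symmetric] power2_eq_square)
    moreover have "G z \<bullet> c \<le> \<Lambda> * s + K * s\<^sup>2"
      using quadratic_remainderD(1)[OF g, of z c] blip_add_diff(2)[OF l, of z c] nc by simp
    ultimately have "s * norm (G z) \<le> s * (\<Lambda> + K * s)"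
      by (simp add: algebra_simps power2_eq_square)
    then show ?thesis using s by simp
  qed
  show ?thesis
  proof (rule field_le_epsilon)
    fix e :: real assume e: "e > 0"
    have "K * (e / (K + 1)) \<le> e" using K e by (simp add: field_simps)
    then show "norm (G z) \<le> \<Lambda> + e" using *[of "e / (K + 1)"] K e by simp
  qed
qed

text \<open>Noise \<open>u\<close> comes before the drift \<open>e\<close>, while the drift is tuned
  to the gradient at \<open>z\<close> alone. Moving the gradient from \<open>z + u\<close> back to
  \<open>z\<close> costs its Lipschitz constant \<open>6 * K\<close>.\<close>

lemma quadratic_remainder_increment:
  fixes G :: "'a::euclidean_space \<Rightarrow> 'a"
  assumes g: "quadratic_remainder K G g"
  shows "\<bar>g (z + u + e) - g (z + u) - G z \<bullet> e\<bar> \<le> 6 * K * norm e * (norm u + norm e)"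
proof -
  have K: "0 \<le> K" using g by (rule quadratic_remainderD)
  have "\<bar>(G (z + u) - G z) \<bullet> e\<bar> \<le> norm (G (z + u) - G z) * norm e"
    by (rule Cauchy_Schwarz_ineq2)
  also have "\<dots> \<le> 6 * K * norm u * norm e"
    using quadratic_remainder_lipschitz[OF g, of "z + u" z] by (intro mult_right_mono) auto
  finally have 1: "\<bar>G (z + u) \<bullet> e - G z \<bullet> e\<bar> \<le> 6 * K * norm u * norm e" by (simp add: inner_diff_left)
  have 2: "\<bar>g (z + u + e) - g (z + u) - G (z + u) \<bullet> e\<bar> \<le> K * (norm e)\<^sup>2"
    by (rule quadratic_remainderD(1)[OF g])
  have 3: "0 \<le> K * (norm e)\<^sup>2" using K by simp
  show ?thesis using 1 2 3 by (simp add: algebra_simps power2_eq_square abs_le_iff)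
qed

section \<open>Smooth bounded functions\<close>

lemma bounded_partials_onorm:
  fixes g :: "'a::euclidean_space \<Rightarrow> real"
  assumes d: "\<And>x. g differentiable at x" and b: "\<And>b x. b \<in> Basis \<Longrightarrow> \<bar>frechet_derivative g (at x) b\<bar> \<le> B b"
  shows "norm (g x - g y) \<le> (\<Sum>b\<in>Basis. B b) * norm (x - y)"
proof (rule differentiable_bound[OF convex_UNIV])
  fix x :: 'a
  show "(g has_derivative frechet_derivative g (at x)) (at x within UNIV)"
    using d by (simp add: frechet_derivative_works[symmetric])
  show "onorm (frechet_derivative g (at x)) \<le> (\<Sum>b\<in>Basis. B b)"
  proof (rule onorm_bound)
    show "0 \<le> (\<Sum>b\<in>(Basis::'a set). B b)" using b abs_ge_zero order_trans by (intro sum_nonneg) blast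
    fix c :: 'a
    have lin: "linear (frechet_derivative g (at x))" by (rule linear_frechet_derivative[OF d])
    have "frechet_derivative g (at x) c = frechet_derivative g (at x) (\<Sum>b\<in>Basis. (c \<bullet> b) *\<^sub>R b)"
      by (simp add: euclidean_representation)
    also have "\<dots> = (\<Sum>b\<in>Basis. (c \<bullet> b) * frechet_derivative g (at x) b)"
      by (simp add: linear_sum[OF lin] linear_scale[OF lin])
    also have "norm \<dots> \<le> (\<Sum>b\<in>Basis. B b * norm c)"
    proof (rule sum_norm_le)
      fix i :: 'a assume i: "i \<in> Basis"
      have "\<bar>c \<bullet> i\<bar> * \<bar>frechet_derivative g (at x) i\<bar> \<le> norm c * B i"
        using Basis_le_norm[OF i, of c] b[OF i] by (intro mult_mono) auto
      then show "norm ((c \<bullet> i) * frechet_derivative g (at x) i) \<le> B i * norm c"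
        by (simp add: abs_mult mult.commute)
    qed
    finally show "norm (frechet_derivative g (at x) c) \<le> (\<Sum>b\<in>Basis. B b) * norm c"
      by (simp add: sum_distrib_right)
  qed
qed auto

lemma grad_inner:
  assumes "f differentiable at x"
  shows "grad f x \<bullet> c = frechet_derivative f (at x) c"
proof -
  have lin: "linear (frechet_derivative f (at x))" by (rule linear_frechet_derivative[OF assms])
  have "frechet_derivative f (at x) c = frechet_derivative f (at x) (\<Sum>b\<in>Basis. (c \<bullet> b) *\<^sub>R b)"
    by (simp add: euclidean_representation)
  also have "\<dots> = (\<Sum>b\<in>Basis. (c \<bullet> b) * frechet_derivative f (at x) b)"
    by (simp add: linear_sum[OF lin] linear_scale[OF lin])
  also have "\<dots> = grad f x \<bullet> c"
    by (simp add: grad_def inner_sum_left inner_commute[of c] mult.commute)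
  finally show ?thesis by simp
qed

text \<open>First partials bound the Lipschitz constant, second partials that of the gradient; the
  quadratic remainder is then the mean value inequality for \<open>f\<close> minus its linear part
  on the ball around \<open>z\<close> through \<open>z + c\<close>.\<close>

lemma Cb_smooth_quadratic:
  fixes f :: "'a::euclidean_space \<Rightarrow> real"
  assumes "f \<in> Cb_smooth"
  obtains \<Lambda> K where "blip \<Lambda> f" "quadratic_remainder K (grad f) f"
proof -
  have diff: "partial_derivs bs f differentiable at x" if "bs \<in> lists Basis" for bs x
    using assms that by (auto simp: Cb_smooth_def smooth_def)
  have "\<exists>r. \<forall>x. \<bar>partial_derivs bs f x\<bar> \<le> r" if "bs \<in> lists Basis" for bs
    using assms that by (fastforce simp: Cb_smooth_def bounded_iff)
  then obtain r where r: "\<And>bs x. bs \<in> lists Basis \<Longrightarrow> \<bar>partial_derivs bs f x\<bar> \<le> r bs" by metis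
  have lip: "\<bar>partial_derivs bs f x - partial_derivs bs f y\<bar> \<le> (\<Sum>b\<in>Basis. r (b # bs)) * norm (x - y)"
    if bs: "bs \<in> lists Basis" for bs x y
    using bounded_partials_onorm[of "partial_derivs bs f" "\<lambda>b. r (b # bs)" x y] diff[OF bs] r[of "_ # bs"] bs
    by auto
  have s0: "0 \<le> (\<Sum>b\<in>Basis. r (b # bs))" if "bs \<in> lists Basis" for bs
    by (intro sum_nonneg order_trans[OF abs_ge_zero r]) (use that in auto)
  have d0: "f differentiable at x" for x using diff[of "[]"] by simp
  define \<Lambda> where "\<Lambda> = (\<Sum>b\<in>Basis. r [b])"
  have "blip \<Lambda> f"
  proof (rule blipI)
    show "0 \<le> \<Lambda>" using s0[of "[]"] by (simp add: \<Lambda>_def)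
    show "\<bar>f x\<bar> \<le> r []" for x using r[of "[]"] by simp
    show "f x - f y \<le> \<Lambda> * norm (x - y)" for x y using lip[of "[]" x y] by (simp add: \<Lambda>_def)
  qed
  \<comment> \<open>The head of the list is the outermost derivative, so \<open>C b\<close> is a
    Lipschitz constant of the partial derivative in direction \<open>b\<close>.\<close>
  define C where "C b = (\<Sum>b'\<in>Basis. r [b', b])" for b
  define K where "K = (\<Sum>b\<in>(Basis::'a set). C b)"
  have C0: "0 \<le> C b" if "b \<in> Basis" for b using s0[of "[b]"] that by (simp add: C_def)
  have K0: "0 \<le> K" unfolding K_def by (intro sum_nonneg C0)
  have gl: "norm (grad f x - grad f y) \<le> K * norm (x - y)" for x y
  proof -
    have "grad f x - grad f y = (\<Sum>b\<in>Basis. (partial_derivs [b] f x - partial_derivs [b] f y) *\<^sub>R b)"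
      by (simp add: grad_def sum_subtractf scaleR_diff_left)
    also have "norm \<dots> \<le> (\<Sum>b\<in>Basis. C b * norm (x - y))"
      using lip[of "[_]" x y] by (intro sum_norm_le) (simp add: C_def)
    finally show ?thesis by (simp add: K_def sum_distrib_right)
  qed
  have "quadratic_remainder K (grad f) f"
    unfolding quadratic_remainder_def
  proof (intro conjI allI K0)
    fix z c :: 'a
    have "norm (f (z + c) - f z - frechet_derivative f (at z) (z + c - z)) \<le> norm (z + c - z) * (K * norm c)"
    proof (rule differentiable_bound_linearization[where S="cball z (norm c)" and f'="\<lambda>x. frechet_derivative f (at x)"])
      show "z + t *\<^sub>R (z + c - z) \<in> cball z (norm c)" if "t \<in> {0..1}" for t
        using that by (auto simp: dist_norm intro: mult_left_le_one_le)
      show "(f has_derivative frechet_derivative f (at x)) (at x within cball z (norm c))" for x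
        using d0 by (simp add: frechet_derivative_works[symmetric] has_derivative_at_withinI)
      show "onorm (frechet_derivative f (at x) - frechet_derivative f (at z)) \<le> K * norm c"
        if "x \<in> cball z (norm c)" for x
      proof (rule onorm_bound)
        show "0 \<le> K * norm c" using K0 by simp
        fix v
        have "norm ((frechet_derivative f (at x) - frechet_derivative f (at z)) v) = \<bar>(grad f x - grad f z) \<bullet> v\<bar>"
          by (simp add: inner_diff_left grad_inner[OF d0])
        also have "\<dots> \<le> norm (grad f x - grad f z) * norm v" by (rule Cauchy_Schwarz_ineq2)
        also have "\<dots> \<le> K * norm c * norm v"
        proof (rule mult_right_mono)
          have "norm (x - z) \<le> norm c" using that by (simp add: dist_norm norm_minus_commute)
          then show "norm (grad f x - grad f z) \<le> K * norm c"
            using gl[of x z] K0 by (meson mult_left_mono order_trans)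
        qed simp
        finally show "norm ((frechet_derivative f (at x) - frechet_derivative f (at z)) v) \<le> K * norm c * norm v" .
      qed
    qed simp
    then show "\<bar>f (z + c) - f z - grad f z \<bullet> c\<bar> \<le> K * (norm c)\<^sup>2"
      by (simp add: grad_inner[OF d0] power2_eq_square mult_ac)
  qed
  then show ?thesis using \<open>blip \<Lambda> f\<close> that by blast
qed

section \<open>Mollification\<close>

text \<open>The kernel is a probability measure rather than a density: mollifying averages
  translates, and Fubini exchanges it with integrals against \<open>\<mu> t\<close>.\<close>

definition mollify :: "'a::euclidean_space measure \<Rightarrow> ('a \<Rightarrow> real) \<Rightarrow> 'a \<Rightarrow> real" where
  "mollify \<rho> u x = (\<integral>y. u (x + y) \<partial>\<rho>)"

definition is_mollifier :: "real \<Rightarrow> 'a::euclidean_space measure \<Rightarrow> bool" where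
  "is_mollifier \<epsilon> \<rho> \<longleftrightarrow> prob_space \<rho> \<and> sets \<rho> = sets borel \<and> (AE y in \<rho>. norm y \<le> \<epsilon>)"

text \<open>The square of \<open>a\<close> is the unnormalised kernel. The square of the positive
  part has a Lipschitz derivative, hence a quadratic first-order remainder; the indicator makes that
  remainder integrable. An increment of a convolution can then be put on the kernel instead of on
  the merely Lipschitz function.\<close>

lemma bump_increment:
  fixes y c :: "'a::euclidean_space"
  assumes c: "norm c \<le> 1" and \<epsilon>: "0 < \<epsilon>"
  defines "a \<equiv> (\<lambda>y. max 0 (\<epsilon>\<^sup>2 - (norm y)\<^sup>2))"
  shows "\<bar>(a (y - c))\<^sup>2 - (a y)\<^sup>2 - 4 * a y * (y \<bullet> c)\<bar>
    \<le> (2 * \<epsilon>\<^sup>2 + (2 * \<epsilon> + 3)\<^sup>2) * (norm c)\<^sup>2 * indicator (cball 0 (\<epsilon> + 1)) y"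
proof (cases "norm y \<le> \<epsilon> + 1")
  case False
  then have "norm (y - c) > \<epsilon>" using norm_triangle_ineq2[of y c] c by linarith
  then have "(norm (y - c))\<^sup>2 > \<epsilon>\<^sup>2" using \<epsilon> by (intro power_strict_mono) auto
  moreover have "(norm y)\<^sup>2 > \<epsilon>\<^sup>2" using \<epsilon> False by (intro power_strict_mono) auto
  ultimately have "a (y - c) = 0" "a y = 0" by (auto simp: a_def)
  then show ?thesis using False by simp
next
  case True
  \<comment> \<open>\<open>t\<close> is the paraboloid before truncation, \<open>\<tau>\<close> its
    change when \<open>y\<close> is replaced by \<open>y - c\<close>.\<close>
  define t where "t = \<epsilon>\<^sup>2 - (norm y)\<^sup>2"
  define \<tau> where "\<tau> = 2 * (y \<bullet> c) - (norm c)\<^sup>2"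
  have *: "0 \<le> (max 0 (t + \<tau>))\<^sup>2 - (max 0 t)\<^sup>2 - 2 * max 0 t * \<tau>"
    "(max 0 (t + \<tau>))\<^sup>2 - (max 0 t)\<^sup>2 - 2 * max 0 t * \<tau> \<le> \<tau>\<^sup>2"
  proof -
    consider "t \<ge> 0" "t + \<tau> \<ge> 0" | "t \<ge> 0" "t + \<tau> < 0" | "t < 0" "t + \<tau> \<ge> 0" | "t < 0" "t + \<tau> < 0" by linarith
    then show "0 \<le> (max 0 (t + \<tau>))\<^sup>2 - (max 0 t)\<^sup>2 - 2 * max 0 t * \<tau>"
      "(max 0 (t + \<tau>))\<^sup>2 - (max 0 t)\<^sup>2 - 2 * max 0 t * \<tau> \<le> \<tau>\<^sup>2"
    proof (atomize(full), cases)
      case 1 then show "0 \<le> (max 0 (t + \<tau>))\<^sup>2 - (max 0 t)\<^sup>2 - 2 * max 0 t * \<tau> \<and>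
        (max 0 (t + \<tau>))\<^sup>2 - (max 0 t)\<^sup>2 - 2 * max 0 t * \<tau> \<le> \<tau>\<^sup>2" by (simp add: power2_eq_square algebra_simps)
    next
      case 2
      have "t * (t + 2 * \<tau>) \<le> 0" using 2 by (intro mult_nonneg_nonpos) auto
      moreover have "0 \<le> (t + \<tau>)\<^sup>2" by simp
      ultimately show "0 \<le> (max 0 (t + \<tau>))\<^sup>2 - (max 0 t)\<^sup>2 - 2 * max 0 t * \<tau> \<and>
        (max 0 (t + \<tau>))\<^sup>2 - (max 0 t)\<^sup>2 - 2 * max 0 t * \<tau> \<le> \<tau>\<^sup>2" using 2
        by (simp add: max_def power2_eq_square algebra_simps)
    next
      case 3
      have "(t + \<tau>)\<^sup>2 \<le> \<tau>\<^sup>2" using 3 by (intro power_mono) auto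
      then show "0 \<le> (max 0 (t + \<tau>))\<^sup>2 - (max 0 t)\<^sup>2 - 2 * max 0 t * \<tau> \<and>
        (max 0 (t + \<tau>))\<^sup>2 - (max 0 t)\<^sup>2 - 2 * max 0 t * \<tau> \<le> \<tau>\<^sup>2" using 3 by (simp add: max_def)
    next
      case 4 then show "0 \<le> (max 0 (t + \<tau>))\<^sup>2 - (max 0 t)\<^sup>2 - 2 * max 0 t * \<tau> \<and>
        (max 0 (t + \<tau>))\<^sup>2 - (max 0 t)\<^sup>2 - 2 * max 0 t * \<tau> \<le> \<tau>\<^sup>2" by (simp add: max_def)
    qed
  qed
  have at: "a y = max 0 t" by (simp add: a_def t_def)
  have "(norm (y - c))\<^sup>2 = (norm y)\<^sup>2 - 2 * (y \<bullet> c) + (norm c)\<^sup>2"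
    by (simp add: power2_norm_eq_inner inner_diff_left inner_diff_right inner_commute)
  then have ac: "a (y - c) = max 0 (t + \<tau>)" by (simp add: a_def t_def \<tau>_def)
  have t2: "2 * max 0 t * (norm c)\<^sup>2 \<le> 2 * \<epsilon>\<^sup>2 * (norm c)\<^sup>2"
    by (intro mult_right_mono) (auto simp: t_def)
  have t0: "0 \<le> 2 * max 0 t * (norm c)\<^sup>2" by simp
  have "\<bar>\<tau>\<bar> \<le> 2 * (norm y * norm c) + (norm c)\<^sup>2"
    using Cauchy_Schwarz_ineq2[of y c] zero_le_power2[of "norm c"] unfolding \<tau>_def by linarith
  also have "\<dots> = (2 * norm y + norm c) * norm c" by (simp add: algebra_simps power2_eq_square)
  also have "\<dots> \<le> (2 * \<epsilon> + 3) * norm c" using True c by (intro mult_right_mono) auto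
  finally have "\<bar>\<tau>\<bar>\<^sup>2 \<le> ((2 * \<epsilon> + 3) * norm c)\<^sup>2" by (intro power_mono) auto
  then have \<tau>2: "\<tau>\<^sup>2 \<le> (2 * \<epsilon> + 3)\<^sup>2 * (norm c)\<^sup>2" by (simp add: power_mult_distrib)
  have "(a (y - c))\<^sup>2 - (a y)\<^sup>2 - 4 * a y * (y \<bullet> c)
     = ((max 0 (t + \<tau>))\<^sup>2 - (max 0 t)\<^sup>2 - 2 * max 0 t * \<tau>) - 2 * max 0 t * (norm c)\<^sup>2"
    by (simp add: at ac \<tau>_def algebra_simps)
  then have "\<bar>(a (y - c))\<^sup>2 - (a y)\<^sup>2 - 4 * a y * (y \<bullet> c)\<bar> \<le> \<tau>\<^sup>2 + 2 * max 0 t * (norm c)\<^sup>2"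
    using * t0 zero_le_power2[of \<tau>] by linarith
  also have "\<dots> \<le> (2 * \<epsilon>\<^sup>2 + (2 * \<epsilon> + 3)\<^sup>2) * (norm c)\<^sup>2"
    using t2 \<tau>2 by (simp add: algebra_simps)
  finally show ?thesis using True by simp
qed

lemma is_mollifierD:
  assumes "is_mollifier \<epsilon> \<rho>"
  shows "prob_space \<rho>" "sets \<rho> = sets borel" "AE y in \<rho>. norm y \<le> \<epsilon>"
  using assms by (auto simp: is_mollifier_def)

lemma integrable_mollify:
  fixes u :: "'a::euclidean_space \<Rightarrow> real"
  assumes "is_mollifier \<epsilon> \<rho>" "u \<in> bcontfun"
  shows "integrable \<rho> (\<lambda>y. u (x + y))"
proof -
  interpret prob_space \<rho> using is_mollifierD(1)[OF assms(1)] .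
  have "(\<lambda>y. x + y) \<in> borel_measurable \<rho>"
    by (simp add: measurable_cong_sets[OF is_mollifierD(2)[OF assms(1)] refl])
  then show ?thesis by (rule integrable_bcontfun_compose[OF finite_measure_axioms assms(2)])
qed

lemma mollify_abs_le:
  assumes m: "is_mollifier \<epsilon> \<rho>" and u: "u \<in> bcontfun" and r: "\<And>x. \<bar>u x\<bar> \<le> r"
  shows "\<bar>mollify \<rho> u x\<bar> \<le> r"
proof -
  interpret prob_space \<rho> using is_mollifierD(1)[OF m] .
  have "norm (mollify \<rho> u x) \<le> (\<integral>y. norm (u (x + y)) \<partial>\<rho>)"
    unfolding mollify_def by (rule integral_norm_bound)
  also have "\<dots> \<le> r"
    using integrable_norm[OF integrable_mollify[OF m u]] r
    by (intro integral_le_const) (auto intro: always_eventually)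
  finally show ?thesis by simp
qed

lemma blip_mollify:
  assumes m: "is_mollifier \<epsilon> \<rho>" and u: "blip \<Lambda> u"
  shows "blip \<Lambda> (mollify \<rho> u)"
proof -
  interpret prob_space \<rho> using is_mollifierD(1)[OF m] .
  note u' = blip_bcontfun[OF u]
  obtain r where r: "\<And>x. \<bar>u x\<bar> \<le> r" using bcontfun_bound[OF u'] by blast
  show ?thesis
  proof (rule blipI)
    show "0 \<le> \<Lambda>" using blip_nonneg[OF u] .
    show "\<bar>mollify \<rho> u x\<bar> \<le> r" for x by (rule mollify_abs_le[OF m u' r])
    fix x z
    have "mollify \<rho> u x - mollify \<rho> u z = (\<integral>y. u (x + y) - u (z + y) \<partial>\<rho>)"
      unfolding mollify_def by (intro Bochner_Integration.integral_diff[symmetric] integrable_mollify[OF m u'])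
    also have "\<dots> \<le> \<Lambda> * norm (x - z)"
      using blip_diff[OF u, of "x + y" "z + y" for y]
      by (intro integral_le_const Bochner_Integration.integrable_diff integrable_mollify[OF m u'])
        (auto intro!: always_eventually)
    finally show "mollify \<rho> u x - mollify \<rho> u z \<le> \<Lambda> * norm (x - z)" .
  qed
qed

lemma mollify_approx:
  assumes m: "is_mollifier \<epsilon> \<rho>" and u: "blip \<Lambda> u"
  shows "\<bar>mollify \<rho> u x - u x\<bar> \<le> \<Lambda> * \<epsilon>"
proof -
  interpret prob_space \<rho> using is_mollifierD(1)[OF m] .
  note i = integrable_mollify[OF m blip_bcontfun[OF u]]
  have "mollify \<rho> u x - u x = (\<integral>y. u (x + y) - u x \<partial>\<rho>)"
    unfolding mollify_def using i by (simp add: prob_space)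
  also have "norm \<dots> \<le> (\<integral>y. norm (u (x + y) - u x) \<partial>\<rho>)"
    by (rule integral_norm_bound)
  also have "\<dots> \<le> \<Lambda> * \<epsilon>"
  proof (rule integral_le_const)
    show "integrable \<rho> (\<lambda>y. norm (u (x + y) - u x))" using i by simp
    show "AE y in \<rho>. norm (u (x + y) - u x) \<le> \<Lambda> * \<epsilon>"
      using is_mollifierD(3)[OF m]
    proof eventually_elim
      case (elim y)
      have "\<Lambda> * norm y \<le> \<Lambda> * \<epsilon>" using elim blip_nonneg[OF u] by (rule mult_left_mono)
      then show ?case using blip_add_diff(2)[OF u, of x y] by simp
    qed
  qed
  finally show ?thesis by simp
qed

text \<open>A kernel with Lipschitz derivative suffices for a quadratic remainder, so a squared
  truncated paraboloid is taken. \<open>K\<close> depends on the bounds \<open>r\<close> and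
  \<open>\<Lambda>\<close> but not on \<open>u\<close>; this lets one constant serve all iterates of
  \<open>J\<close>.\<close>

lemma mollifier_exists:
  fixes \<epsilon> :: real
  assumes \<epsilon>: "\<epsilon> > 0"
  obtains \<rho> :: "'a::euclidean_space measure" where "is_mollifier \<epsilon> \<rho>"
    "\<And>r \<Lambda>. \<exists>K. \<forall>u. blip \<Lambda> u \<longrightarrow> (\<forall>x. \<bar>u x\<bar> \<le> r) \<longrightarrow> (\<exists>G. quadratic_remainder K G (mollify \<rho> u))"
proof -
  define a where "a y = max 0 (\<epsilon>\<^sup>2 - (norm y)\<^sup>2)" for y :: 'a
  define q where "q y = (a y)\<^sup>2" for y
  have a_cont: "continuous_on S (\<lambda>y. a (y - z))" for S z
    unfolding a_def by (intro continuous_intros)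
  have q_cont: "continuous_on S (\<lambda>y. q (y - z))" for S z
    unfolding q_def by (intro continuous_intros a_cont)
  have a0: "a y = 0" if "norm y > \<epsilon>" for y
  proof -
    have "(norm y)\<^sup>2 > \<epsilon>\<^sup>2" using \<epsilon> that by (intro power_strict_mono) auto
    then show ?thesis by (simp add: a_def)
  qed
  have supp: "(\<lambda>y. indicator (cball z \<epsilon>) y *\<^sub>R (a (y - z) *\<^sub>R F y)) = (\<lambda>y. a (y - z) *\<^sub>R F y)"
    for z and F :: "'a \<Rightarrow> 'b::real_normed_vector"
  proof
    fix y
    show "indicator (cball z \<epsilon>) y *\<^sub>R (a (y - z) *\<^sub>R F y) = a (y - z) *\<^sub>R F y"
      using a0[of "y - z"] by (cases "y \<in> cball z \<epsilon>") (auto simp: dist_norm norm_minus_commute)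
  qed
  have int_a: "integrable lborel (\<lambda>y. a (y - z) *\<^sub>R F y)" if "continuous_on UNIV F"
    for z and F :: "'a \<Rightarrow> 'b::{banach, second_countable_topology}"
    by (subst supp[symmetric], rule borel_integrable_compact)
      (auto intro!: continuous_intros a_cont continuous_on_subset[OF that])
  have int_qu: "integrable lborel (\<lambda>y. q (y - z) * u y)" if "continuous_on UNIV u" for z u
    using int_a[of "\<lambda>y. a (y - z) * u y" z] that
    by (simp add: q_def power2_eq_square mult_ac continuous_on_mult a_cont)
  have int_q: "integrable lborel q" using int_qu[of "\<lambda>_. 1" 0] by simp
  define Z where "Z = (\<integral>y. q y \<partial>lborel)"
  have q_nonneg: "0 \<le> q y" for y by (simp add: q_def)
  \<comment> \<open>Lower bound for the mass: on the ball of radius \<epsilon>/2 the paraboloid is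
    at least 3/4 of its height.\<close>
  have "0 < (\<epsilon>\<^sup>2 * 3 / 4)\<^sup>2 * measure lborel (cball (0::'a) (\<epsilon> / 2))"
    using \<epsilon> content_cball_pos[of "\<epsilon> / 2" "0::'a"] by simp
  also have "\<dots> = (\<integral>y. (\<epsilon>\<^sup>2 * 3 / 4)\<^sup>2 * indicator (cball (0::'a) (\<epsilon> / 2)) y \<partial>lborel)"
    by simp
  also have "\<dots> \<le> Z"
    unfolding Z_def
  proof (rule integral_mono[OF _ int_q])
    show "integrable lborel (\<lambda>y. (\<epsilon>\<^sup>2 * 3 / 4)\<^sup>2 * indicator (cball (0::'a) (\<epsilon> / 2)) y :: real)"
      by (intro integrable_mult_right integrable_real_indicator) (auto simp: emeasure_lborel_cball_finite[unfolded infinity_ennreal_def])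
    show "(\<epsilon>\<^sup>2 * 3 / 4)\<^sup>2 * indicator (cball 0 (\<epsilon> / 2)) y \<le> q y" for y :: 'a
    proof (cases "y \<in> cball 0 (\<epsilon> / 2)")
      case True
      then have "(norm y)\<^sup>2 \<le> (\<epsilon> / 2)\<^sup>2" by (intro power_mono) auto
      then have "\<epsilon>\<^sup>2 * 3 / 4 \<le> \<epsilon>\<^sup>2 - (norm y)\<^sup>2" by (simp add: power_divide)
      then have "\<epsilon>\<^sup>2 * 3 / 4 \<le> a y" unfolding a_def by linarith
      then have "(\<epsilon>\<^sup>2 * 3 / 4)\<^sup>2 \<le> q y" unfolding q_def by (intro power_mono) auto
      then show ?thesis using True by simp
    qed (simp add: q_nonneg)
  qed
  finally have Z: "Z > 0" .
  define \<rho> where "\<rho> = density lborel (\<lambda>y. ennreal (q y / Z))"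
  have q_meas[measurable]: "q \<in> borel_measurable borel"
    using borel_measurable_continuous_onI[OF q_cont[of UNIV 0]] by simp
  have "(\<integral>\<^sup>+y. ennreal (q y / Z) \<partial>lborel) = ennreal (\<integral>y. q y / Z \<partial>lborel)"
    using int_q Z by (intro nn_integral_eq_integral) (auto simp: q_nonneg)
  also have "\<dots> = 1" using Z by (simp add: Z_def)
  finally have \<rho>_prob: "prob_space \<rho>"
    by (intro prob_spaceI) (simp add: \<rho>_def emeasure_density)
  have q0: "norm y \<le> \<epsilon>" if "q y \<noteq> 0" for y using a0[of y] that by (force simp: q_def)
  have "AE y in \<rho>. norm y \<le> \<epsilon>"
    unfolding \<rho>_def by (subst AE_density) (auto intro!: always_eventually q0)
  moreover have "sets \<rho> = sets borel" by (simp add: \<rho>_def)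
  ultimately have mol: "is_mollifier \<epsilon> \<rho>" using \<rho>_prob by (simp add: is_mollifier_def)
  \<comment> \<open>Translation invariance of \<open>lborel\<close> moves \<open>x\<close> from the
    argument of \<open>u\<close> to the kernel.\<close>
  have mol_eq: "mollify \<rho> u x = (\<integral>y. q (y - x) * u y \<partial>lborel) / Z" if u: "u \<in> bcontfun" for u x
  proof -
    have um[measurable]: "u \<in> borel_measurable borel" using bcontfun_measurable[OF u] .
    have "mollify \<rho> u x = (\<integral>y. (q y / Z) * u (x + y) \<partial>lborel)"
      unfolding mollify_def \<rho>_def using Z
      by (subst integral_density) (auto simp: q_nonneg)
    also have "\<dots> = (\<integral>y. q ((x + y) - x) * u (x + y) / Z \<partial>lborel)" by (simp add: mult_ac)
    also have "\<dots> = (\<integral>y. q (y - x) * u y / Z \<partial>distr lborel borel ((+) x))"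
      by (subst integral_distr) auto
    finally show ?thesis by (simp add: lborel_distr_plus)
  qed
  have "\<exists>K. \<forall>u. blip \<Lambda> u \<longrightarrow> (\<forall>x. \<bar>u x\<bar> \<le> r) \<longrightarrow> (\<exists>G. quadratic_remainder K G (mollify \<rho> u))" for r \<Lambda>
  proof (cases "\<Lambda> \<ge> 0 \<and> r \<ge> 0")
    case False
    \<comment> \<open>No \<open>u\<close> meets a negative bound, so any constant will do.\<close>
    then show ?thesis by (metis blip_nonneg abs_ge_zero order_trans)
  next
    case True
    define K1 where "K1 = 2 * \<epsilon>\<^sup>2 + (2 * \<epsilon> + 3)\<^sup>2"
    define vol where "vol = unit_ball_vol (real (DIM('a))) * (\<epsilon> + 1) ^ DIM('a)"
    define K0 where "K0 = K1 * r * vol / Z"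
    define K where "K = K0 + 2 * \<Lambda>"
    have vol: "measure lborel (cball z (\<epsilon> + 1)) = vol" for z :: 'a
      using content_cball[of "\<epsilon> + 1" z] \<epsilon> by (simp add: vol_def)
    have "vol \<ge> 0" unfolding vol[of 0, symmetric] by simp
    moreover have "K1 \<ge> 0" by (simp add: K1_def)
    ultimately have K0: "K0 \<ge> 0" using Z True by (simp add: K0_def)
    show ?thesis
    proof (intro exI[of _ K] allI impI)
      fix u :: "'a \<Rightarrow> real" assume u: "blip \<Lambda> u" and r: "\<forall>x. \<bar>u x\<bar> \<le> r"
      note ub = blip_bcontfun[OF u]
      note uc = bcontfun_continuous[OF ub]
      \<comment> \<open>The gradient of \<open>q (y - z)\<close> in \<open>z\<close> is
        \<open>4 * a (y - z)\<close> times \<open>y - z\<close>; integrated against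
        \<open>u / Z\<close> it becomes the gradient of the mollified function.\<close>
      define G where "G z = (\<integral>y. a (y - z) *\<^sub>R ((4 * u y / Z) *\<^sub>R (y - z)) \<partial>lborel)" for z
      have intG: "integrable lborel (\<lambda>y. a (y - z) *\<^sub>R ((4 * u y / Z) *\<^sub>R (y - z)))" for z
        by (rule int_a) (use Z in \<open>auto intro!: continuous_intros uc\<close>)
      have small: "\<bar>mollify \<rho> u (z + c) - mollify \<rho> u z - G z \<bullet> c\<bar> \<le> K0 * (norm c)\<^sup>2"
        if c: "norm c \<le> 1" for z c
      proof -
        have "G z \<bullet> c = (\<integral>y. a (y - z) * (4 * u y / Z) * ((y - z) \<bullet> c) \<partial>lborel)"
          unfolding G_def using integral_inner_left[OF intG[of z], of c] by (simp add: mult_ac)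
        moreover have iG: "integrable lborel (\<lambda>y. a (y - z) * (4 * u y / Z) * ((y - z) \<bullet> c))"
          using integrable_inner_left[OF intG[of z], of c] by (simp add: mult_ac)
        moreover have i1: "integrable lborel (\<lambda>y. q (y - x) * u y / Z)" for x
          using int_qu[OF uc] by simp
        ultimately have A: "mollify \<rho> u (z + c) - mollify \<rho> u z - G z \<bullet> c
          = (\<integral>y. q (y - (z + c)) * u y / Z - q (y - z) * u y / Z - a (y - z) * (4 * u y / Z) * ((y - z) \<bullet> c) \<partial>lborel)"
          using Z by (simp add: mol_eq[OF ub])
        have B: "norm (\<integral>y. q (y - (z + c)) * u y / Z - q (y - z) * u y / Z - a (y - z) * (4 * u y / Z) * ((y - z) \<bullet> c) \<partial>lborel)
          \<le> (\<integral>y. K1 * (norm c)\<^sup>2 * r / Z * indicator (cball z (\<epsilon> + 1)) y \<partial>lborel)"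
        proof (rule Bochner_Integration.integral_norm_bound_integral)
          show "integrable lborel (\<lambda>y. q (y - (z + c)) * u y / Z - q (y - z) * u y / Z
              - a (y - z) * (4 * u y / Z) * ((y - z) \<bullet> c))"
            by (intro Bochner_Integration.integrable_diff i1 iG)
          show "integrable lborel (\<lambda>y. K1 * (norm c)\<^sup>2 * r / Z * indicator (cball z (\<epsilon> + 1)) y :: real)"
            by (intro integrable_mult_right integrable_real_indicator) (auto simp: emeasure_lborel_cball_finite[unfolded infinity_ennreal_def])
          fix y
          have "(q (y - (z + c)) * u y / Z - q (y - z) * u y / Z - a (y - z) * (4 * u y / Z) * ((y - z) \<bullet> c))
             = ((a ((y - z) - c))\<^sup>2 - (a (y - z))\<^sup>2 - 4 * a (y - z) * ((y - z) \<bullet> c)) * (u y / Z)"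
            by (simp add: q_def algebra_simps diff_divide_distrib)
          also have "norm \<dots> = \<bar>(a ((y - z) - c))\<^sup>2 - (a (y - z))\<^sup>2 - 4 * a (y - z) * ((y - z) \<bullet> c)\<bar> * (\<bar>u y\<bar> / Z)"
            using Z by (simp add: abs_mult)
          also have "\<dots> \<le> (K1 * (norm c)\<^sup>2 * indicator (cball 0 (\<epsilon> + 1)) (y - z)) * (r / Z)"
            using bump_increment[OF c \<epsilon>, of "y - z"] r Z unfolding a_def K1_def
            by (intro mult_mono divide_right_mono) (auto simp: zero_le_mult_iff)
          also have "\<dots> = K1 * (norm c)\<^sup>2 * r / Z * indicator (cball z (\<epsilon> + 1)) y"
            by (auto simp: indicator_def dist_norm norm_minus_commute)
          finally show "norm (q (y - (z + c)) * u y / Z - q (y - z) * u y / Z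
              - a (y - z) * (4 * u y / Z) * ((y - z) \<bullet> c))
            \<le> K1 * (norm c)\<^sup>2 * r / Z * indicator (cball z (\<epsilon> + 1)) y" .
        qed
        have "(\<integral>y. K1 * (norm c)\<^sup>2 * r / Z * indicator (cball z (\<epsilon> + 1)) y \<partial>lborel) = K0 * (norm c)\<^sup>2"
          unfolding integral_mult_right_zero Bochner_Integration.integral_indicator by (simp add: vol K0_def)
        then show ?thesis using B unfolding A real_norm_def by argo
      qed
      have mlip: "\<bar>mollify \<rho> u (z + c) - mollify \<rho> u z\<bar> \<le> \<Lambda> * norm c" for z c
        by (rule blip_add_diff(2)[OF blip_mollify[OF mol u]])
      have Gn: "norm (G z) \<le> \<Lambda> + K0" for z
      proof (cases "G z = 0")
        case False
        define c where "c = (1 / norm (G z)) *\<^sub>R G z"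
        have nc: "norm c = 1" using False by (simp add: c_def)
        have "G z \<bullet> c = norm (G z)"
          using False by (simp add: c_def power2_norm_eq_inner[symmetric] power2_eq_square)
        then show ?thesis using small[of c z] mlip[of z c] nc by simp
      qed (use K0 True in auto)
      have "quadratic_remainder K G (mollify \<rho> u)"
        unfolding quadratic_remainder_def
      proof (intro conjI allI)
        show "0 \<le> K" using K0 True by (simp add: K_def)
        fix z c :: 'a
        have sq: "0 \<le> (norm c)\<^sup>2" by simp
        show "\<bar>mollify \<rho> u (z + c) - mollify \<rho> u z - G z \<bullet> c\<bar> \<le> K * (norm c)\<^sup>2"
        proof (cases "norm c \<le> 1")
          case le: True
          have "K0 * (norm c)\<^sup>2 \<le> K * (norm c)\<^sup>2" using True sq by (intro mult_right_mono) (auto simp: K_def)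
          then show ?thesis using small[OF le, of z] by linarith
        next
          case False
          have "\<bar>G z \<bullet> c\<bar> \<le> norm (G z) * norm c" by (rule Cauchy_Schwarz_ineq2)
          also have "\<dots> \<le> (\<Lambda> + K0) * norm c" using Gn[of z] by (intro mult_right_mono) auto
          finally have "\<bar>mollify \<rho> u (z + c) - mollify \<rho> u z - G z \<bullet> c\<bar> \<le> K * norm c"
            using mlip[of z c] by (simp add: K_def algebra_simps)
          also have "\<dots> \<le> K * (norm c)\<^sup>2"
            using False \<open>0 \<le> K\<close> self_le_power[of "norm c" 2] by (intro mult_left_mono) auto
          finally show ?thesis .
        qed
      qed
      then show "\<exists>G. quadratic_remainder K G (mollify \<rho> u)" by blast
    qed
  qed
  then show ?thesis using that mol by blast
qed

section \<open>Couplings\<close>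

lemma norm_le_one_plus_powr: "1 \<le> p \<Longrightarrow> norm y \<le> 1 + norm y powr p"
proof -
  assume p: "1 \<le> p"
  show ?thesis
  proof (cases "norm y \<le> 1")
    case True then show ?thesis by (simp add: add_increasing2)
  next
    case False
    then have "norm y powr 1 \<le> norm y powr p" using p by (intro powr_mono) auto
    then show ?thesis using False by simp
  qed
qed

text \<open>Integrating Young's inequality for \<open>X u / s\<close> and \<open>1\<close>.\<close>

lemma expectation_le_of_powr:
  fixes X :: "'b \<Rightarrow> real" and p s :: real
  assumes M: "prob_space M" and X: "X \<in> borel_measurable M" "\<And>u. 0 \<le> X u" and p: "1 < p"
    and i: "integrable M (\<lambda>u. X u powr p)" and s: "(\<integral>u. X u powr p \<partial>M) \<le> s powr p" "0 < s"
  shows "integrable M X" "(\<integral>u. X u \<partial>M) \<le> s"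
proof -
  interpret prob_space M by fact
  define q where "q = p / (p - 1)"
  have q: "1 < q" "1 / p + 1 / q = 1" using p by (auto simp: q_def field_simps)
  have pt: "X u \<le> s * (X u powr p / s powr p / p + 1 / q)" for u
  proof -
    have "X u / s * 1 \<le> (X u / s) powr p / p + 1 powr q / q"
      using p q X(2)[of u] s by (intro Youngs_inequality) auto
    then have "X u / s \<le> X u powr p / s powr p / p + 1 / q"
      using s X(2)[of u] by (simp add: powr_divide)
    then show ?thesis using s(2) by (simp add: field_simps)
  qed
  have int: "integrable M (\<lambda>u. s * (X u powr p / s powr p / p + 1 / q))" using i by simp
  show iX: "integrable M X"
    by (rule Bochner_Integration.integrable_bound[OF int X(1)]) (use order_trans[OF pt abs_ge_self] X(2) in \<open>auto intro!: always_eventually\<close>)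
  have "(\<integral>u. X u \<partial>M) \<le> (\<integral>u. s * (X u powr p / s powr p / p + 1 / q) \<partial>M)"
    by (rule integral_mono[OF iX int pt])
  also have "\<dots> = s * ((\<integral>u. X u powr p \<partial>M) / s powr p / p + 1 / q)" using i by (simp add: prob_space)
  also have "\<dots> \<le> s * (1 / p + 1 / q)"
    using s p by (intro mult_left_mono add_right_mono divide_right_mono) (auto simp: divide_le_eq_1)
  finally show "(\<integral>u. X u \<partial>M) \<le> s" using q by simp
qed

lemma P_spaceD:
  assumes "\<mu> \<in> P_space p"
  shows "prob_space \<mu>" "sets \<mu> = sets borel" "integrable \<mu> (\<lambda>y. norm y powr p)"
  using assms by (auto simp: P_space_def)

lemma couplingsD:
  assumes "\<pi> \<in> couplings \<mu> \<nu>"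
  shows "prob_space \<pi>" "sets \<pi> = sets borel" "distr \<pi> borel fst = \<mu>" "distr \<pi> borel snd = \<nu>"
    "fst \<in> borel_measurable \<pi>" "snd \<in> borel_measurable \<pi>"
proof -
  show *: "prob_space \<pi>" "sets \<pi> = sets borel" "distr \<pi> borel fst = \<mu>" "distr \<pi> borel snd = \<nu>"
    using assms by (auto simp: couplings_def)
  show "fst \<in> borel_measurable \<pi>" "snd \<in> borel_measurable \<pi>"
    by (simp_all add: measurable_cong_sets[OF *(2) refl] borel_measurable_continuous_onI continuous_on_fst continuous_on_snd)
qed

lemma integral_coupling_fst:
  fixes f :: "'a::euclidean_space \<Rightarrow> real"
  assumes "\<pi> \<in> couplings \<mu> \<nu>" "f \<in> borel_measurable borel"
  shows "(\<integral>y. f y \<partial>\<mu>) = (\<integral>u. f (fst u) \<partial>\<pi>)"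
  using integral_distr[of fst \<pi> borel f] couplingsD[OF assms(1)] assms(2) by simp

lemma integral_coupling_snd:
  fixes f :: "'a::euclidean_space \<Rightarrow> real"
  assumes "\<pi> \<in> couplings \<mu> \<nu>" "f \<in> borel_measurable borel"
  shows "(\<integral>y. f y \<partial>\<nu>) = (\<integral>u. f (snd u) \<partial>\<pi>)"
  using integral_distr[of snd \<pi> borel f] couplingsD[OF assms(1)] assms(2) by simp

text \<open>One coupling, whose cost is finite by \<open>integrable_coupling_cost\<close>, keeps the
  infimum in \<open>wasserstein\<close> below \<open>top\<close>, where \<open>enn2real\<close>
  would return 0.\<close>

lemma product_coupling:
  fixes \<mu> \<nu> :: "'a::euclidean_space measure"
  assumes "\<mu> \<in> P_space p" "\<nu> \<in> P_space p"
  shows "\<mu> \<Otimes>\<^sub>M \<nu> \<in> couplings \<mu> \<nu>"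
proof -
  interpret m: prob_space \<mu> using P_spaceD(1)[OF assms(1)] .
  interpret n: prob_space \<nu> using P_spaceD(1)[OF assms(2)] .
  interpret pair_prob_space \<mu> \<nu> ..
  have s: "sets (\<mu> \<Otimes>\<^sub>M \<nu>) = sets borel"
    using sets_pair_measure_cong[OF P_spaceD(2)[OF assms(1)] P_spaceD(2)[OF assms(2)]] by (metis borel_prod)
  have sp: "space \<mu> = UNIV" "space \<nu> = UNIV"
    using sets_eq_imp_space_eq[OF P_spaceD(2)[OF assms(1)]] sets_eq_imp_space_eq[OF P_spaceD(2)[OF assms(2)]] by auto
  have fm: "fst \<in> borel_measurable (\<mu> \<Otimes>\<^sub>M \<nu>)" "snd \<in> borel_measurable (\<mu> \<Otimes>\<^sub>M \<nu>)"
    by (simp_all add: measurable_cong_sets[OF s refl] borel_measurable_continuous_onI continuous_on_fst continuous_on_snd)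
  have "distr (\<mu> \<Otimes>\<^sub>M \<nu>) borel fst = \<mu>"
  proof (rule measure_eqI)
    fix A assume A: "A \<in> sets (distr (\<mu> \<Otimes>\<^sub>M \<nu>) borel fst)"
    have "fst -` A \<inter> space (\<mu> \<Otimes>\<^sub>M \<nu>) = A \<times> space \<nu>" by (auto simp: space_pair_measure sp)
    with A fm show "emeasure (distr (\<mu> \<Otimes>\<^sub>M \<nu>) borel fst) A = emeasure \<mu> A"
      using P_spaceD(2)[OF assms(1)]
      by (simp add: emeasure_distr n.emeasure_pair_measure_Times n.emeasure_space_1)
  qed (simp add: P_spaceD(2)[OF assms(1)])
  moreover have "distr (\<mu> \<Otimes>\<^sub>M \<nu>) borel snd = \<nu>"
  proof (rule measure_eqI)
    fix A assume A: "A \<in> sets (distr (\<mu> \<Otimes>\<^sub>M \<nu>) borel snd)"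
    have "snd -` A \<inter> space (\<mu> \<Otimes>\<^sub>M \<nu>) = space \<mu> \<times> A" by (auto simp: space_pair_measure sp)
    with A fm show "emeasure (distr (\<mu> \<Otimes>\<^sub>M \<nu>) borel snd) A = emeasure \<nu> A"
      using P_spaceD(2)[OF assms(2)]
      by (simp add: emeasure_distr n.emeasure_pair_measure_Times m.emeasure_space_1)
  qed (simp add: P_spaceD(2)[OF assms(2)])
  ultimately show ?thesis using s prob_space_axioms by (simp add: couplings_def)
qed

lemma norm_diff_powr_le:
  fixes x y :: "'a::real_normed_vector"
  assumes "0 < p"
  shows "norm (x - y) powr p \<le> 2 powr p * (norm x powr p + norm y powr p)"
proof -
  have "norm (x - y) \<le> 2 * max (norm x) (norm y)" using norm_triangle_ineq4[of x y] by simp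
  then have "norm (x - y) powr p \<le> (2 * max (norm x) (norm y)) powr p" using assms by (intro powr_mono2) auto
  also have "\<dots> = 2 powr p * max (norm x) (norm y) powr p" by (simp add: powr_mult)
  also have "\<dots> \<le> 2 powr p * (norm x powr p + norm y powr p)"
    by (intro mult_left_mono) (auto simp: max_def)
  finally show ?thesis .
qed

lemma integrable_coupling_cost:
  fixes \<mu> \<nu> :: "'a::euclidean_space measure"
  assumes "1 < p" "\<mu> \<in> P_space p" "\<nu> \<in> P_space p" and \<pi>: "\<pi> \<in> couplings \<mu> \<nu>"
  shows "integrable \<pi> (\<lambda>u. norm (fst u - snd u) powr p)"
proof -
  note c = couplingsD[OF \<pi>]
  have "integrable (distr \<pi> borel fst) (\<lambda>y. norm y powr p)" "integrable (distr \<pi> borel snd) (\<lambda>y. norm y powr p)"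
    using P_spaceD(3)[OF assms(2)] P_spaceD(3)[OF assms(3)] c by auto
  then have "integrable \<pi> (\<lambda>u. norm (fst u) powr p)" "integrable \<pi> (\<lambda>u. norm (snd u) powr p)"
    using integrable_distr[OF c(5), of "\<lambda>y. norm y powr p"] integrable_distr[OF c(6), of "\<lambda>y. norm y powr p"] by auto
  then have "integrable \<pi> (\<lambda>u. 2 powr p * (norm (fst u) powr p + norm (snd u) powr p))" by simp
  then show ?thesis
    by (rule Bochner_Integration.integrable_bound)
      (use c(5,6) assms(1) norm_diff_powr_le[of p] in \<open>auto intro!: always_eventually\<close>)
qed

lemma wasserstein_nonneg: "0 \<le> wasserstein p \<mu> \<nu>"
  by (simp add: wasserstein_def)

text \<open>Avoids the existence of optimal couplings at the price of an \<open>s\<close> strictly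
  above the distance; callers let \<open>s\<close> decrease to it.\<close>

lemma near_optimal_coupling:
  fixes \<mu> \<nu> :: "'a::euclidean_space measure"
  assumes p: "1 < p" and m: "\<mu> \<in> P_space p" "\<nu> \<in> P_space p" and s: "wasserstein p \<mu> \<nu> < s"
  obtains \<pi> where "\<pi> \<in> couplings \<mu> \<nu>" "(\<integral>u. norm (fst u - snd u) powr p \<partial>\<pi>) \<le> s powr p"
proof -
  define c where "c \<pi> = (\<integral>\<^sup>+ u. ennreal (norm (fst u - snd u) powr p) \<partial>\<pi>)" for \<pi> :: "('a \<times> 'a) measure"
  define v where "v = (INF \<pi>\<in>couplings \<mu> \<nu>. c \<pi>)"
  have fin: "c \<pi> = ennreal (\<integral>u. norm (fst u - snd u) powr p \<partial>\<pi>)" if "\<pi> \<in> couplings \<mu> \<nu>" for \<pi>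
    unfolding c_def using integrable_coupling_cost[OF p m that] by (intro nn_integral_eq_integral) auto
  have "v \<le> c (\<mu> \<Otimes>\<^sub>M \<nu>)" unfolding v_def using product_coupling[OF m] by (intro INF_lower)
  then have vfin: "v < top" using fin[OF product_coupling[OF m]] by (simp add: order_le_less_trans)
  have w: "wasserstein p \<mu> \<nu> = enn2real v powr (1 / p)" by (simp add: wasserstein_def v_def c_def)
  have "enn2real v = (enn2real v powr (1 / p)) powr p" using p by (simp add: powr_powr)
  also have "\<dots> < s powr p" using s p unfolding w by (intro powr_less_mono2) auto
  finally have "v < ennreal (s powr p)" using vfin by (simp add: enn2real_less_iff)
  then obtain \<pi> where \<pi>: "\<pi> \<in> couplings \<mu> \<nu>" "c \<pi> < ennreal (s powr p)"
    unfolding v_def INF_less_iff by blast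
  then have "(\<integral>u. norm (fst u - snd u) powr p \<partial>\<pi>) \<le> s powr p"
    unfolding fin[OF \<pi>(1)] by (simp add: ennreal_less_iff)
  then show ?thesis by (rule that[OF \<pi>(1)])
qed

text \<open>The easy half of Kantorovich-Rubinstein duality along a near-optimal coupling, followed
  by the bound of the mean displacement by its \<open>p\<close>-th moment.\<close>

lemma integral_diff_le_wasserstein:
  fixes \<mu> \<nu> :: "'a::euclidean_space measure"
  assumes p: "1 < p" and m: "\<mu> \<in> P_space p" "\<nu> \<in> P_space p" and g: "blip \<Lambda> g"
  shows "(\<integral>y. g (z + y) \<partial>\<nu>) \<le> (\<integral>y. g (z + y) \<partial>\<mu>) + \<Lambda> * wasserstein p \<mu> \<nu>"
proof -
  have gm: "(\<lambda>y. g (z + y)) \<in> borel_measurable borel"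
    using bcontfun_measurable[OF bcontfun_shift[OF blip_bcontfun[OF g], of z]] by (simp add: add.commute)
  have *: "(\<integral>y. g (z + y) \<partial>\<nu>) - (\<integral>y. g (z + y) \<partial>\<mu>) \<le> \<Lambda> * s" if s: "wasserstein p \<mu> \<nu> < s" for s
  proof -
    obtain \<pi> where \<pi>: "\<pi> \<in> couplings \<mu> \<nu>" and le: "(\<integral>u. norm (fst u - snd u) powr p \<partial>\<pi>) \<le> s powr p"
      using near_optimal_coupling[OF p m s] .
    note c = couplingsD[OF \<pi>]
    interpret prob_space \<pi> using c(1) .
    have s0: "0 < s" using wasserstein_nonneg[of p \<mu> \<nu>] s by linarith
    have n: "(\<lambda>u. norm (fst u - snd u)) \<in> borel_measurable \<pi>" using c(5,6) by simp
    note e = expectation_le_of_powr[OF c(1) n norm_ge_zero p integrable_coupling_cost[OF p m \<pi>] le s0]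
    have i: "integrable \<pi> (\<lambda>u. g (z + fst u))" "integrable \<pi> (\<lambda>u. g (z + snd u))"
      using c(5,6) by (auto intro!: integrable_bcontfun_compose[OF finite_measure_axioms blip_bcontfun[OF g]])
    have "(\<integral>y. g (z + y) \<partial>\<nu>) - (\<integral>y. g (z + y) \<partial>\<mu>) = (\<integral>u. g (z + snd u) - g (z + fst u) \<partial>\<pi>)"
      using i by (simp add: integral_coupling_fst[OF \<pi> gm] integral_coupling_snd[OF \<pi> gm])
    also have "\<dots> \<le> (\<integral>u. \<Lambda> * norm (fst u - snd u) \<partial>\<pi>)"
      using i e(1) blip_diff[OF g, of "z + snd u" "z + fst u" for u]
      by (intro integral_mono) (auto simp: norm_minus_commute)
    also have "\<dots> \<le> \<Lambda> * s" using e(2) blip_nonneg[OF g] by (simp add: mult_left_mono)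
    finally show ?thesis .
  qed
  show ?thesis
  proof (rule field_le_epsilon)
    fix e :: real assume e: "e > 0"
    have l: "0 \<le> \<Lambda>" using blip_nonneg[OF g] .
    have "\<Lambda> * (e / (\<Lambda> + 1)) \<le> e" using l e by (simp add: field_simps)
    then show "(\<integral>y. g (z + y) \<partial>\<nu>) \<le> (\<integral>y. g (z + y) \<partial>\<mu>) + \<Lambda> * wasserstein p \<mu> \<nu> + e"
      using *[of "wasserstein p \<mu> \<nu> + e / (\<Lambda> + 1)"] l e by (simp add: distrib_left)
  qed
qed

text \<open>The coupling \<open>(y, y + c)\<close> moves every point by exactly \<open>c\<close>.
  Through it the drifts of \<open>J\<close> become competitors in the supremum of
  \<open>I\<close>.\<close>

lemma shift_P_space:
  fixes \<mu> :: "'a::euclidean_space measure"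
  assumes p: "1 < p" and m: "\<mu> \<in> P_space p"
  shows "distr \<mu> borel (\<lambda>y. y + c) \<in> P_space p" "wasserstein p \<mu> (distr \<mu> borel (\<lambda>y. y + c)) \<le> norm c"
proof -
  note m' = P_spaceD[OF m]
  interpret prob_space \<mu> using m'(1) .
  have me: "(\<lambda>y. y + c) \<in> borel_measurable \<mu>" "(\<lambda>y. y) \<in> borel_measurable \<mu>"
    by (simp_all add: measurable_cong_sets[OF m'(2) refl])
  have "integrable \<mu> (\<lambda>y. 2 powr p * (norm y powr p + norm (- c) powr p))" using m'(3) by simp
  then have "integrable \<mu> (\<lambda>y. norm (y + c) powr p)"
    by (rule Bochner_Integration.integrable_bound)
      (use me p norm_diff_powr_le[of p _ "- c"] in \<open>auto intro!: always_eventually\<close>)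
  then show "distr \<mu> borel (\<lambda>y. y + c) \<in> P_space p"
    unfolding P_space_def using me
    by (auto intro!: prob_space_distr simp: integrable_distr_eq)
  define \<pi> where "\<pi> = distr \<mu> borel (\<lambda>y. (y, y + c))"
  have mp: "(\<lambda>y. (y, y + c)) \<in> borel_measurable \<mu>" using me by simp
  have "distr \<pi> borel fst = \<mu>"
    unfolding \<pi>_def using mp
    by (subst distr_distr) (auto simp: comp_def m'(2) distr_id2 borel_measurable_continuous_onI continuous_on_fst)
  moreover have "distr \<pi> borel snd = distr \<mu> borel (\<lambda>y. y + c)"
    unfolding \<pi>_def using mp
    by (subst distr_distr) (auto simp: comp_def borel_measurable_continuous_onI continuous_on_snd)
  ultimately have \<pi>: "\<pi> \<in> couplings \<mu> (distr \<mu> borel (\<lambda>y. y + c))"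
    unfolding couplings_def using prob_space_distr[OF mp] by (simp add: \<pi>_def)
  have "(\<lambda>u::'a \<times> 'a. norm (fst u - snd u)) \<in> borel_measurable borel"
    by (intro borel_measurable_continuous_onI continuous_intros)
  then have n: "(\<lambda>u::'a \<times> 'a. ennreal (norm (fst u - snd u) powr p)) \<in> borel_measurable borel"
    by simp
  have "(\<integral>\<^sup>+ u. ennreal (norm (fst u - snd u) powr p) \<partial>\<pi>) = (\<integral>\<^sup>+ y. ennreal (norm c powr p) \<partial>\<mu>)"
    unfolding \<pi>_def using mp n by (subst nn_integral_distr) auto
  also have "\<dots> = ennreal (norm c powr p)" by (simp add: emeasure_space_1)
  finally have "(INF \<pi>\<in>couplings \<mu> (distr \<mu> borel (\<lambda>y. y + c)). \<integral>\<^sup>+ u. ennreal (norm (fst u - snd u) powr p) \<partial>\<pi>)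
    \<le> ennreal (norm c powr p)" by (rule INF_lower2[OF \<pi> eq_refl])
  then have "enn2real (INF \<pi>\<in>couplings \<mu> (distr \<mu> borel (\<lambda>y. y + c)). \<integral>\<^sup>+ u. ennreal (norm (fst u - snd u) powr p) \<partial>\<pi>)
    \<le> norm c powr p" by (simp add: enn2real_leI)
  then have "wasserstein p \<mu> (distr \<mu> borel (\<lambda>y. y + c)) \<le> (norm c powr p) powr (1 / p)"
    unfolding wasserstein_def using p by (intro powr_mono2) auto
  then show "wasserstein p \<mu> (distr \<mu> borel (\<lambda>y. y + c)) \<le> norm c" using p by (simp add: powr_powr)
qed

section \<open>The penalty function and its conjugate\<close>

text \<open>\<open>real_of_ereal\<close> sends both infinities to 0, so the supremum must be known
  to be finite before it is read as a real; one index bounded below and a common upper bound ensure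
  this. The conjugate and both one-step operators are handled through the two resulting
  rules.\<close>

lemma real_of_SUP_bounds:
  fixes A :: "'i \<Rightarrow> ereal"
  assumes "i0 \<in> X" "ereal l \<le> A i0" and ub: "\<And>i. i \<in> X \<Longrightarrow> A i \<le> ereal u"
  shows "\<And>i a. i \<in> X \<Longrightarrow> ereal a \<le> A i \<Longrightarrow> a \<le> real_of_ereal (SUP i\<in>X. A i)"
    and "\<And>a. (\<And>i. i \<in> X \<Longrightarrow> A i \<le> ereal a) \<Longrightarrow> real_of_ereal (SUP i\<in>X. A i) \<le> a"
proof -
  define S where "S = (SUP i\<in>X. A i)"
  have "ereal l \<le> S" unfolding S_def using assms(1,2) by (rule SUP_upper2)
  moreover have "S \<le> ereal u" unfolding S_def using ub by (rule SUP_least)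
  ultimately obtain s where s: "S = ereal s" by (cases S) auto
  show "a \<le> real_of_ereal (SUP i\<in>X. A i)" if "i \<in> X" "ereal a \<le> A i" for i a
  proof -
    have "ereal a \<le> S" unfolding S_def using that by (rule SUP_upper2)
    then show ?thesis unfolding S_def[symmetric] s by simp
  qed
  show "real_of_ereal (SUP i\<in>X. A i) \<le> a" if "\<And>i. i \<in> X \<Longrightarrow> A i \<le> ereal a" for a
  proof -
    have "S \<le> ereal a" unfolding S_def using that by (rule SUP_least)
    then show ?thesis unfolding S_def[symmetric] s by simp
  qed
qed

locale penalty =
  fixes p :: real and \<phi> :: "real \<Rightarrow> ereal"
  assumes p: "1 < p"
    and phi_nonneg: "\<And>v. 0 \<le> v \<Longrightarrow> 0 \<le> \<phi> v"
    and phi_convex: "ereal_convex_halfline \<phi>"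
    and phi_0: "\<phi> 0 = 0"
    and phi_pos: "\<exists>v\<ge>0. \<phi> v > 0"
    and phi_convex_p: "ereal_convex_halfline (\<lambda>v. \<phi> (v powr (1 / p)))"
begin

text \<open>Allows real arithmetic: speeds outside enter every supremum as minus infinity.\<close>

definition dom where "dom = {v. 0 \<le> v \<and> \<phi> v \<noteq> \<infinity>}"

definition cost where "cost v = real_of_ereal (\<phi> v)"

abbreviation \<Phi> where "\<Phi> \<equiv> conjugate \<phi>"

lemma dom_nonneg: "v \<in> dom \<Longrightarrow> 0 \<le> v"
  by (simp add: dom_def)

lemma phi_eq_cost: "v \<in> dom \<Longrightarrow> \<phi> v = ereal (cost v)"
  using phi_nonneg[of v] by (cases "\<phi> v") (auto simp: dom_def cost_def)

lemma cost_nonneg: "v \<in> dom \<Longrightarrow> 0 \<le> cost v"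
  using phi_nonneg[of v] phi_eq_cost[of v] by (simp add: dom_def)

lemma zero_dom: "0 \<in> dom" and cost_0: "cost 0 = 0"
  by (auto simp: dom_def cost_def phi_0)

lemma dom_scale:
  assumes v: "v \<in> dom" and l: "0 \<le> l" "l \<le> 1"
  shows "l * v \<in> dom" "cost (l * v) \<le> l * cost v"
proof -
  have "\<phi> (l * v + (1 - l) * 0) \<le> ereal l * \<phi> v + ereal (1 - l) * \<phi> 0"
    using phi_convex[unfolded ereal_convex_halfline_def, rule_format, of v 0 l] v l by (simp add: dom_def)
  then have *: "\<phi> (l * v) \<le> ereal (l * cost v)" using phi_eq_cost[OF v] by (simp add: phi_0)
  then show d: "l * v \<in> dom" using l dom_nonneg[OF v] by (auto simp: dom_def)
  show "cost (l * v) \<le> l * cost v" using * phi_eq_cost[OF d] by simp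
qed

text \<open>Convexity together with the minimum 0 at 0 makes the penalty nondecreasing.\<close>

lemma dom_mono:
  assumes "v \<in> dom" "0 \<le> w" "w \<le> v"
  shows "w \<in> dom" "cost w \<le> cost v"
proof -
  have "w \<in> dom \<and> cost w \<le> cost v"
  proof (cases "v = 0")
    case False
    then have l: "0 \<le> w / v" "w / v \<le> 1" "w / v * v = w" using assms by auto
    have "w / v * cost v \<le> cost v" using l cost_nonneg[OF assms(1)] by (intro mult_left_le_one_le) auto
    then show ?thesis using dom_scale[OF assms(1) l(1,2)] unfolding l(3) by simp
  qed (use assms in auto)
  then show "w \<in> dom" "cost w \<le> cost v" by auto
qed

text \<open>In the variable \<open>s = v powr p\<close> the penalty is convex and vanishes at 0, so
  past \<open>s0\<close> it stays above the line through the origin and its value at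
  \<open>s0\<close>. This is the source of the growth of order \<open>p\<close>.\<close>

lemma cost_coercive:
  obtains a C where "0 < a" "0 \<le> C" "\<And>v. v \<in> dom \<Longrightarrow> a * v powr p - C \<le> cost v"
proof -
  obtain v0 where v0: "v0 \<ge> 0" "\<phi> v0 > 0" using phi_pos by blast
  then have v0p: "v0 > 0" using phi_0 by (cases "v0 = 0") auto
  define s0 where "s0 = v0 powr p"
  have s0: "s0 > 0" using v0p by (simp add: s0_def)
  \<comment> \<open>If the penalty at \<open>v0\<close> is infinite, \<open>dom\<close> ends before
    \<open>v0\<close> and any positive slope works.\<close>
  define a where "a = (if v0 \<in> dom then cost v0 / s0 else 1)"
  have a: "a > 0" using v0 s0 phi_eq_cost[of v0] by (cases "v0 \<in> dom") (auto simp: a_def)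
  have "a * v powr p - a * s0 \<le> cost v" if v: "v \<in> dom" for v
  proof (cases "v < v0")
    case True
    then have "v powr p \<le> s0" unfolding s0_def using p dom_nonneg[OF v] by (intro powr_mono2) auto
    then have "a * v powr p \<le> a * s0" using a by simp
    then show ?thesis using cost_nonneg[OF v] by simp
  next
    case v0_le: False
    define s where "s = v powr p"
    have s: "s0 \<le> s" "0 < s" unfolding s_def s0_def using v0_le p v0p by (auto intro: powr_mono2)
    have pw: "s powr (1 / p) = v" "s0 powr (1 / p) = v0"
      using p dom_nonneg[OF v] v0p by (auto simp: s_def s0_def powr_powr)
    define l where "l = s0 / s"
    have l: "0 \<le> l" "l \<le> 1" "l * s = s0" using s s0 by (auto simp: l_def)
    have "\<phi> ((l * s + (1 - l) * 0) powr (1 / p))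
        \<le> ereal l * \<phi> (s powr (1 / p)) + ereal (1 - l) * \<phi> (0 powr (1 / p))"
      using phi_convex_p[unfolded ereal_convex_halfline_def, rule_format, of s 0 l] l s by simp
    then have *: "\<phi> v0 \<le> ereal (l * cost v)" using phi_eq_cost[OF v] by (simp add: l(3) pw phi_0)
    then have d: "v0 \<in> dom" using v0 by (auto simp: dom_def)
    have "cost v0 \<le> l * cost v" using * phi_eq_cost[OF d] by simp
    then have "cost v0 / s0 * s \<le> cost v" using s s0 by (simp add: l_def field_simps)
    then show ?thesis using d cost_nonneg[OF d] s0 by (simp add: a_def s_def)
  qed
  then show ?thesis using that[of a "a * s0"] a s0 by simp
qed

text \<open>Beyond \<open>vmax \<Lambda>\<close> the penalty dominates the linear gain \<open>\<Lambda> v\<close>, so that such speeds are never optimal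
  against \<open>\<Lambda>\<close>-Lipschitz functions.\<close>

definition vmax where "vmax \<Lambda> = (SOME V. 0 \<le> V \<and> (\<forall>v\<in>dom. V < v \<longrightarrow> \<Lambda> * v \<le> cost v))"

lemma vmax:
  assumes \<Lambda>: "0 \<le> \<Lambda>"
  shows "0 \<le> vmax \<Lambda>" "\<And>v. v \<in> dom \<Longrightarrow> vmax \<Lambda> < v \<Longrightarrow> \<Lambda> * v \<le> cost v"
proof -
  obtain a C where a: "0 < a" "0 \<le> C" "\<And>v. v \<in> dom \<Longrightarrow> a * v powr p - C \<le> cost v"
    using cost_coercive by blast
  \<comment> \<open>Solves \<open>a * u powr (p - 1) = \<Lambda> + C\<close>; the maximum with 1
    below lets \<open>C * v\<close> absorb the constant \<open>C\<close>.\<close>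
  define u where "u = ((\<Lambda> + C) / a) powr (1 / (p - 1))"
  have "\<Lambda> * v \<le> cost v" if v: "v \<in> dom" "max 1 u < v" for v
  proof -
    have "(\<Lambda> + C) / a = u powr (p - 1)" using p \<Lambda> a by (simp add: u_def powr_powr)
    also have "\<dots> \<le> v powr (p - 1)" using v p by (intro powr_mono2) (auto simp: u_def)
    finally have "\<Lambda> + C \<le> a * v powr (p - 1)" using a by (simp add: field_simps)
    then have "v * (\<Lambda> + C) \<le> v * (a * v powr (p - 1))" using v by (intro mult_left_mono) auto
    also have "\<dots> = a * v powr p" using v powr_mult_base[of v "p - 1"] by simp
    finally have "\<Lambda> * v + C * v \<le> a * v powr p" by (simp add: algebra_simps)
    moreover have "C * 1 \<le> C * v" using a v by (intro mult_left_mono) auto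
    ultimately show ?thesis using a(3)[OF v(1)] by simp
  qed
  then have "\<exists>V. 0 \<le> V \<and> (\<forall>v\<in>dom. V < v \<longrightarrow> \<Lambda> * v \<le> cost v)"
    by (intro exI[of _ "max 1 u"]) auto
  from someI_ex[OF this]
  show "0 \<le> vmax \<Lambda>" "\<And>v. v \<in> dom \<Longrightarrow> vmax \<Lambda> < v \<Longrightarrow> \<Lambda> * v \<le> cost v"
    unfolding vmax_def by blast+
qed

text \<open>Beyond \<open>vmax w\<close> a speed contributes at most 0, below it at most
  \<open>vmax w * w\<close>; hence the supremum is finite and the conversion to reals is
  faithful.\<close>

lemma conjugate_bounds:
  assumes w: "0 \<le> w"
  shows conjugate_ge: "\<And>v. v \<in> dom \<Longrightarrow> v * w - cost v \<le> \<Phi> w"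
    and conjugate_le: "\<And>X. (\<And>v. v \<in> dom \<Longrightarrow> v * w - cost v \<le> X) \<Longrightarrow> \<Phi> w \<le> X"
proof -
  have out: "ereal (v * w) - \<phi> v \<le> ereal X" if "v \<in> {0..}" "v \<notin> dom" for v X
    using that by (simp add: dom_def)
  have ub: "ereal (v * w) - \<phi> v \<le> ereal (vmax w * w)" if "v \<in> {0..}" for v
  proof (cases "v \<in> dom")
    case True
    have "v * w - cost v \<le> vmax w * w"
    proof (cases "vmax w < v")
      case t: True
      have "0 \<le> vmax w * w" using vmax(1)[OF w] w by simp
      then show ?thesis using vmax(2)[OF w True t] by (simp add: mult.commute)
    next
      case False
      then have "v * w \<le> vmax w * w" using w by (intro mult_right_mono) auto
      then show ?thesis using cost_nonneg[OF True] by simp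
    qed
    then show ?thesis using phi_eq_cost[OF True] by simp
  qed (rule out[OF that])
  note S = real_of_SUP_bounds[where A="\<lambda>v. ereal (v * w) - \<phi> v" and X="{0..}", OF _ _ ub, of 0 0]
  show "v * w - cost v \<le> \<Phi> w" if "v \<in> dom" for v
    unfolding conjugate_def using that phi_eq_cost[OF that] dom_nonneg[OF that] by (intro S(1)) (auto simp: phi_0)
  show "\<Phi> w \<le> X" if X: "\<And>v. v \<in> dom \<Longrightarrow> v * w - cost v \<le> X" for X
    unfolding conjugate_def
  proof (rule S(2))
    fix v assume v: "v \<in> {0::real..}"
    show "ereal (v * w) - \<phi> v \<le> ereal X"
      using X[of v] phi_eq_cost[of v] out[OF v] by (cases "v \<in> dom") auto
  qed (auto simp: phi_0)
qed

lemma conjugate_nonneg: "0 \<le> w \<Longrightarrow> 0 \<le> \<Phi> w"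
  using conjugate_ge[of w 0] by (simp add: zero_dom cost_0)

lemma conjugate_mono:
  assumes "0 \<le> w" "w \<le> w'"
  shows "\<Phi> w \<le> \<Phi> w'"
proof (rule conjugate_le[OF assms(1)])
  fix v assume v: "v \<in> dom"
  have "v * w \<le> v * w'" using assms dom_nonneg[OF v] by (intro mult_left_mono)
  then show "v * w - cost v \<le> \<Phi> w'" using conjugate_ge[of w' v] assms v by simp
qed

text \<open>Costs are nonnegative, so \<open>l * (v * w - cost v)\<close> dominates
  \<open>v * (l * w) - cost v\<close>. It makes the penalty of a function of small slope small in
  proportion, on which \<open>adm_gap\<close> relies.\<close>

lemma conjugate_scale:
  assumes "0 \<le> w" "0 \<le> l" "l \<le> 1"
  shows "\<Phi> (l * w) \<le> l * \<Phi> w"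
proof (rule conjugate_le)
  show "0 \<le> l * w" using assms by simp
  fix v assume v: "v \<in> dom"
  have "l * cost v \<le> cost v" using assms cost_nonneg[OF v] by (intro mult_left_le_one_le) auto
  moreover have "l * (v * w - cost v) \<le> l * \<Phi> w"
    using conjugate_ge[OF assms(1) v] assms by (intro mult_left_mono) auto
  ultimately show "v * (l * w) - cost v \<le> l * \<Phi> w" by (simp add: algebra_simps)
qed

lemma conjugate_0: "\<Phi> 0 = 0"
  using conjugate_scale[of 0 0] conjugate_nonneg[of 0] by simp

text \<open>The slope of a conjugate is the optimal speed; against slopes up to \<open>W\<close>,
  speeds beyond \<open>vmax W\<close> contribute nothing positive.\<close>

lemma conjugate_lipschitz:
  assumes "0 \<le> w" "w \<le> W" "0 \<le> w'"
  shows "\<Phi> w - \<Phi> w' \<le> vmax W * \<bar>w - w'\<bar>"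
proof -
  have W: "0 \<le> W" using assms by simp
  have "\<Phi> w \<le> \<Phi> w' + vmax W * \<bar>w - w'\<bar>"
  proof (rule conjugate_le[OF assms(1)])
    fix v assume v: "v \<in> dom"
    note v0 = dom_nonneg[OF v]
    show "v * w - cost v \<le> \<Phi> w' + vmax W * \<bar>w - w'\<bar>"
    proof (cases "vmax W < v")
      case True
      have "v * w \<le> v * W" using assms v0 by (intro mult_left_mono)
      then have "v * w - cost v \<le> 0" using vmax(2)[OF W v True] by (simp add: mult.commute)
      moreover have "0 \<le> vmax W * \<bar>w - w'\<bar>" using vmax(1)[OF W] by simp
      ultimately show ?thesis using conjugate_nonneg[OF assms(3)] by linarith
    next
      case False
      have "v * (w - w') \<le> v * \<bar>w - w'\<bar>" using v0 by (intro mult_left_mono) auto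
      also have "\<dots> \<le> vmax W * \<bar>w - w'\<bar>" using False by (intro mult_right_mono) auto
      finally show ?thesis using conjugate_ge[OF assms(3) v] by (simp add: algebra_simps)
    qed
  qed
  then show ?thesis by simp
qed

lemma perspective_cost:
  assumes "0 < t" "v / t \<in> dom"
  shows "perspective \<phi> t v = ereal (t * cost (v / t))"
  using assms phi_eq_cost[OF assms(2)] by (simp add: perspective_def)

lemma perspective_infinite:
  assumes "0 < t" "0 \<le> v" "v / t \<notin> dom"
  shows "perspective \<phi> t v = \<infinity>"
  using assms by (simp add: perspective_def dom_def)

end

section \<open>The reference semigroup\<close>

locale wasserstein_perturbation = penalty p \<phi>
  for p :: real and \<phi> :: "real \<Rightarrow> ereal" +
  fixes \<mu> :: "real \<Rightarrow> 'a::euclidean_space measure" and \<psi> :: "real \<Rightarrow> 'a \<Rightarrow> 'a" and L :: real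
  assumes mu: "\<And>t. 0 \<le> t \<Longrightarrow> \<mu> t \<in> P_space p"
    and R_semigroup: "Cb_semigroup (R_op \<mu> \<psi>)"
    and moment: "((\<lambda>t. \<integral>y. norm y powr p \<partial>\<mu> t) \<longlongrightarrow> 0) (at_right 0)"
    and psi_0: "\<And>t. 0 \<le> t \<Longrightarrow> \<psi> t 0 = 0"
    and L_nonneg: "0 \<le> L"
    and psi_near_id: "\<And>t x y. 0 \<le> t \<Longrightarrow> t \<le> 1 \<Longrightarrow> norm (\<psi> t x - \<psi> t y - (x - y)) \<le> L * t * norm (x - y)"
begin

abbreviation R where "R \<equiv> R_op \<mu> \<psi>"
abbreviation J where "J \<equiv> J_op \<phi> \<mu> \<psi>"
abbreviation I where "I \<equiv> I_op p \<phi> \<mu> \<psi>"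

definition m where "m t = (\<integral>y. norm y \<partial>\<mu> t)"

lemma prob: "0 \<le> t \<Longrightarrow> prob_space (\<mu> t)"
  and sets_mu: "0 \<le> t \<Longrightarrow> sets (\<mu> t) = sets borel"
  using P_spaceD[OF mu] by auto

lemma measurable_mu: "0 \<le> t \<Longrightarrow> g \<in> borel_measurable borel \<Longrightarrow> g \<in> borel_measurable (\<mu> t)"
  by (simp add: measurable_cong_sets[OF sets_mu refl])

lemma integrable_norm_mu: "0 \<le> t \<Longrightarrow> integrable (\<mu> t) norm"
proof -
  assume t: "0 \<le> t"
  interpret prob_space "\<mu> t" by (rule prob[OF t])
  have "integrable (\<mu> t) (\<lambda>y. 1 + norm y powr p)" using P_spaceD(3)[OF mu[OF t]] by simp
  then show ?thesis
    by (rule Bochner_Integration.integrable_bound)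
      (use measurable_mu[OF t borel_measurable_continuous_onI[OF continuous_on_norm[OF continuous_on_id]]] norm_le_one_plus_powr[of p] p in
        \<open>auto intro!: always_eventually simp: id_def\<close>)
qed

lemma m_nonneg: "0 \<le> m t"
  by (simp add: m_def)

text \<open>Hoelder's inequality passes from the \<open>p\<close>-th to the first moment. The limit
  is one-sided, so time 0 is left out; there \<open>R 0\<close> is the identity.\<close>

lemma m_small:
  assumes "\<epsilon> > 0"
  obtains \<delta> where "0 < \<delta>" "\<delta> \<le> 1" "\<And>t. 0 < t \<Longrightarrow> t \<le> \<delta> \<Longrightarrow> m t \<le> \<epsilon>"
proof -
  have "\<forall>\<^sub>F t in at_right 0. dist (\<integral>y. norm y powr p \<partial>\<mu> t) 0 < \<epsilon> powr p"
    using moment assms by (intro tendstoD) auto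
  then obtain d where d: "d > 0" "\<And>t. 0 < t \<Longrightarrow> t < d \<Longrightarrow> (\<integral>y. norm y powr p \<partial>\<mu> t) \<le> \<epsilon> powr p"
    by (fastforce simp: eventually_at_right_field dist_real_def abs_less_iff less_imp_le)
  show ?thesis
  proof (rule that[of "min 1 (d / 2)"])
    fix t assume t: "0 < t" "t \<le> min 1 (d / 2)"
    show "m t \<le> \<epsilon>" unfolding m_def
      using t d p assms
      by (intro expectation_le_of_powr(2)[OF prob _ norm_ge_zero p P_spaceD(3)[OF mu]] d measurable_mu) auto
  qed (use d in auto)
qed

lemma integrable_R: "0 \<le> t \<Longrightarrow> f \<in> bcontfun \<Longrightarrow> integrable (\<mu> t) (\<lambda>y. f (z + y))"
  for f :: "'a \<Rightarrow> real"
  using prob by (intro integrable_bcontfun_compose) (auto simp: prob_space_def intro: measurable_mu)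

lemma R_bcontfun: "0 \<le> t \<Longrightarrow> f \<in> bcontfun \<Longrightarrow> R t f \<in> bcontfun"
  and R_0: "f \<in> bcontfun \<Longrightarrow> R 0 f = f"
  and R_add_time: "0 \<le> s \<Longrightarrow> 0 \<le> t \<Longrightarrow> f \<in> bcontfun \<Longrightarrow> R (s + t) f = R s (R t f)"
  using R_semigroup by (auto simp: Cb_semigroup_def)

lemma R_mono:
  assumes "0 \<le> t" "f \<in> bcontfun" "g \<in> bcontfun" "\<And>x. f x \<le> g x"
  shows "R t f x \<le> R t g x"
  unfolding R_op_def using assms by (intro integral_mono integrable_R) auto

lemma R_add:
  assumes "0 \<le> t" "f \<in> bcontfun" "g \<in> bcontfun"
  shows "R t (\<lambda>x. f x + g x) x = R t f x + R t g x"
  unfolding R_op_def using assms by (intro Bochner_Integration.integral_add integrable_R) auto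

lemma R_cmult: "R t (\<lambda>x. a * f x) x = a * R t f x"
  unfolding R_op_def by simp

lemma R_const: "0 \<le> t \<Longrightarrow> R t (\<lambda>_. c) x = c"
  unfolding R_op_def using prob_space.prob_space[OF prob] by simp

lemma R_add_const:
  assumes "0 \<le> t" "f \<in> bcontfun"
  shows "R t (\<lambda>x. f x + c) x = R t f x + c"
  using R_add[OF assms const_bcontfun] R_const[OF assms(1)] by simp

lemma psi_minus_id:
  assumes "0 \<le> t" "t \<le> 1"
  shows "norm (\<psi> t x - x) \<le> L * t * norm x"
  using psi_near_id[OF assms, of x 0] psi_0[OF assms(1)] by simp

lemma psi_lipschitz_small:
  assumes "0 \<le> t" "t \<le> 1"
  shows "norm (\<psi> t x - \<psi> t y) \<le> exp (L * t) * norm (x - y)"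
proof -
  have "norm (\<psi> t x - \<psi> t y) \<le> norm (\<psi> t x - \<psi> t y - (x - y)) + norm (x - y)"
    using norm_triangle_ineq[of "\<psi> t x - \<psi> t y - (x - y)" "x - y"] by simp
  also have "\<dots> \<le> (1 + L * t) * norm (x - y)" using psi_near_id[OF assms, of x y] by (simp add: algebra_simps)
  also have "\<dots> \<le> exp (L * t) * norm (x - y)" by (intro mult_right_mono exp_ge_add_one_self) auto
  finally show ?thesis .
qed

section \<open>Lipschitz and first-moment bounds for \<open>R t\<close>\<close>

lemma R_diff_le:
  assumes "0 \<le> t" "blip \<Lambda> f"
  shows "R t f x - R t f y \<le> \<Lambda> * norm (\<psi> t x - \<psi> t y)"
proof -
  interpret prob_space "\<mu> t" by (rule prob[OF assms(1)])
  note i = integrable_R[OF assms(1) blip_bcontfun[OF assms(2)]]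
  have "R t f x - R t f y = (\<integral>z. f (\<psi> t x + z) - f (\<psi> t y + z) \<partial>\<mu> t)"
    unfolding R_op_def using i by simp
  also have "\<dots> \<le> \<Lambda> * norm (\<psi> t x - \<psi> t y)"
    using i blip_diff[OF assms(2), of "\<psi> t x + z" "\<psi> t y + z" for z]
    by (intro integral_le_const) (auto intro!: always_eventually)
  finally show ?thesis .
qed

lemma R_abs_le:
  assumes "0 \<le> t" "f \<in> bcontfun" "\<And>x. \<bar>f x\<bar> \<le> r"
  shows "\<bar>R t f x\<bar> \<le> r"
proof -
  have r: "- r \<le> f x \<and> f x \<le> r" for x using assms(3)[of x] by linarith
  show ?thesis
    using R_mono[OF assms(1,2) const_bcontfun, of r x] R_mono[OF assms(1) const_bcontfun assms(2), of "-r" x]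
      r R_const[OF assms(1)] by auto
qed

lemma blip_R_small:
  assumes "0 \<le> t" "t \<le> 1" "blip \<Lambda> f"
  shows "blip (exp (L * t) * \<Lambda>) (R t f)"
proof -
  note f = blip_bcontfun[OF assms(3)]
  obtain r where r: "\<And>x. \<bar>f x\<bar> \<le> r" using bcontfun_bound[OF f] by blast
  show ?thesis
  proof (rule blipI)
    show "0 \<le> exp (L * t) * \<Lambda>" using blip_nonneg[OF assms(3)] by simp
    show "\<bar>R t f x\<bar> \<le> r" for x by (rule R_abs_le[OF assms(1) f r])
    show "R t f x - R t f y \<le> exp (L * t) * \<Lambda> * norm (x - y)" for x y
      using R_diff_le[OF assms(1,3), of x y]
        mult_left_mono[OF psi_lipschitz_small[OF assms(1,2), of x y] blip_nonneg[OF assms(3)]]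
      by (simp add: mult_ac)
  qed
qed

lemma blip_R_steps:
  assumes "0 \<le> t" "t \<le> 1" "blip \<Lambda> f"
  shows "blip (exp (L * (real k * t)) * \<Lambda>) (R (real k * t) f)"
proof (induction k)
  case 0
  then show ?case using R_0[OF blip_bcontfun[OF assms(3)]] assms(3) by simp
next
  case (Suc k)
  have "R (real (Suc k) * t) f = R t (R (real k * t) f)"
    using R_add_time[of t "real k * t" f] assms(1) blip_bcontfun[OF assms(3)] by (simp add: distrib_right)
  then show ?case using blip_R_small[OF assms(1,2) Suc.IH]
    by (simp add: exp_add distrib_left distrib_right mult_ac)
qed

text \<open>The hypothesis on the flow reaches only up to time 1. Subdividing loses nothing because
  exponentials multiply, which is why \<open>exp (L * t)\<close> stands in place of
  \<open>1 + L * t\<close>.\<close>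

lemma blip_R:
  assumes "0 \<le> t" "blip \<Lambda> f"
  shows "blip (exp (L * t) * \<Lambda>) (R t f)"
proof -
  obtain k :: nat where k: "max t 1 < real k" using reals_Archimedean2 by blast
  then have "0 \<le> t / real k" "t / real k \<le> 1" "real k * (t / real k) = t" using assms(1) by auto
  then show ?thesis using blip_R_steps[OF _ _ assms(2), of "t / real k" k] by simp
qed

text \<open>Testing the Lipschitz bound for \<open>R t\<close> with truncated linear functions.\<close>

lemma psi_lipschitz:
  assumes t: "0 \<le> t"
  shows "norm (\<psi> t x - \<psi> t y) \<le> exp (L * t) * norm (x - y)"
proof -
  interpret prob_space "\<mu> t" by (rule prob[OF t])
  \<comment> \<open>Its inner product with the difference is the full length of the difference;
    \<open>sgn 0 = 0\<close> covers coinciding points.\<close>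
  define e where "e = sgn (\<psi> t x - \<psi> t y)"
  have e1: "norm e \<le> 1" by (simp add: e_def norm_sgn)
  define f where "f N z = max (- real N) (min (real N) (e \<bullet> z))" for N z
  have fb: "\<bar>f N z\<bar> \<le> \<bar>e \<bullet> z\<bar>" "\<bar>f N z\<bar> \<le> real N" for N z by (auto simp: f_def)
  have blip: "blip 1 (f N)" for N
  proof (rule blipI[OF _ fb(2)])
    fix x y
    have "\<bar>e \<bullet> x - e \<bullet> y\<bar> \<le> norm e * norm (x - y)"
      using Cauchy_Schwarz_ineq2[of e "x - y"] by (simp add: inner_diff_right)
    also have "\<dots> \<le> 1 * norm (x - y)" using e1 by (intro mult_right_mono) auto
    finally show "f N x - f N y \<le> 1 * norm (x - y)" unfolding f_def by linarith
  qed simp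
  have lim: "(\<lambda>N. R t (f N) x) \<longlonglongrightarrow> (\<integral>y. e \<bullet> (\<psi> t x + y) \<partial>\<mu> t)" for x
    unfolding R_op_def
  proof (rule integral_dominated_convergence[where w="\<lambda>y. norm (\<psi> t x) + norm y"])
    show "integrable (\<mu> t) (\<lambda>y. norm (\<psi> t x) + norm y)" using integrable_norm_mu[OF t] by simp
    show "(\<lambda>y. e \<bullet> (\<psi> t x + y)) \<in> borel_measurable (\<mu> t)" by (rule measurable_mu[OF t]) simp
    show "(\<lambda>y. f N (\<psi> t x + y)) \<in> borel_measurable (\<mu> t)" for N
      unfolding f_def by (rule measurable_mu[OF t]) simp
    show "AE y in \<mu> t. (\<lambda>N. f N (\<psi> t x + y)) \<longlonglongrightarrow> e \<bullet> (\<psi> t x + y)"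
    proof (rule AE_I2)
      fix y
      obtain N0 :: nat where "\<bar>e \<bullet> (\<psi> t x + y)\<bar> < real N0" using reals_Archimedean2 by blast
      then have "\<forall>\<^sub>F N in sequentially. f N (\<psi> t x + y) = e \<bullet> (\<psi> t x + y)"
        by (intro eventually_sequentiallyI[of N0]) (auto simp: f_def)
      then show "(\<lambda>N. f N (\<psi> t x + y)) \<longlonglongrightarrow> e \<bullet> (\<psi> t x + y)" by (rule tendsto_eventually)
    qed
    show "AE y in \<mu> t. norm (f N (\<psi> t x + y)) \<le> norm (\<psi> t x) + norm y" for N
    proof (rule AE_I2)
      fix y
      have "\<bar>e \<bullet> (\<psi> t x + y)\<bar> \<le> norm e * norm (\<psi> t x + y)" by (rule Cauchy_Schwarz_ineq2)
      also have "\<dots> \<le> 1 * norm (\<psi> t x + y)" using e1 by (intro mult_right_mono) auto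
      finally show "norm (f N (\<psi> t x + y)) \<le> norm (\<psi> t x) + norm y"
        using fb(1)[of N "\<psi> t x + y"] norm_triangle_ineq[of "\<psi> t x" y] by simp
    qed
  qed
  have int: "integrable (\<mu> t) (\<lambda>y. e \<bullet> (z + y))" for z
  proof (rule Bochner_Integration.integrable_bound)
    show "integrable (\<mu> t) (\<lambda>y. norm z + norm y)" using integrable_norm_mu[OF t] by simp
    show "(\<lambda>y. e \<bullet> (z + y)) \<in> borel_measurable (\<mu> t)" by (rule measurable_mu[OF t]) simp
    show "AE y in \<mu> t. norm (e \<bullet> (z + y)) \<le> norm (norm z + norm y)"
    proof (rule AE_I2)
      fix y
      have "\<bar>e \<bullet> (z + y)\<bar> \<le> norm e * norm (z + y)" by (rule Cauchy_Schwarz_ineq2)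
      also have "\<dots> \<le> 1 * norm (z + y)" using e1 by (intro mult_right_mono) auto
      finally show "norm (e \<bullet> (z + y)) \<le> norm (norm z + norm y)"
        using norm_triangle_ineq[of z y] by simp
    qed
  qed
  have "(\<lambda>N. R t (f N) x - R t (f N) y) \<longlonglongrightarrow> (\<integral>z. e \<bullet> (\<psi> t x + z) \<partial>\<mu> t) - (\<integral>z. e \<bullet> (\<psi> t y + z) \<partial>\<mu> t)"
    by (intro tendsto_diff lim)
  also have "(\<integral>z. e \<bullet> (\<psi> t x + z) \<partial>\<mu> t) - (\<integral>z. e \<bullet> (\<psi> t y + z) \<partial>\<mu> t)
      = (\<integral>z. e \<bullet> (\<psi> t x - \<psi> t y) \<partial>\<mu> t)"
    by (subst Bochner_Integration.integral_diff[symmetric]) (use int in \<open>simp_all add: inner_add_right inner_diff_right\<close>)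
  also have "\<dots> = norm (\<psi> t x - \<psi> t y)"
    by (cases "\<psi> t x = \<psi> t y") (auto simp: e_def sgn_div_norm prob_space power2_norm_eq_inner[symmetric] power2_eq_square)
  finally show ?thesis
    by (rule LIMSEQ_le_const2) (use blip_diff[OF blip_R[OF t blip], where x=x and y=y] in auto)
qed

lemma R_min_norm_le:
  assumes s: "0 \<le> s" "s \<le> 1" and N: "0 \<le> N"
  shows "R s (\<lambda>x. min N (norm x)) x \<le> exp (L * s) * min N (norm x) + m s"
proof -
  interpret prob_space "\<mu> s" by (rule prob[OF s(1)])
  have e: "1 \<le> exp (L * s)" using L_nonneg s by simp
  have pt: "min N (norm (\<psi> s x + y)) \<le> exp (L * s) * min N (norm x) + norm y" for y
  proof -
    have "norm (\<psi> s x) \<le> exp (L * s) * norm x" using psi_lipschitz_small[OF s, of x 0] psi_0[OF s(1)] by simp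
    moreover have "1 * N \<le> exp (L * s) * N" using e N by (intro mult_right_mono)
    ultimately show ?thesis using norm_triangle_ineq[of "\<psi> s x" y] norm_ge_zero[of y]
      unfolding min_def by (smt (verit))
  qed
  have "R s (\<lambda>x. min N (norm x)) x \<le> (\<integral>y. exp (L * s) * min N (norm x) + norm y \<partial>\<mu> s)"
    unfolding R_op_def
    using integrable_R[OF s(1) blip_bcontfun[OF blip_min_norm[OF N]]] integrable_norm_mu[OF s(1)] pt
    by (intro integral_mono) auto
  also have "\<dots> = exp (L * s) * min N (norm x) + m s"
    using integrable_norm_mu[OF s(1)] by (simp add: m_def prob_space)
  finally show ?thesis .
qed

text \<open>A first-moment bound in disguise. The semigroup law is available on bounded functions,
  hence the truncation at \<open>N\<close>, of which the constants must be independent. Time is cut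
  into steps on which \<open>m\<close> is at most 1, so each step adds at most one exponential
  factor.\<close>

lemma R_min_norm_bound:
  assumes T: "0 \<le> T"
  obtains C where "0 \<le> C" "\<And>t N x. 0 \<le> t \<Longrightarrow> t \<le> T \<Longrightarrow> 0 \<le> N \<Longrightarrow>
    R t (\<lambda>x. min N (norm x)) x \<le> exp (L * T) * norm x + C"
proof -
  obtain \<delta> where \<delta>: "0 < \<delta>" "\<delta> \<le> 1" "\<And>t. 0 < t \<Longrightarrow> t \<le> \<delta> \<Longrightarrow> m t \<le> 1" using m_small[of 1] by auto
  obtain j :: nat where j: "T / \<delta> + 1 < real j" using reals_Archimedean2 by blast
  have j0: "real j > 0" using j T \<delta>(1) by (smt (verit) divide_nonneg_pos)
  have Tj: "T / real j \<le> \<delta>"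
  proof -
    have "T / \<delta> \<le> real j" using j by simp
    then show ?thesis using \<delta>(1) j0 by (simp add: field_simps)
  qed
  have "R t (\<lambda>x. min N (norm x)) x \<le> exp (L * T) * norm x + real j * exp (L * T)"
    if t: "0 \<le> t" "t \<le> T" and N: "0 \<le> N" for t N x
  proof (cases "t = 0")
    case True
    have "min N (norm x) \<le> exp (L * T) * norm x"
      using T L_nonneg mult_right_mono[of 1 "exp (L * T)" "norm x"] by (simp add: min_def)
    then show ?thesis using True R_0[OF blip_bcontfun[OF blip_min_norm[OF N]]] by (simp add: add_increasing2)
  next
    case False
    define s where "s = t / real j"
    have s: "0 < s" "s \<le> \<delta>"
      using t False j0 Tj divide_right_mono[of t T "real j"] by (auto simp: s_def)
    then have s1: "s \<le> 1" using \<delta>(2) by linarith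
    define w where "w x = min N (norm x)" for x :: 'a
    have wb: "w \<in> bcontfun" unfolding w_def by (rule blip_bcontfun[OF blip_min_norm[OF N]])
    have ind: "R (real i * s) w x \<le> exp (L * (real i * s)) * w x + real i * exp (L * (real i * s))" for i x
    proof (induction i arbitrary: x)
      case 0
      then show ?case using R_0[OF wb] by simp
    next
      case (Suc i)
      define E where "E = exp (L * (real i * s))"
      have E: "E \<ge> 1" "exp (L * s) \<ge> 1" using L_nonneg s by (auto simp: E_def)
      have EE: "exp (L * (real (Suc i) * s)) = E * exp (L * s)"
        by (simp add: E_def exp_add[symmetric] algebra_simps)
      have "R (real (Suc i) * s) w x = R s (R (real i * s) w) x"
        using R_add_time[of s "real i * s" w] s wb by (simp add: distrib_right)
      also have "\<dots> \<le> R s (\<lambda>x. E * w x + real i * E) x"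
        using Suc.IH s wb by (intro R_mono R_bcontfun bcontfun_add_const bcontfun_mult_left) (auto simp: E_def)
      also have "\<dots> = E * R s w x + real i * E"
        using R_add_const[of s "\<lambda>x. E * w x"] R_cmult s wb by (simp add: bcontfun_mult_left)
      also have "\<dots> \<le> E * (exp (L * s) * w x + 1) + real i * E"
      proof (intro add_right_mono mult_left_mono)
        show "R s w x \<le> exp (L * s) * w x + 1"
          using R_min_norm_le[of s N x] s s1 N \<delta>(3)[of s] unfolding w_def by simp
      qed (use E in auto)
      also have "\<dots> = E * exp (L * s) * w x + real (Suc i) * E * 1" by (simp add: algebra_simps)
      also have "\<dots> \<le> E * exp (L * s) * w x + real (Suc i) * E * exp (L * s)"
        using E by (intro add_left_mono mult_left_mono) auto
      finally show ?case by (simp only: EE mult.assoc)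
    qed
    have sj: "real j * s = t" using j0 by (simp add: s_def)
    have e: "exp (L * t) \<le> exp (L * T)" using t L_nonneg by (simp add: mult_left_mono)
    have "R t w x \<le> exp (L * t) * w x + real j * exp (L * t)" using ind[of j x] by (simp only: sj)
    also have "\<dots> \<le> exp (L * T) * norm x + real j * exp (L * T)"
      using e N by (intro add_mono mult_mono mult_left_mono) (auto simp: w_def)
    finally show ?thesis unfolding w_def[abs_def] .
  qed
  then show ?thesis using that[of "real j * exp (L * T)"] by simp
qed

section \<open>Admissible operators\<close>

text \<open>The properties shared by \<open>R t\<close>, by \<open>k\<close>-fold iterates of one-step operators with step \<open>t / k\<close>, and by their
  limits.\<close>

definition adm :: "real \<Rightarrow> (('a \<Rightarrow> real) \<Rightarrow> 'a \<Rightarrow> real) \<Rightarrow> bool" where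
  "adm t T \<longleftrightarrow> 0 \<le> t \<and>
    (\<forall>f\<in>bcontfun. \<forall>g\<in>bcontfun. (\<forall>x. f x \<le> g x) \<longrightarrow> (\<forall>x. T f x \<le> T g x)) \<and>
    (\<forall>f\<in>bcontfun. \<forall>g\<in>bcontfun. \<forall>l\<in>{0..1}. \<forall>x.
       T (\<lambda>y. l * f y + (1 - l) * g y) x \<le> l * T f x + (1 - l) * T g x) \<and>
    (\<forall>f\<in>bcontfun. \<forall>c x. T (\<lambda>y. f y + c) x = T f x + c) \<and>
    (\<forall>\<Lambda> f. blip \<Lambda> f \<longrightarrow>
       (\<forall>x y. T f x - T f y \<le> exp (L * t) * \<Lambda> * norm (x - y)) \<and>
       (\<forall>x. R t f x \<le> T f x \<and> T f x \<le> R t f x + t * \<Phi> (exp (L * t) * \<Lambda>)))"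

lemma
  assumes "adm t T"
  shows adm_time: "0 \<le> t"
    and adm_mono: "f \<in> bcontfun \<Longrightarrow> g \<in> bcontfun \<Longrightarrow> (\<And>x. f x \<le> g x) \<Longrightarrow> T f x \<le> T g x"
    and adm_convex: "f \<in> bcontfun \<Longrightarrow> g \<in> bcontfun \<Longrightarrow> 0 \<le> l \<Longrightarrow> l \<le> 1 \<Longrightarrow>
      T (\<lambda>y. l * f y + (1 - l) * g y) x \<le> l * T f x + (1 - l) * T g x"
    and adm_add_const: "f \<in> bcontfun \<Longrightarrow> T (\<lambda>y. f y + c) x = T f x + c"
    and adm_lipschitz: "blip \<Lambda> f \<Longrightarrow> T f x - T f y \<le> exp (L * t) * \<Lambda> * norm (x - y)"
    and adm_ge_R: "blip \<Lambda> f \<Longrightarrow> R t f x \<le> T f x"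
    and adm_le_R: "blip \<Lambda> f \<Longrightarrow> T f x \<le> R t f x + t * \<Phi> (exp (L * t) * \<Lambda>)"
proof -
  note a = assms[unfolded adm_def]
  show "0 \<le> t" using a by blast
  show "T f x \<le> T g x" if "f \<in> bcontfun" "g \<in> bcontfun" "\<And>x. f x \<le> g x" using a that by blast
  show "T (\<lambda>y. l * f y + (1 - l) * g y) x \<le> l * T f x + (1 - l) * T g x"
    if "f \<in> bcontfun" "g \<in> bcontfun" "0 \<le> l" "l \<le> 1"
  proof -
    have "l \<in> {0..1}" using that by simp
    then show ?thesis using a that by blast
  qed
  show "T (\<lambda>y. f y + c) x = T f x + c" if "f \<in> bcontfun" using a that by blast
  show "T f x - T f y \<le> exp (L * t) * \<Lambda> * norm (x - y)" "R t f x \<le> T f x"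
    "T f x \<le> R t f x + t * \<Phi> (exp (L * t) * \<Lambda>)" if "blip \<Lambda> f" using a that by blast+
qed

lemma exp_L_ge_1: "0 \<le> t \<Longrightarrow> 1 \<le> exp (L * t)"
  using L_nonneg by simp

text \<open>Constants have Lipschitz constant 0 and \<open>\<Phi> 0 = 0\<close>, so the two bounds
  in terms of \<open>R\<close> coincide.\<close>

lemma adm_const:
  assumes "adm t T"
  shows "T (\<lambda>_. c) x = c"
proof -
  note t = adm_time[OF assms]
  have "T (\<lambda>_. 0) x = 0"
    using adm_ge_R[OF assms blip_const, of 0 x] adm_le_R[OF assms blip_const, of 0 x] R_const[OF t]
    by (simp add: conjugate_0)
  then show ?thesis using adm_add_const[OF assms const_bcontfun, of 0 c x] by simp
qed

lemma adm_abs_le: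
  assumes "adm t T" "f \<in> bcontfun" "\<And>x. \<bar>f x\<bar> \<le> r"
  shows "\<bar>T f x\<bar> \<le> r"
proof -
  have r: "- r \<le> f x \<and> f x \<le> r" for x using assms(3)[of x] by linarith
  show ?thesis
    using adm_mono[OF assms(1,2) const_bcontfun, of r x] adm_mono[OF assms(1) const_bcontfun assms(2), of "-r" x]
      r adm_const[OF assms(1)] by auto
qed

lemma adm_blip:
  assumes "adm t T" "blip \<Lambda> f"
  shows "blip (exp (L * t) * \<Lambda>) (T f)"
proof -
  note f = blip_bcontfun[OF assms(2)]
  obtain r where r: "\<And>x. \<bar>f x\<bar> \<le> r" using bcontfun_bound[OF f] by blast
  show ?thesis
    by (rule blipI[OF _ adm_abs_le[OF assms(1) f r] adm_lipschitz[OF assms]])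
      (use blip_nonneg[OF assms(2)] in simp)
qed

text \<open>Convexity bounds \<open>T f - T g\<close> by \<open>\<theta> (T w - T g)\<close> with \<open>w = g + (f - g) / \<theta>\<close>; outside a large ball
  \<open>w\<close> is dominated by a function with a small Lipschitz constant.\<close>

lemma adm_gap:
  assumes T: "adm t T" and f: "f \<in> bcontfun" "\<And>x. \<bar>f x\<bar> \<le> r" and g: "g \<in> bcontfun" "\<And>x. \<bar>g x\<bar> \<le> r"
    and \<delta>: "0 \<le> \<delta>" "\<And>x. norm x \<le> M \<Longrightarrow> f x - g x \<le> \<delta>"
    and \<theta>: "0 < \<theta>" "\<theta> \<le> 1" and M: "0 < M" "exp (L * t) * (2 * r / (\<theta> * M)) \<le> 1"
  shows "T f x - T g x \<le> (2 * r / M) * (R t (\<lambda>x. min M (norm x)) x + t * exp (L * t) * \<Phi> 1) + 2 * r * \<theta> + \<delta>"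
proof -
  have r: "0 \<le> r" using f(2)[of 0] by linarith
  \<comment> \<open>The slope at which \<open>\<theta> * u\<close> reaches \<open>2 * r\<close> at
    radius \<open>M\<close>; \<open>2 * r\<close> is the largest possible gap between
    \<open>f\<close> and \<open>g\<close>.\<close>
  define c where "c = 2 * r / (\<theta> * M)"
  have c: "0 \<le> c" using r \<theta> M by (simp add: c_def)
  define w where "w y = g y + (1 / \<theta>) * (f y - g y)" for y
  define u where "u y = c * min M (norm y)" for y :: 'a
  have wb: "w \<in> bcontfun" unfolding w_def using f g by (intro plus_cont bcontfun_mult_left minus_cont)
  have u: "blip c u" unfolding u_def using blip_cmult[OF c blip_min_norm[of M]] M by simp
  have fw: "f = (\<lambda>y. \<theta> * w y + (1 - \<theta>) * g y)" using \<theta> by (auto simp: w_def fun_eq_iff field_simps)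
  have 1: "T f x \<le> \<theta> * T w x + (1 - \<theta>) * T g x"
    using adm_convex[OF T wb g(1), of \<theta> x] \<theta> by (simp flip: fw)
  have wle: "w y \<le> u y + (r + \<delta> / \<theta>)" for y
  proof -
    have "f y - g y \<le> \<delta> + \<theta> * u y"
    proof (cases "norm y \<le> M")
      case True
      have "0 \<le> \<theta> * u y" using c \<theta> M by (simp add: u_def)
      then show ?thesis using \<delta>(2)[OF True] by simp
    next
      case False
      then have "\<theta> * u y = 2 * r" using \<theta> M by (simp add: u_def c_def)
      then show ?thesis using f(2)[of y] g(2)[of y] \<delta> by linarith
    qed
    then have "(1 / \<theta>) * (f y - g y) \<le> (1 / \<theta>) * (\<delta> + \<theta> * u y)" using \<theta> by (intro mult_left_mono) auto
    then have "(1 / \<theta>) * (f y - g y) \<le> \<delta> / \<theta> + u y" using \<theta> by (simp add: field_simps)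
    then show ?thesis using g(2)[of y] unfolding w_def by linarith
  qed
  have "T w x \<le> T (\<lambda>y. u y + (r + \<delta> / \<theta>)) x"
    using adm_mono[OF T wb bcontfun_add_const[OF blip_bcontfun[OF u]] wle, of x] .
  also have "\<dots> = T u x + (r + \<delta> / \<theta>)" by (rule adm_add_const[OF T blip_bcontfun[OF u]])
  finally have w1: "T w x \<le> T u x + (r + \<delta> / \<theta>)" .
  have w2: "T u x \<le> R t u x + t * \<Phi> (exp (L * t) * c)" by (rule adm_le_R[OF T u])
  \<comment> \<open>The size condition on \<open>M\<close> puts the slope below 1, so the penalty is
    linear in \<open>c\<close> and, after multiplication by \<open>\<theta>\<close>, of order
    \<open>1 / M\<close>.\<close>
  have "\<Phi> (exp (L * t) * c) \<le> exp (L * t) * c * \<Phi> 1"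
    using conjugate_scale[of 1 "exp (L * t) * c"] M(2)[folded c_def] c by simp
  then have w3: "t * \<Phi> (exp (L * t) * c) \<le> t * (exp (L * t) * c * \<Phi> 1)"
    using adm_time[OF T] by (rule mult_left_mono)
  have w4: "R t u x = c * R t (\<lambda>x. min M (norm x)) x" unfolding u_def by (rule R_cmult)
  have "c * (R t (\<lambda>x. min M (norm x)) x + t * exp (L * t) * \<Phi> 1)
      = c * R t (\<lambda>x. min M (norm x)) x + t * (exp (L * t) * c * \<Phi> 1)" by (simp add: algebra_simps)
  then have 2: "T w x \<le> c * (R t (\<lambda>x. min M (norm x)) x + t * exp (L * t) * \<Phi> 1) + r + \<delta> / \<theta>"
    using w1 w2 w3 w4 by linarith
  have "- r \<le> T g x" using adm_abs_le[OF T g, of x] by linarith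
  then have "T w x - T g x \<le> c * (R t (\<lambda>x. min M (norm x)) x + t * exp (L * t) * \<Phi> 1) + 2 * r + \<delta> / \<theta>"
    using 2 by linarith
  then have "\<theta> * (T w x - T g x) \<le> \<theta> * (c * (R t (\<lambda>x. min M (norm x)) x + t * exp (L * t) * \<Phi> 1) + 2 * r + \<delta> / \<theta>)"
    using \<theta> by (intro mult_left_mono) auto
  also have "\<dots> = (2 * r / M) * (R t (\<lambda>x. min M (norm x)) x + t * exp (L * t) * \<Phi> 1) + 2 * r * \<theta> + \<delta>"
    using \<theta> by (simp add: c_def distrib_left mult_ac)
  finally show ?thesis using 1 by (simp add: algebra_simps)
qed

text \<open>One pair \<open>M\<close>, \<open>\<delta>\<close> for all admissible operators up to
  time \<open>T0\<close>: it serves the iterates for every step size and their limit alike.\<close>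

definition equi_modulus where
  "equi_modulus T0 r M0 \<epsilon> M \<delta> \<longleftrightarrow> 0 < \<delta> \<and> (\<forall>t T f g x. adm t T \<longrightarrow> t \<le> T0 \<longrightarrow> f \<in> bcontfun \<longrightarrow> g \<in> bcontfun \<longrightarrow>
    (\<forall>x. \<bar>f x\<bar> \<le> r) \<longrightarrow> (\<forall>x. \<bar>g x\<bar> \<le> r) \<longrightarrow> (\<forall>x. norm x \<le> M \<longrightarrow> \<bar>f x - g x\<bar> \<le> \<delta>) \<longrightarrow>
    norm x \<le> M0 \<longrightarrow> \<bar>T f x - T g x\<bar> \<le> \<epsilon>)"

lemma equi_modulusD:
  assumes "equi_modulus T0 r M0 \<epsilon> M \<delta>"
  shows "0 < \<delta>" "adm t T \<Longrightarrow> t \<le> T0 \<Longrightarrow> f \<in> bcontfun \<Longrightarrow> g \<in> bcontfun \<Longrightarrow>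
    (\<And>x. \<bar>f x\<bar> \<le> r) \<Longrightarrow> (\<And>x. \<bar>g x\<bar> \<le> r) \<Longrightarrow> (\<And>x. norm x \<le> M \<Longrightarrow> \<bar>f x - g x\<bar> \<le> \<delta>) \<Longrightarrow>
    norm x \<le> M0 \<Longrightarrow> \<bar>T f x - T g x\<bar> \<le> \<epsilon>"
  using assms unfolding equi_modulus_def by (simp, blast)

text \<open>The three terms of \<open>adm_gap\<close> get a third of \<open>\<epsilon>\<close> each:
  \<open>\<theta>\<close> is fixed by the middle term, then \<open>M\<close> depending on
  \<open>\<theta>\<close>, and the last third is the closeness on the ball.\<close>

lemma adm_equicontinuous:
  assumes T0: "0 \<le> T0" and \<epsilon>: "0 < \<epsilon>" and r: "0 \<le> r"
  obtains M \<delta> where "equi_modulus T0 r M0 \<epsilon> M \<delta>"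
proof -
  obtain C where C: "0 \<le> C" "\<And>t N x. 0 \<le> t \<Longrightarrow> t \<le> T0 \<Longrightarrow> 0 \<le> N \<Longrightarrow>
    R t (\<lambda>x. min N (norm x)) x \<le> exp (L * T0) * norm x + C"
    using R_min_norm_bound[OF T0] by blast
  define E where "E = exp (L * T0)"
  define \<theta> where "\<theta> = min 1 (\<epsilon> / (6 * (r + 1)))"
  have \<theta>: "0 < \<theta>" "\<theta> \<le> 1" using \<epsilon> r by (auto simp: \<theta>_def)
  have "2 * r * \<theta> \<le> 2 * r * (\<epsilon> / (6 * (r + 1)))" using r by (intro mult_left_mono) (auto simp: \<theta>_def)
  also have "\<dots> \<le> \<epsilon> / 3" using \<epsilon> r by (simp add: field_simps)
  finally have \<theta>r: "2 * r * \<theta> \<le> \<epsilon> / 3" .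
  define B where "B = E * \<bar>M0\<bar> + C + T0 * E * \<Phi> 1"
  have \<Phi>1: "0 \<le> \<Phi> 1" by (rule conjugate_nonneg) simp
  have E1: "1 \<le> E" unfolding E_def by (rule exp_L_ge_1[OF T0])
  have B: "0 \<le> B" using E1 C(1) T0 \<Phi>1 by (simp add: B_def)
  \<comment> \<open>The second summand makes \<open>2 * r / M * B\<close> small, the third meets the
    slope condition of \<open>adm_gap\<close>.\<close>
  define M where "M = 1 + 6 * r * B / \<epsilon> + 2 * r * E / \<theta>"
  have n: "0 \<le> 6 * r * B / \<epsilon>" "0 \<le> 2 * r * E / \<theta>" using r B \<epsilon> E1 \<theta> by auto
  have M: "0 < M" "6 * r * B / \<epsilon> \<le> M" "2 * r * E / \<theta> \<le> M" using n by (auto simp: M_def)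
  have MB: "2 * r / M * B \<le> \<epsilon> / 3"
  proof -
    have "6 * r * B \<le> M * \<epsilon>" using M(2) \<epsilon> by (simp add: pos_divide_le_eq)
    then show ?thesis using M(1) by (simp add: field_simps)
  qed
  have ME: "E * (2 * r / (\<theta> * M)) \<le> 1"
  proof -
    have "2 * r * E \<le> M * \<theta>" using M(3) \<theta> by (simp add: pos_divide_le_eq)
    then show ?thesis using M(1) \<theta> by (simp add: field_simps)
  qed
  have one: "T f x - T g x \<le> \<epsilon>"
    if T: "adm t T" "t \<le> T0" and f: "f \<in> bcontfun" "\<And>x. \<bar>f x\<bar> \<le> r" and g: "g \<in> bcontfun" "\<And>x. \<bar>g x\<bar> \<le> r"
      and d: "\<And>x. norm x \<le> M \<Longrightarrow> f x - g x \<le> \<epsilon> / 3" and x: "norm x \<le> M0" for t T f g x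
  proof -
    note t = adm_time[OF T(1)]
    have Et: "exp (L * t) \<le> E" unfolding E_def using T(2) L_nonneg by (simp add: mult_left_mono)
    have "exp (L * t) * (2 * r / (\<theta> * M)) \<le> E * (2 * r / (\<theta> * M))"
      using Et r \<theta> M by (intro mult_right_mono) auto
    then have "exp (L * t) * (2 * r / (\<theta> * M)) \<le> 1" using ME by linarith
    then have "T f x - T g x \<le> (2 * r / M) * (R t (\<lambda>x. min M (norm x)) x + t * exp (L * t) * \<Phi> 1) + 2 * r * \<theta> + \<epsilon> / 3"
      using adm_gap[OF T(1) f g _ d \<theta> M(1)] \<epsilon> by simp
    moreover have "(2 * r / M) * (R t (\<lambda>x. min M (norm x)) x + t * exp (L * t) * \<Phi> 1) \<le> (2 * r / M) * B"
    proof (rule mult_left_mono)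
      have "E * norm x \<le> E * \<bar>M0\<bar>" using x E1 by (intro mult_left_mono) auto
      then have "R t (\<lambda>x. min M (norm x)) x \<le> E * \<bar>M0\<bar> + C"
        using C(2)[OF t T(2), of M x, folded E_def] M(1) by linarith
      moreover have "t * exp (L * t) * \<Phi> 1 \<le> T0 * E * \<Phi> 1"
        using t T(2) Et \<Phi>1 by (intro mult_right_mono mult_mono) auto
      ultimately show "R t (\<lambda>x. min M (norm x)) x + t * exp (L * t) * \<Phi> 1 \<le> B" by (simp add: B_def)
    qed (use r M in auto)
    ultimately show ?thesis using MB \<theta>r by linarith
  qed
  have "equi_modulus T0 r M0 \<epsilon> M (\<epsilon> / 3)"
    unfolding equi_modulus_def
  proof (intro conjI allI impI)
    show "0 < \<epsilon> / 3" using \<epsilon> by simp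
    fix t T and x :: 'a and f g :: "'a \<Rightarrow> real"
    assume a: "adm t T" "t \<le> T0" "f \<in> bcontfun" "g \<in> bcontfun" "\<forall>x. \<bar>f x\<bar> \<le> r" "\<forall>x. \<bar>g x\<bar> \<le> r"
      and d: "\<forall>x. norm x \<le> M \<longrightarrow> \<bar>f x - g x\<bar> \<le> \<epsilon> / 3" and x: "norm x \<le> M0"
    have d': "f x - g x \<le> \<epsilon> / 3" "g x - f x \<le> \<epsilon> / 3" if "norm x \<le> M" for x
      using d[rule_format, OF that] by linarith+
    have "T f x - T g x \<le> \<epsilon>"
      by (rule one[OF a(1,2,3) _ a(4) _ d'(1) x]) (use a in auto)
    moreover have "T g x - T f x \<le> \<epsilon>"
      by (rule one[OF a(1,2,4) _ a(3) _ d'(2) x]) (use a in auto)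
    ultimately show "\<bar>T f x - T g x\<bar> \<le> \<epsilon>" by linarith
  qed
  then show ?thesis by (rule that)
qed

text \<open>Lipschitz functions have Lipschitz images. A general \<open>f\<close> is replaced by
  such a function on a large ball, which changes \<open>T f\<close> little on the ball of radius
  \<open>norm x + 1\<close>.\<close>

lemma adm_bcontfun:
  assumes T: "adm t T" and f: "f \<in> bcontfun"
  shows "T f \<in> bcontfun"
proof -
  obtain r where r: "r \<ge> 0" "\<And>x. \<bar>f x\<bar> \<le> r" using bcontfun_bound[OF f] by blast
  have "isCont (T f) x" for x
    unfolding continuous_at_eps_delta
  proof (intro allI impI)
    fix e :: real assume e: "e > 0"
    then have e4: "0 < e / 4" by simp
    obtain M \<delta> where M: "equi_modulus t r (norm x + 1) (e / 4) M \<delta>"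
      using adm_equicontinuous[OF adm_time[OF T] e4 r(1)] .
    note \<delta> = equi_modulusD(1)[OF M]
    obtain g \<Lambda> where g: "blip \<Lambda> g" "\<forall>x. \<bar>g x\<bar> \<le> r" "\<forall>x. norm x \<le> M \<longrightarrow> \<bar>f x - g x\<bar> \<le> \<delta>"
      using lipschitz_approx[OF f r(2) \<delta>] .
    define K where "K = exp (L * t) * \<Lambda>"
    have K: "0 \<le> K" using blip_nonneg[OF g(1)] by (simp add: K_def)
    have close: "\<bar>T f y - T g y\<bar> \<le> e / 4" if "norm y \<le> norm x + 1" for y
      by (rule equi_modulusD(2)[OF M T order_refl f blip_bcontfun[OF g(1)] r(2) _ _ that]) (use g in auto)
    show "\<exists>d>0. \<forall>x'. dist x' x < d \<longrightarrow> dist (T f x') (T f x) < e"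
    proof (intro exI[of _ "min 1 (e / (4 * (K + 1)))"] conjI allI impI)
      show "0 < min 1 (e / (4 * (K + 1)))" using e K by simp
      fix y assume "dist y x < min 1 (e / (4 * (K + 1)))"
      then have y: "norm (y - x) < 1" "norm (y - x) \<le> e / (4 * (K + 1))" by (auto simp: dist_norm)
      have "norm y \<le> norm x + 1" using norm_triangle_sub[of y x] y(1) by linarith
      moreover have "\<bar>T g y - T g x\<bar> \<le> K * norm (y - x)"
        unfolding K_def by (rule blip_abs_diff[OF adm_blip[OF T g(1)]])
      moreover have "K * norm (y - x) \<le> e / 4"
      proof -
        have "K * norm (y - x) \<le> K * (e / (4 * (K + 1)))" using y K by (intro mult_left_mono)
        also have "\<dots> \<le> e / 4" using K e by (simp add: field_simps)
        finally show ?thesis .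
      qed
      ultimately show "dist (T f y) (T f x) < e"
        using close[of y] close[of x] e unfolding dist_real_def by linarith
    qed
  qed
  then have "continuous_on UNIV (T f)" by (simp add: continuous_on_eq_continuous_at)
  then show ?thesis using adm_abs_le[OF T f r(2)] by (rule bcontfunI)
qed

text \<open>Exponentials multiply and penalties add: \<open>T f\<close> is dominated by
  \<open>R t f\<close> plus a constant, the constant passes through \<open>S\<close>, and
  \<open>S\<close> then meets a function of Lipschitz constant
  \<open>exp (L * t) * \<Lambda>\<close>.\<close>

lemma adm_compose:
  assumes S: "adm s S" and T: "adm t T"
  shows "adm (s + t) (\<lambda>f. S (T f))"
proof -
  note s = adm_time[OF S] and t = adm_time[OF T]
  note Tb = adm_bcontfun[OF T]
  have E: "exp (L * (s + t)) = exp (L * s) * exp (L * t)" by (simp add: distrib_left exp_add)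
  have "S (T (\<lambda>y. l * f y + (1 - l) * g y)) x \<le> l * S (T f) x + (1 - l) * S (T g) x"
    if f: "f \<in> bcontfun" and g: "g \<in> bcontfun" and l: "l \<in> {0..1}" for f g l x
  proof -
    have b: "(\<lambda>y. l * u y + (1 - l) * v y) \<in> bcontfun" if "u \<in> bcontfun" "v \<in> bcontfun" for u v :: "'a \<Rightarrow> real"
      using that by (intro plus_cont bcontfun_mult_left)
    have "S (T (\<lambda>y. l * f y + (1 - l) * g y)) x \<le> S (\<lambda>y. l * T f y + (1 - l) * T g y) x"
      using l by (intro adm_mono[OF S] adm_convex[OF T] b Tb f g) auto
    also have "\<dots> \<le> l * S (T f) x + (1 - l) * S (T g) x" using l by (intro adm_convex[OF S] Tb f g) auto
    finally show ?thesis .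
  qed
  moreover have "S (T (\<lambda>y. f y + c)) x = S (T f) x + c" if f: "f \<in> bcontfun" for f c x
    using adm_add_const[OF T f] adm_add_const[OF S Tb[OF f]] by presburger
  moreover have "S (T f) x - S (T f) y \<le> exp (L * (s + t)) * \<Lambda> * norm (x - y)"
    and "R (s + t) f x \<le> S (T f) x" and "S (T f) x \<le> R (s + t) f x + (s + t) * \<Phi> (exp (L * (s + t)) * \<Lambda>)"
    if f: "blip \<Lambda> f" for f \<Lambda> x y
  proof -
    note fb = blip_bcontfun[OF f]
    note l0 = blip_nonneg[OF f]
    note R' = R_add_time[OF s t fb]
    note Rf = blip_R[OF t f]
    show "S (T f) x - S (T f) y \<le> exp (L * (s + t)) * \<Lambda> * norm (x - y)"
      using adm_lipschitz[OF S adm_blip[OF T f]] by (simp add: E mult.assoc)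
    have "R s (R t f) x \<le> S (R t f) x" by (rule adm_ge_R[OF S Rf])
    also have "\<dots> \<le> S (T f) x" by (intro adm_mono[OF S] R_bcontfun t fb Tb adm_ge_R[OF T f])
    finally show "R (s + t) f x \<le> S (T f) x" by (simp add: R')
    define \<kappa> where "\<kappa> = \<Phi> (exp (L * t) * \<Lambda>)"
    have k: "\<kappa> \<le> \<Phi> (exp (L * (s + t)) * \<Lambda>)"
      unfolding \<kappa>_def using l0 s L_nonneg by (intro conjugate_mono mult_right_mono) (auto simp: distrib_left)
    have "S (T f) x \<le> S (\<lambda>y. R t f y + t * \<kappa>) x"
      unfolding \<kappa>_def by (intro adm_mono[OF S] adm_le_R[OF T f] Tb fb bcontfun_add_const R_bcontfun t)
    also have "\<dots> = S (R t f) x + t * \<kappa>" by (intro adm_add_const[OF S] R_bcontfun t fb)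
    also have "S (R t f) x \<le> R s (R t f) x + s * \<Phi> (exp (L * s) * (exp (L * t) * \<Lambda>))"
      by (rule adm_le_R[OF S Rf])
    finally have "S (T f) x \<le> R (s + t) f x + s * \<Phi> (exp (L * (s + t)) * \<Lambda>) + t * \<kappa>"
      by (simp add: R' E mult.assoc)
    then show "S (T f) x \<le> R (s + t) f x + (s + t) * \<Phi> (exp (L * (s + t)) * \<Lambda>)"
      using mult_left_mono[OF k t] by (simp add: distrib_right)
  qed
  moreover have "S (T f) x \<le> S (T g) x" if "f \<in> bcontfun" "g \<in> bcontfun" "\<And>x. f x \<le> g x" for f g x
    using that by (intro adm_mono[OF S] adm_mono[OF T] Tb)
  ultimately show ?thesis unfolding adm_def using s t by auto
qed

lemma adm_R: "0 \<le> t \<Longrightarrow> adm t (R t)"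
proof -
  assume t: "0 \<le> t"
  have "R t (\<lambda>y. l * f y + (1 - l) * g y) x \<le> l * R t f x + (1 - l) * R t g x"
    if "f \<in> bcontfun" "g \<in> bcontfun" for f g l x
    using R_add[OF t bcontfun_mult_left[OF that(1), of l] bcontfun_mult_left[OF that(2), of "1 - l"]]
    by (simp add: R_cmult)
  moreover have "0 \<le> t * \<Phi> (exp (L * t) * \<Lambda>)" if "blip \<Lambda> f" for \<Lambda> and f :: "'a \<Rightarrow> real"
    using t conjugate_nonneg[of "exp (L * t) * \<Lambda>"] blip_nonneg[OF that] by simp
  ultimately show ?thesis
    unfolding adm_def using t R_mono[OF t] R_add_const[OF t] blip_diff[OF blip_R[OF t]] by auto
qed

lemma adm_id: "adm 0 (\<lambda>f. f)"
proof -
  show ?thesis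
    unfolding adm_def using blip_diff blip_bcontfun[THEN R_0]
    by (auto simp: conjugate_nonneg)
qed

lemma adm_power:
  assumes "adm t T"
  shows "adm (real k * t) (T ^^ k)"
proof (induction k)
  case 0
  then show ?case using adm_id by (simp add: id_def)
next
  case (Suc k)
  have "T ^^ Suc k = (\<lambda>f. T ((T ^^ k) f))" by (simp add: fun_eq_iff)
  then show ?case using adm_compose[OF assms Suc] by (simp add: distrib_right)
qed

text \<open>The flow displaces by at most \<open>L t |x|\<close>, the noise by \<open>m t\<close> on
  average. The first grows with \<open>x\<close>, which is why continuity at time 0 is obtained only
  locally.\<close>

lemma R_minus_id:
  assumes t: "0 \<le> t" "t \<le> 1" and f: "blip \<Lambda> f"
  shows "\<bar>R t f x - f x\<bar> \<le> \<Lambda> * (L * t * norm x + m t)"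
proof -
  interpret prob_space "\<mu> t" by (rule prob[OF t(1)])
  note i = integrable_R[OF t(1) blip_bcontfun[OF f]]
  note im = integrable_norm_mu[OF t(1)]
  have "R t f x - f x = (\<integral>y. f (\<psi> t x + y) - f x \<partial>\<mu> t)"
    unfolding R_op_def using i by (simp add: prob_space)
  also have "norm \<dots> \<le> (\<integral>y. norm (f (\<psi> t x + y) - f x) \<partial>\<mu> t)"
    by (rule integral_norm_bound)
  also have "\<dots> \<le> (\<integral>y. \<Lambda> * (L * t * norm x + norm y) \<partial>\<mu> t)"
  proof (rule integral_mono)
    fix y
    have "norm (\<psi> t x + y - x) \<le> L * t * norm x + norm y"
      using norm_triangle_ineq[of "\<psi> t x - x" y] psi_minus_id[OF t, of x] by (simp add: algebra_simps)
    then have "\<Lambda> * norm (\<psi> t x + y - x) \<le> \<Lambda> * (L * t * norm x + norm y)"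
      using blip_nonneg[OF f] by (rule mult_left_mono)
    then show "norm (f (\<psi> t x + y) - f x) \<le> \<Lambda> * (L * t * norm x + norm y)"
      using blip_abs_diff[OF f, of "\<psi> t x + y" x] by simp
  qed (use i im in auto)
  also have "\<dots> = \<Lambda> * (L * t * norm x + m t)" using im by (simp add: m_def prob_space)
  finally show ?thesis by simp
qed

lemma adm_near_id:
  assumes "0 \<le> \<Lambda>" "0 < \<epsilon>"
  obtains \<delta> where "0 < \<delta>" "\<forall>t T f x. adm t T \<longrightarrow> t \<le> \<delta> \<longrightarrow> blip \<Lambda> f \<longrightarrow> norm x \<le> M \<longrightarrow> \<bar>T f x - f x\<bar> \<le> \<epsilon>"
proof -
  \<comment> \<open>Penalty rate for times up to 1, to which \<open>\<delta>\<close>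
    restricts.\<close>
  define \<kappa> where "\<kappa> = \<Phi> (exp L * \<Lambda>)"
  have \<kappa>: "0 \<le> \<kappa>" unfolding \<kappa>_def using assms by (intro conjugate_nonneg) simp
  have "0 < \<epsilon> / (3 * (\<Lambda> + 1))" using assms by simp
  then obtain d where d: "0 < d" "d \<le> 1" "\<And>t. 0 < t \<Longrightarrow> t \<le> d \<Longrightarrow> m t \<le> \<epsilon> / (3 * (\<Lambda> + 1))"
    using m_small by blast
  define \<delta> where "\<delta> = min d (min (\<epsilon> / (3 * (\<Lambda> * L * \<bar>M\<bar> + 1))) (\<epsilon> / (3 * (\<kappa> + 1))))"
  have pos: "0 < \<Lambda> * L * \<bar>M\<bar> + 1" using assms L_nonneg by (simp add: add_nonneg_pos)
  have "\<bar>T f x - f x\<bar> \<le> \<epsilon>" if T: "adm t T" and t\<delta>: "t \<le> \<delta>" and f: "blip \<Lambda> f" and x: "norm x \<le> M" for t T f x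
  proof (cases "t = 0")
    case True
    have "T f x = f x" using adm_ge_R[OF T f, of x] adm_le_R[OF T f, of x] R_0[OF blip_bcontfun[OF f]] True by simp
    then show ?thesis using assms by simp
  next
    case False
    note t0 = adm_time[OF T]
    have t: "0 < t" "t \<le> d" "t \<le> \<epsilon> / (3 * (\<Lambda> * L * \<bar>M\<bar> + 1))" "t \<le> \<epsilon> / (3 * (\<kappa> + 1))"
      using False t0 t\<delta> by (auto simp: \<delta>_def)
    have t1: "t \<le> 1" using t d by linarith
    have "exp (L * t) * \<Lambda> \<le> exp L * \<Lambda>" using assms t1 t0 L_nonneg by (intro mult_right_mono) (auto simp: mult_left_le)
    then have "\<Phi> (exp (L * t) * \<Lambda>) \<le> \<kappa>" unfolding \<kappa>_def using assms by (intro conjugate_mono) auto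
    then have "t * \<Phi> (exp (L * t) * \<Lambda>) \<le> t * \<kappa>" using t0 by (rule mult_left_mono)
    also have "\<dots> \<le> \<epsilon> / 3"
    proof -
      have "t * (3 * (\<kappa> + 1)) \<le> \<epsilon>" using t(4) \<kappa> by (simp add: pos_le_divide_eq)
      then show ?thesis using t(1) by (simp add: algebra_simps)
    qed
    finally have 1: "t * \<Phi> (exp (L * t) * \<Lambda>) \<le> \<epsilon> / 3" .
    have "\<Lambda> * m t \<le> \<Lambda> * (\<epsilon> / (3 * (\<Lambda> + 1)))" using d(3) t assms by (intro mult_left_mono) auto
    also have "\<dots> \<le> \<epsilon> / 3" using assms by (simp add: field_simps)
    finally have 2: "\<Lambda> * m t \<le> \<epsilon> / 3" .
    have "\<Lambda> * (L * t * norm x) \<le> \<Lambda> * (L * t * \<bar>M\<bar>)"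
      using x assms L_nonneg t0 by (intro mult_left_mono) auto
    also have "\<dots> \<le> \<epsilon> / 3"
    proof -
      have "t * (3 * (\<Lambda> * L * \<bar>M\<bar> + 1)) \<le> \<epsilon>" using t(3) pos by (simp add: pos_le_divide_eq)
      then show ?thesis using t(1) by (simp add: algebra_simps)
    qed
    finally have 3: "\<Lambda> * (L * t * norm x) \<le> \<epsilon> / 3" .
    have "\<bar>R t f x - f x\<bar> \<le> \<Lambda> * (L * t * norm x) + \<Lambda> * m t"
      using R_minus_id[OF t0 t1 f, of x] by (simp add: distrib_left)
    then show ?thesis using adm_ge_R[OF T f, of x] adm_le_R[OF T f, of x] 1 2 3 by linarith
  qed
  moreover have "0 < \<delta>" using d assms pos \<kappa> by (simp add: \<delta>_def)
  ultimately show ?thesis using that by blast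
qed

text \<open>Both one-step operators are suprema of normalised monotone linear maps minus constants,
  which gives convexity, monotonicity and translation by constants; specific to each are only the
  bounds against \<open>R t\<close>. The Lipschitz estimate has the displacement of the flow on its
  right side, so it is valid beyond time 1 by \<open>psi_lipschitz\<close>.\<close>

lemma adm_of_sup:
  assumes t: "0 \<le> t"
    and ge: "\<And>i f x. i \<in> X \<Longrightarrow> f \<in> bcontfun \<Longrightarrow> A i f x - P i \<le> T f x"
    and le: "\<And>f x a. f \<in> bcontfun \<Longrightarrow> (\<And>i. i \<in> X \<Longrightarrow> A i f x - P i \<le> a) \<Longrightarrow> T f x \<le> a"
    and mono: "\<And>i f g x. i \<in> X \<Longrightarrow> f \<in> bcontfun \<Longrightarrow> g \<in> bcontfun \<Longrightarrow> (\<And>x. f x \<le> g x) \<Longrightarrow> A i f x \<le> A i g x"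
    and add: "\<And>i f g x. i \<in> X \<Longrightarrow> f \<in> bcontfun \<Longrightarrow> g \<in> bcontfun \<Longrightarrow> A i (\<lambda>y. f y + g y) x = A i f x + A i g x"
    and cmult: "\<And>i f a x. A i (\<lambda>y. a * f y) x = a * A i f x"
    and const: "\<And>i c x. i \<in> X \<Longrightarrow> A i (\<lambda>_. c) x = c"
    and lip: "\<And>i \<Lambda> f x y. i \<in> X \<Longrightarrow> blip \<Lambda> f \<Longrightarrow> A i f x - A i f y \<le> \<Lambda> * norm (\<psi> t x - \<psi> t y)"
    and low: "\<And>\<Lambda> f x. blip \<Lambda> f \<Longrightarrow> R t f x \<le> T f x"
    and up: "\<And>i \<Lambda> f x. i \<in> X \<Longrightarrow> blip \<Lambda> f \<Longrightarrow> A i f x - P i \<le> R t f x + t * \<Phi> \<Lambda>"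
  shows "adm t T"
  unfolding adm_def
proof (intro conjI ballI allI impI t)
  fix f g :: "'a \<Rightarrow> real" and x assume f: "f \<in> bcontfun" and g: "g \<in> bcontfun"
  show "T f x \<le> T g x" if "\<forall>x. f x \<le> g x"
    using mono[OF _ f g, of _ x] ge[OF _ g, of _ x] that by (intro le[OF f]) fastforce
  fix l :: real assume l: "l \<in> {0..1}"
  note lf = bcontfun_mult_left[OF f, of l] and lg = bcontfun_mult_left[OF g, of "1 - l"]
  show "T (\<lambda>y. l * f y + (1 - l) * g y) x \<le> l * T f x + (1 - l) * T g x"
  proof (rule le[OF plus_cont[OF lf lg]])
    fix i assume i: "i \<in> X"
    have "l * (A i f x - P i) \<le> l * T f x" "(1 - l) * (A i g x - P i) \<le> (1 - l) * T g x"
      using ge[OF i f] ge[OF i g] l by (auto intro!: mult_left_mono)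
    then show "A i (\<lambda>y. l * f y + (1 - l) * g y) x - P i \<le> l * T f x + (1 - l) * T g x"
      unfolding add[OF i lf lg] cmult by (simp add: algebra_simps)
  qed
next
  fix f :: "'a \<Rightarrow> real" and c x assume f: "f \<in> bcontfun"
  have A: "A i (\<lambda>y. f y + c) x = A i f x + c" if "i \<in> X" for i
    using add[OF that f const_bcontfun] const[OF that] by simp
  have "T (\<lambda>y. f y + c) x \<le> T f x + c"
    using A ge[OF _ f, of _ x] by (intro le bcontfun_add_const f) (fastforce simp: algebra_simps)
  moreover have "T f x \<le> T (\<lambda>y. f y + c) x - c"
    using A ge[OF _ bcontfun_add_const[OF f], of _ c x] by (intro le f) (fastforce simp: algebra_simps)
  ultimately show "T (\<lambda>y. f y + c) x = T f x + c" by simp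
next
  fix \<Lambda> x y and f :: "'a \<Rightarrow> real" assume f: "blip \<Lambda> f"
  note fb = blip_bcontfun[OF f]
  note l0 = blip_nonneg[OF f]
  have n: "\<Lambda> * norm (\<psi> t x - \<psi> t y) \<le> exp (L * t) * \<Lambda> * norm (x - y)"
    using mult_left_mono[OF psi_lipschitz[OF t, of x y] l0] by (simp add: mult_ac)
  have "T f x \<le> T f y + \<Lambda> * norm (\<psi> t x - \<psi> t y)"
    using lip[OF _ f, of _ x y] ge[OF _ fb, of _ y] by (intro le fb) (smt (verit))
  then show "T f x - T f y \<le> exp (L * t) * \<Lambda> * norm (x - y)" using n by simp
  show "R t f x \<le> T f x" by (rule low[OF f])
  have "1 * \<Lambda> \<le> exp (L * t) * \<Lambda>" using exp_L_ge_1[OF t] l0 by (intro mult_right_mono)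
  then have "t * \<Phi> \<Lambda> \<le> t * \<Phi> (exp (L * t) * \<Lambda>)" using t l0 by (intro mult_left_mono conjugate_mono) auto
  moreover have "T f x \<le> R t f x + t * \<Phi> \<Lambda>" by (intro le fb up f)
  ultimately show "T f x \<le> R t f x + t * \<Phi> (exp (L * t) * \<Lambda>)" by linarith
qed

section \<open>The one-step operators\<close>

text \<open>The control \<open>b = 0\<close> costs nothing and keeps the supremum finite; controls
  outside \<open>dom\<close> contribute minus infinity and drop out.\<close>

lemma J_bounds:
  assumes t: "0 < t" and f: "f \<in> bcontfun"
  shows J_ge: "\<And>b x. norm b \<in> dom \<Longrightarrow> R t (\<lambda>z. f (z + t *\<^sub>R b)) x - t * cost (norm b) \<le> J t f x"
    and J_le: "\<And>x a. (\<And>b. norm b \<in> dom \<Longrightarrow> R t (\<lambda>z. f (z + t *\<^sub>R b)) x - t * cost (norm b) \<le> a) \<Longrightarrow> J t f x \<le> a"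
proof -
  note t0 = less_imp_le[OF t]
  define A where "A x b = ereal (R t (\<lambda>z. f (z + t *\<^sub>R b)) x) - perspective \<phi> t (norm b * t)" for x b
  have J: "J t f x = real_of_ereal (SUP b\<in>UNIV. A x b)" for x
    unfolding J_op_def A_def R_op_def ..
  obtain r where r: "\<And>x. \<bar>f x\<bar> \<le> r" using bcontfun_bound[OF f] by blast
  have Rr: "\<bar>R t (\<lambda>z. f (z + t *\<^sub>R b)) x\<bar> \<le> r" for b x
    by (rule R_abs_le[OF t0 bcontfun_shift[OF f]]) (rule r)
  have Ad: "A x b = ereal (R t (\<lambda>z. f (z + t *\<^sub>R b)) x - t * cost (norm b))" if "norm b \<in> dom" for x b
    using perspective_cost[OF t, of "norm b * t"] t that by (simp add: A_def)
  have An: "A x b = - \<infinity>" if "norm b \<notin> dom" for x b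
    using perspective_infinite[OF t, of "norm b * t"] t that by (simp add: A_def)
  have ub: "A x b \<le> ereal r" for x b
  proof (cases "norm b \<in> dom")
    case True
    have "0 \<le> t * cost (norm b)" using t0 cost_nonneg[OF True] by simp
    then show ?thesis using Ad[OF True] Rr[of b x] by (simp add: abs_le_iff)
  qed (simp add: An)
  have lb: "ereal (- r) \<le> A x 0" for x
    using Ad[of 0 x] zero_dom Rr[of 0 x] by (simp add: cost_0 abs_le_iff)
  note S = real_of_SUP_bounds[where X=UNIV and A="A x" for x, OF UNIV_I lb ub]
  show "R t (\<lambda>z. f (z + t *\<^sub>R b)) x - t * cost (norm b) \<le> J t f x" if "norm b \<in> dom" for b x
    unfolding J by (rule S(1)[where i=b, OF UNIV_I]) (simp add: Ad[OF that])
  show "J t f x \<le> a" if *: "\<And>b. norm b \<in> dom \<Longrightarrow> R t (\<lambda>z. f (z + t *\<^sub>R b)) x - t * cost (norm b) \<le> a" for x a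
    unfolding J
  proof (rule S(2))
    show "A x b \<le> ereal a" for b using Ad[of b x] An[of b x] *[of b] by (cases "norm b \<in> dom") auto
  qed
qed

lemma R_shift_bound:
  assumes t: "0 \<le> t" and f: "blip \<Lambda> f"
  shows "\<bar>R t (\<lambda>z. f (z + c)) x - R t f x\<bar> \<le> \<Lambda> * norm c"
proof -
  note fb = blip_bcontfun[OF f]
  have "R t (\<lambda>z. f (z + c)) x \<le> R t (\<lambda>z. f z + \<Lambda> * norm c) x"
    using blip_add_diff(1)[OF f, of _ c] by (intro R_mono t bcontfun_shift bcontfun_add_const fb) (simp add: algebra_simps)
  moreover have "R t (\<lambda>z. f z + - (\<Lambda> * norm c)) x \<le> R t (\<lambda>z. f (z + c)) x"
  proof (intro R_mono t bcontfun_shift bcontfun_add_const fb)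
    show "f z + - (\<Lambda> * norm c) \<le> f (z + c)" for z
      using blip_add_diff(2)[OF f, of z c] by linarith
  qed
  ultimately show ?thesis unfolding R_add_const[OF t fb] by linarith
qed

lemma R_le_J:
  assumes "0 < t" "f \<in> bcontfun"
  shows "R t f x \<le> J t f x"
  using J_ge[OF assms, of 0 x] by (simp add: zero_dom cost_0)

lemma adm_J:
  assumes t: "0 < t"
  shows "adm t (J t)"
proof (rule adm_of_sup[where X="{b. norm b \<in> dom}" and A="\<lambda>b f. R t (\<lambda>z. f (z + t *\<^sub>R b))" and P="\<lambda>b. t * cost (norm b)"])
  note t0 = less_imp_le[OF t]
  show "0 \<le> t" by fact
  show "R t (\<lambda>z. f (z + t *\<^sub>R i)) x - t * cost (norm i) \<le> R t f x + t * \<Phi> \<Lambda>"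
    if i: "i \<in> {b. norm b \<in> dom}" and f: "blip \<Lambda> f" for i f \<Lambda> x
  proof -
    have "t * (norm i * \<Lambda> - cost (norm i)) \<le> t * \<Phi> \<Lambda>"
      using i t0 blip_nonneg[OF f] by (intro mult_left_mono conjugate_ge) auto
    moreover have "R t (\<lambda>z. f (z + t *\<^sub>R i)) x \<le> R t f x + \<Lambda> * (t * norm i)"
      using R_shift_bound[OF t0 f, of "t *\<^sub>R i" x] t by simp
    ultimately show ?thesis by (simp add: algebra_simps)
  qed
  show "R t (\<lambda>z. f (z + t *\<^sub>R i)) x - R t (\<lambda>z. f (z + t *\<^sub>R i)) y \<le> \<Lambda> * norm (\<psi> t x - \<psi> t y)"
    if "blip \<Lambda> f" for i f \<Lambda> x y by (rule R_diff_le[OF t0 blip_shift[OF that]])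
  show "R t (\<lambda>z. f (z + t *\<^sub>R i)) x - t * cost (norm i) \<le> J t f x"
    if "i \<in> {b. norm b \<in> dom}" "f \<in> bcontfun" for i f x using J_ge[OF t that(2)] that(1) by simp
  show "J t f x \<le> a" if "f \<in> bcontfun"
    "\<And>i. i \<in> {b. norm b \<in> dom} \<Longrightarrow> R t (\<lambda>z. f (z + t *\<^sub>R i)) x - t * cost (norm i) \<le> a" for f x a
    using J_le[OF t that(1)] that(2) by simp
  show "R t f x \<le> J t f x" if "blip \<Lambda> f" for \<Lambda> f x using R_le_J[OF t blip_bcontfun[OF that]] .
qed (use t in \<open>auto intro!: R_mono bcontfun_shift R_add R_const simp: R_cmult\<close>)

section \<open>Refining the time grid\<close>

text \<open>Shifting before or after the flow differs by
  \<open>\<psi> s (x + c) - \<psi> s x - c\<close>, of size at most \<open>L s |c|\<close>; the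
  noise is the same in both cases and cancels.\<close>

lemma R_commutator:
  assumes s: "0 \<le> s" "s \<le> 1" and f: "blip \<Lambda> f"
  shows "\<bar>R s (\<lambda>z. f (z + c)) x - R s f (x + c)\<bar> \<le> \<Lambda> * L * s * norm c"
proof -
  interpret prob_space "\<mu> s" by (rule prob[OF s(1)])
  note i = integrable_R[OF s(1) blip_bcontfun[OF f]]
  note i' = integrable_R[OF s(1) bcontfun_shift[OF blip_bcontfun[OF f]]]
  have "R s (\<lambda>z. f (z + c)) x - R s f (x + c) = (\<integral>y. f (\<psi> s x + y + c) - f (\<psi> s (x + c) + y) \<partial>\<mu> s)"
    unfolding R_op_def using i i' by simp
  also have "norm \<dots> \<le> (\<integral>y. norm (f (\<psi> s x + y + c) - f (\<psi> s (x + c) + y)) \<partial>\<mu> s)"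
    by (rule integral_norm_bound)
  also have "\<dots> \<le> \<Lambda> * L * s * norm c"
  proof (rule integral_le_const)
    show "AE y in \<mu> s. norm (f (\<psi> s x + y + c) - f (\<psi> s (x + c) + y)) \<le> \<Lambda> * L * s * norm c"
    proof (rule AE_I2)
      fix y
      have "norm ((\<psi> s x + y + c) - (\<psi> s (x + c) + y)) = norm (\<psi> s (x + c) - \<psi> s x - (x + c - x))"
        by (simp add: norm_minus_commute algebra_simps)
      also have "\<dots> \<le> L * s * norm c" using psi_near_id[OF s, of "x + c" x] by simp
      finally have "\<Lambda> * norm ((\<psi> s x + y + c) - (\<psi> s (x + c) + y)) \<le> \<Lambda> * (L * s * norm c)"
        using blip_nonneg[OF f] by (rule mult_left_mono)
      then show "norm (f (\<psi> s x + y + c) - f (\<psi> s (x + c) + y)) \<le> \<Lambda> * L * s * norm c"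
        using blip_abs_diff[OF f, of "\<psi> s x + y + c" "\<psi> s (x + c) + y"] by (simp add: mult.assoc)
    qed
  qed (use i i' in auto)
  finally show ?thesis by simp
qed

lemma J_power_bcontfun: "0 < h \<Longrightarrow> f \<in> bcontfun \<Longrightarrow> (J h ^^ k) f \<in> bcontfun"
  by (rule adm_bcontfun[OF adm_power[OF adm_J]])

text \<open>The control \<open>b\<close> is kept constant during all \<open>j\<close> steps.\<close>

lemma J_iterate_ge:
  assumes h: "0 < h" and f: "blip \<Lambda> f" and b: "norm b \<in> dom" and j: "real j * h \<le> 1"
  shows "R (real j * h) (\<lambda>z. f (z + (real j * h) *\<^sub>R b)) x - real j * h * cost (norm b)
    - \<Lambda> * L * norm b * (real j * h)\<^sup>2 \<le> (J h ^^ j) f x"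
  using j
proof (induction j arbitrary: x)
  case 0
  then show ?case using R_0[OF blip_bcontfun[OF f]] by simp
next
  case (Suc j)
  define s where "s = real j * h"
  have s: "0 \<le> s" "s + h \<le> 1" "s \<le> 1" using h Suc.prems by (auto simp: s_def algebra_simps)
  have sj: "real (Suc j) * h = h + s" by (simp add: s_def distrib_right)
  note h0 = less_imp_le[OF h]
  note fb = blip_bcontfun[OF f]
  note l0 = blip_nonneg[OF f]
  define u where "u z = f (z + s *\<^sub>R b)" for z
  define v where "v z = f (z + (h + s) *\<^sub>R b)" for z
  have u: "blip \<Lambda> u" unfolding u_def by (rule blip_shift[OF f])
  have v: "v \<in> bcontfun" unfolding v_def by (rule bcontfun_shift[OF fb])
  have uv: "(\<lambda>z. u (z + h *\<^sub>R b)) = v" by (simp add: u_def v_def fun_eq_iff scaleR_left_distrib add.assoc)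
  define g where "g = (J h ^^ j) f"
  have gb: "g \<in> bcontfun" unfolding g_def by (rule J_power_bcontfun[OF h fb])
  \<comment> \<open>The last summand is the price of pulling the shift of the current step through
    \<open>R s\<close>.\<close>
  define K where "K = s * cost (norm b) + \<Lambda> * L * norm b * s\<^sup>2 + \<Lambda> * L * s * (h * norm b)"
  have gz: "R s v z - K \<le> g (z + h *\<^sub>R b)" for z
  proof -
    have "R s u (z + h *\<^sub>R b) - s * cost (norm b) - \<Lambda> * L * norm b * s\<^sup>2 \<le> g (z + h *\<^sub>R b)"
      using Suc.IH[of "z + h *\<^sub>R b", folded s_def, OF s(3)] unfolding u_def[abs_def] g_def .
    moreover have "R s v z - R s u (z + h *\<^sub>R b) \<le> \<Lambda> * L * s * (h * norm b)"
      using R_commutator[OF s(1,3) u, of "h *\<^sub>R b" z] h by (simp add: uv)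
    ultimately show ?thesis unfolding K_def by linarith
  qed
  have "R (h + s) v x + (- K) = R h (\<lambda>z. R s v z + (- K)) x"
    using R_add_const[OF h0 R_bcontfun[OF s(1) v], of "-K" x] R_add_time[OF h0 s(1) v] by simp
  also have "\<dots> \<le> R h (\<lambda>z. g (z + h *\<^sub>R b)) x"
    using gz by (intro R_mono h0 bcontfun_add_const bcontfun_shift R_bcontfun s v gb) auto
  also have "\<dots> \<le> J h g x + h * cost (norm b)" using J_ge[OF h gb b, of x] by simp
  finally have "R (h + s) v x - K - h * cost (norm b) \<le> (J h ^^ Suc j) f x" by (simp add: g_def)
  \<comment> \<open>The contributions \<open>s * h\<close> of the single steps sum to less than the
    square of the elapsed time, whence the exponent 2.\<close>
  moreover have "K + h * cost (norm b) \<le> (h + s) * cost (norm b) + \<Lambda> * L * norm b * (h + s)\<^sup>2"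
  proof -
    have "s\<^sup>2 + s * h \<le> (h + s)\<^sup>2" using s h0 by (simp add: power2_eq_square algebra_simps)
    then have "\<Lambda> * L * norm b * (s\<^sup>2 + s * h) \<le> \<Lambda> * L * norm b * (h + s)\<^sup>2"
      using l0 L_nonneg by (intro mult_left_mono) auto
    then show ?thesis by (simp add: K_def algebra_simps)
  qed
  ultimately show ?case unfolding sj v_def by linarith
qed

text \<open>Controls up to \<open>vmax \<Lambda>\<close> are repeated in every small step; faster
  ones lose to no control at all, since \<open>R\<close> already lies below the iterate.\<close>

lemma J_refine:
  assumes h: "0 < h" and f: "blip \<Lambda> f" and k: "1 \<le> k" "real k * h \<le> 1"
  shows "J (real k * h) f x \<le> (J h ^^ k) f x + \<Lambda> * L * vmax \<Lambda> * (real k * h)\<^sup>2"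
proof -
  define H where "H = real k * h"
  have H: "0 < H" using h k by (simp add: H_def)
  note H0 = less_imp_le[OF H]
  note fb = blip_bcontfun[OF f]
  note l0 = blip_nonneg[OF f]
  note a = adm_power[OF adm_J[OF h], of k, folded H_def]
  have v: "0 \<le> \<Lambda> * L * vmax \<Lambda> * H\<^sup>2" using l0 L_nonneg vmax(1)[OF l0] by simp
  have "J H f x \<le> (J h ^^ k) f x + \<Lambda> * L * vmax \<Lambda> * H\<^sup>2"
  proof (rule J_le[OF H fb])
    fix b :: 'a assume b: "norm b \<in> dom"
    show "R H (\<lambda>z. f (z + H *\<^sub>R b)) x - H * cost (norm b) \<le> (J h ^^ k) f x + \<Lambda> * L * vmax \<Lambda> * H\<^sup>2"
    proof (cases "norm b \<le> vmax \<Lambda>")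
      case True
      then have "\<Lambda> * L * norm b * H\<^sup>2 \<le> \<Lambda> * L * vmax \<Lambda> * H\<^sup>2"
        using l0 L_nonneg by (intro mult_right_mono mult_left_mono) auto
      then show ?thesis using J_iterate_ge[OF h f b k(2), of x] unfolding H_def by linarith
    next
      case False
      then have "\<Lambda> * norm b \<le> cost (norm b)" using vmax(2)[OF l0 b] by simp
      then have "H * (\<Lambda> * norm b) \<le> H * cost (norm b)" using H0 by (rule mult_left_mono)
      moreover have "R H (\<lambda>z. f (z + H *\<^sub>R b)) x \<le> R H f x + H * (\<Lambda> * norm b)"
        using R_shift_bound[OF H0 f, of "H *\<^sub>R b" x] H by (simp add: algebra_simps)
      ultimately show ?thesis using adm_ge_R[OF a f, of x] v by linarith
    qed
  qed
  then show ?thesis by (simp add: H_def)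
qed

lemma adm_blip_upto:
  assumes "adm t T" "t \<le> T0" "blip \<Lambda> f"
  shows "blip (exp (L * T0) * \<Lambda>) (T f)"
  by (rule blip_mono[OF adm_blip[OF assms(1,3)]])
    (use assms L_nonneg blip_nonneg[OF assms(3)] in \<open>auto intro!: mult_right_mono mult_left_mono\<close>)

text \<open>Each of the \<open>j\<close> coarse steps loses order \<open>H^2\<close>; as
  \<open>real j * H \<le> T0\<close>, the total is of order \<open>H\<close>. The constant uses the
  Lipschitz bound valid up to time \<open>T0\<close>.\<close>

lemma J_refine_iterate:
  assumes h: "0 < h" and f: "blip \<Lambda> f" and k: "1 \<le> k" and H: "H = real k * h" "H \<le> 1" and j: "real j * H \<le> T0"
  shows "(J H ^^ j) f x \<le> (J h ^^ (k * j)) f x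
    + real j * ((exp (L * T0) * \<Lambda>) * L * vmax (exp (L * T0) * \<Lambda>) * H\<^sup>2)"
  using j
proof (induction j arbitrary: x)
  case 0
  then show ?case by simp
next
  case (Suc j)
  define C where "C = (exp (L * T0) * \<Lambda>) * L * vmax (exp (L * T0) * \<Lambda>) * H\<^sup>2"
  have Hp: "0 < H" using h k H by simp
  note fb = blip_bcontfun[OF f]
  define g where "g = (J h ^^ (k * j)) f"
  have gb: "g \<in> bcontfun" unfolding g_def by (rule J_power_bcontfun[OF h fb])
  have jT: "real j * H \<le> T0" using Suc.prems Hp by (simp add: distrib_right)
  then have "real (k * j) * h \<le> T0" by (simp add: H mult_ac)
  then have g: "blip (exp (L * T0) * \<Lambda>) g"
    unfolding g_def using adm_power[OF adm_J[OF h]] f by (intro adm_blip_upto)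
  have "(J H ^^ Suc j) f x \<le> J H (\<lambda>y. g y + real j * C) x"
    using adm_mono[OF adm_J[OF Hp] J_power_bcontfun[OF Hp fb] bcontfun_add_const[OF gb], of j "real j * C" x]
      Suc.IH[OF jT] by (simp add: g_def C_def)
  also have "\<dots> = J H g x + real j * C" by (rule adm_add_const[OF adm_J[OF Hp] gb])
  also have "\<dots> \<le> (J h ^^ k) g x + C + real j * C"
    using J_refine[OF h g k, of x] H unfolding C_def by simp
  also have "(J h ^^ k) g = (J h ^^ (k * Suc j)) f" by (simp add: g_def funpow_add)
  finally show ?case unfolding C_def by (simp add: algebra_simps)
qed

text \<open>Approach from the left allows \<open>R t f = R (t - s n) (R (s n) f)\<close>: a
  short-time operator applied to functions with a common Lipschitz constant. Grid points below
  \<open>t\<close> approach it in this way.\<close>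

lemma R_tendsto:
  assumes f: "blip \<Lambda> f" and s: "\<And>n. 0 \<le> s n" "\<And>n. s n \<le> t" "s \<longlonglongrightarrow> t"
  shows "(\<lambda>n. R (s n) f x) \<longlonglongrightarrow> R t f x"
proof (rule LIMSEQ_I)
  fix e :: real assume e: "0 < e"
  have l: "0 \<le> exp (L * t) * \<Lambda>" using blip_nonneg[OF f] by simp
  obtain d where d: "0 < d" "\<forall>\<tau> T f y. adm \<tau> T \<longrightarrow> \<tau> \<le> d \<longrightarrow> blip (exp (L * t) * \<Lambda>) f \<longrightarrow> norm y \<le> norm x \<longrightarrow> \<bar>T f y - f y\<bar> \<le> e / 2"
    using adm_near_id[OF l half_gt_zero[OF e]] .
  obtain N where N: "\<forall>n\<ge>N. norm (s n - t) < d" using LIMSEQ_D[OF s(3) d(1)] by blast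
  show "\<exists>N. \<forall>n\<ge>N. norm (R (s n) f x - R t f x) < e"
  proof (intro exI[of _ N] allI impI)
    fix n assume n: "N \<le> n"
    have t': "0 \<le> t - s n" "t - s n \<le> d" using s(2)[of n] N n by (auto simp: abs_le_iff dest!: spec[of _ n])
    have "R t f = R (t - s n) (R (s n) f)"
      using R_add_time[OF t'(1) s(1)[of n] blip_bcontfun[OF f]] by simp
    moreover have "blip (exp (L * t) * \<Lambda>) (R (s n) f)" by (rule adm_blip_upto[OF adm_R[OF s(1)] s(2) f])
    ultimately have "\<bar>R t f x - R (s n) f x\<bar> \<le> e / 2"
      using d(2)[rule_format, OF adm_R[OF t'(1)] t'(2), of "R (s n) f" x] by simp
    then show "norm (R (s n) f x - R t f x) < e" using e by (simp add: abs_minus_commute)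
  qed
qed

section \<open>Mixed limits and admissible operators\<close>

text \<open>Equicontinuity lets argument and operator vary together: replacing \<open>F n\<close> by
  \<open>f\<close> inside \<open>T n\<close> is controlled by one modulus for all
  \<open>n\<close>.\<close>

lemma mixed_lim_compose_adm:
  assumes F: "mixed_lim F f" and T: "\<And>n. adm (\<tau> n) (T n)" "\<And>n. \<tau> n \<le> T0"
    and g: "mixed_lim (\<lambda>n. T n f) g"
  shows "mixed_lim (\<lambda>n. T n (F n)) g"
proof -
  note Fb = mixed_lim_bcontfun[OF F]
  obtain r where r: "r \<ge> 0" "\<And>n x. \<bar>F n x\<bar> \<le> r" "\<And>x. \<bar>f x\<bar> \<le> r" using mixed_lim_bound[OF F] by blast
  have T0: "0 \<le> T0" using adm_time[OF T(1)] T(2) by (meson order_trans)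
  show ?thesis
  proof (rule mixed_limI)
    show "T n (F n) \<in> bcontfun" for n by (rule adm_bcontfun[OF T(1) Fb(2)])
    show "g \<in> bcontfun" by (rule mixed_lim_bcontfun(1)[OF g])
    show "\<bar>T n (F n) x\<bar> \<le> r" for n x by (rule adm_abs_le[OF T(1) Fb(2) r(2)])
    fix M0 e :: real assume e: "0 < e"
    obtain M \<delta> where M: "equi_modulus T0 r M0 (e / 2) M \<delta>"
      using adm_equicontinuous[OF T0 half_gt_zero[OF e] r(1)] .
    show "\<forall>\<^sub>F n in sequentially. \<forall>x\<in>cball 0 M0. \<bar>T n (F n) x - g x\<bar> \<le> e"
      using mixed_limD[OF F equi_modulusD(1)[OF M], of M] mixed_limD[OF g half_gt_zero[OF e], of M0]
    proof eventually_elim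
      case (elim n)
      show ?case
      proof
        fix x :: 'a assume x: "x \<in> cball 0 M0"
        have "\<bar>T n (F n) x - T n f x\<bar> \<le> e / 2"
          by (rule equi_modulusD(2)[OF M T(1) T(2) Fb(2,1) r(2,3)]) (use elim(1) x in auto)
        then show "\<bar>T n (F n) x - g x\<bar> \<le> e" using elim(2)[rule_format, OF x] by linarith
      qed
    qed
  qed
qed

lemma mixed_lim_near_id:
  assumes T: "\<And>n. adm (\<tau> n) (T n)" "\<And>n. \<tau> n \<le> T0" and \<tau>: "\<tau> \<longlonglongrightarrow> 0" and f: "f \<in> bcontfun"
  shows "mixed_lim (\<lambda>n. T n f) f"
proof -
  obtain r where r: "r \<ge> 0" "\<And>x. \<bar>f x\<bar> \<le> r" using bcontfun_bound[OF f] by blast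
  have T0: "0 \<le> T0" using adm_time[OF T(1)] T(2) by (meson order_trans)
  show ?thesis
  proof (rule mixed_limI)
    show "T n f \<in> bcontfun" for n by (rule adm_bcontfun[OF T(1) f])
    show "f \<in> bcontfun" by fact
    show "\<bar>T n f x\<bar> \<le> r" for n x by (rule adm_abs_le[OF T(1) f r(2)])
    fix M0 e :: real assume e: "0 < e"
    then have e3: "0 < e / 3" by simp
    obtain M \<delta> where M: "equi_modulus T0 r M0 (e / 3) M \<delta>"
      using adm_equicontinuous[OF T0 e3 r(1)] .
    define \<delta>' where "\<delta>' = min \<delta> (e / 3)"
    have \<delta>': "0 < \<delta>'" using equi_modulusD(1)[OF M] e by (simp add: \<delta>'_def)
    obtain g \<Lambda> where g: "blip \<Lambda> g" "\<forall>x. \<bar>g x\<bar> \<le> r" "\<forall>x. norm x \<le> max M M0 \<longrightarrow> \<bar>f x - g x\<bar> \<le> \<delta>'"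
      using lipschitz_approx[OF f r(2) \<delta>'] .
    obtain d where d: "0 < d" "\<forall>t T f x. adm t T \<longrightarrow> t \<le> d \<longrightarrow> blip \<Lambda> f \<longrightarrow> norm x \<le> M0 \<longrightarrow> \<bar>T f x - f x\<bar> \<le> e / 3"
      using adm_near_id[OF blip_nonneg[OF g(1)] e3] .
    have "\<forall>\<^sub>F n in sequentially. \<tau> n < d" using order_tendstoD(2)[OF \<tau> d(1)] .
    then show "\<forall>\<^sub>F n in sequentially. \<forall>x\<in>cball 0 M0. \<bar>T n f x - f x\<bar> \<le> e"
    proof eventually_elim
      case (elim n)
      show ?case
      proof
        fix x :: 'a assume "x \<in> cball 0 M0"
        then have x: "norm x \<le> M0" by simp
        have "\<bar>T n f x - T n g x\<bar> \<le> e / 3"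
          by (rule equi_modulusD(2)[OF M T(1) T(2) f blip_bcontfun[OF g(1)] r(2) _ _ x])
            (use g in \<open>auto simp: \<delta>'_def\<close>)
        moreover have "\<bar>T n g x - g x\<bar> \<le> e / 3" using d(2) T(1)[of n] elim g(1) x by (meson less_imp_le)
        moreover have "\<bar>f x - g x\<bar> \<le> e / 3" using g(3) x by (auto simp: \<delta>'_def)
        ultimately show "\<bar>T n f x - f x\<bar> \<le> e" by linarith
      qed
    qed
  qed
qed

end

text \<open>Boundedness gives a cluster point. Beyond a late member of the subsequence the sequence
  cannot fall by much, nor rise by much, because a still later member returns to the same
  point.\<close>

lemma almost_incseq_convergent:
  fixes b :: "nat \<Rightarrow> real"
  assumes bdd: "\<And>n. \<bar>b n\<bar> \<le> r"
    and mono: "\<And>e. 0 < e \<Longrightarrow> \<exists>N. \<forall>n\<ge>N. \<forall>k\<ge>n. b n \<le> b k + e"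
  shows "convergent b"
proof -
  have "bounded (range b)" using bdd by (auto simp: bounded_iff)
  then obtain l \<rho> where \<rho>: "strict_mono \<rho>" "(b \<circ> \<rho>) \<longlonglongrightarrow> l"
    using bounded_imp_convergent_subsequence by blast
  have "b \<longlonglongrightarrow> l"
  proof (rule LIMSEQ_I)
    fix e :: real assume e: "0 < e"
    then obtain N where N: "\<And>n k. n \<ge> N \<Longrightarrow> k \<ge> n \<Longrightarrow> b n \<le> b k + e / 3"
      using mono[of "e / 3"] by auto
    obtain K where K: "\<And>k. k \<ge> K \<Longrightarrow> \<bar>b (\<rho> k) - l\<bar> < e / 3"
      using LIMSEQ_D[OF \<rho>(2), of "e / 3"] e by auto
    define k0 where "k0 = max K N"
    have k0: "\<rho> k0 \<ge> N" "\<bar>b (\<rho> k0) - l\<bar> < e / 3"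
      using seq_suble[OF \<rho>(1), of k0] K[of k0] by (auto simp: k0_def)
    show "\<exists>N. \<forall>n\<ge>N. norm (b n - l) < e"
    proof (intro exI[of _ "\<rho> k0"] allI impI)
      fix n assume n: "\<rho> k0 \<le> n"
      have "\<rho> (max n K) \<ge> n" using seq_suble[OF \<rho>(1), of "max n K"] by linarith
      then have "b n \<le> b (\<rho> (max n K)) + e / 3" using N n k0(1) by simp
      moreover have "\<bar>b (\<rho> (max n K)) - l\<bar> < e / 3" by (rule K) simp
      moreover have "b (\<rho> k0) \<le> b n + e / 3" using N k0(1) n by simp
      ultimately show "norm (b n - l) < e" using k0(2) unfolding real_norm_def by linarith
    qed
  qed
  then show ?thesis by (rule convergentI)
qed

text \<open>By compactness finitely many of the sets where \<open>F n\<close> is below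
  \<open>e\<close> cover the ball, and these sets increase with \<open>n\<close>.\<close>

lemma Dini_zero:
  fixes F :: "nat \<Rightarrow> 'a::euclidean_space \<Rightarrow> real"
  assumes F: "\<And>n. continuous_on UNIV (F n)" and dec: "decseq F" and lim: "\<And>x. (\<lambda>n. F n x) \<longlonglongrightarrow> 0" and e: "0 < e"
  shows "\<forall>\<^sub>F n in sequentially. \<forall>x\<in>cball 0 M. \<bar>F n x\<bar> \<le> e"
proof -
  have dec': "F n x \<le> F k x" if "k \<le> n" for n k x using decseqD[OF dec that] by (simp add: le_fun_def)
  have nn: "0 \<le> F n x" for n x
    by (rule LIMSEQ_le_const2[OF lim[of x]]) (use dec' in \<open>auto intro!: exI[of _ n]\<close>)
  have op: "open {x. F n x < e}" for n
    using F by (intro open_Collect_less) (auto intro: continuous_on_const)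
  have sub: "cball 0 M \<subseteq> (\<Union>n\<in>UNIV. {x. F n x < e})"
  proof
    fix x :: 'a
    have "\<forall>\<^sub>F n in sequentially. F n x < e" using order_tendstoD(2)[OF lim e] .
    then show "x \<in> (\<Union>n\<in>UNIV. {x. F n x < e})" by (auto simp: eventually_sequentially)
  qed
  obtain A where A: "finite A" "cball 0 M \<subseteq> (\<Union>n\<in>A. {x. F n x < e})"
    by (rule compactE_image[OF compact_cball op sub])
  then obtain N where N: "\<forall>n\<in>A. n \<le> N" using finite_nat_set_iff_bounded_le by blast
  show ?thesis
  proof (rule eventually_sequentiallyI[of N], intro ballI)
    fix n x assume n: "N \<le> n" and x: "x \<in> cball (0::'a) M"
    then obtain k where "k \<in> A" "F k x < e" using A(2) by blast
    then have "F n x < e" using dec'[of k n x] N n by fastforce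
    then show "\<bar>F n x\<bar> \<le> e" using nn[of n x] by simp
  qed
qed

section \<open>The limit semigroup\<close>

locale wasserstein_scheme = wasserstein_perturbation p \<phi> \<mu> \<psi> L
  for p :: real and \<phi> :: "real \<Rightarrow> ereal" and \<mu> :: "real \<Rightarrow> 'a::euclidean_space measure"
    and \<psi> :: "real \<Rightarrow> 'a \<Rightarrow> 'a" and L :: real +
  fixes h :: "nat \<Rightarrow> real"
  assumes h_pos: "\<And>n. 0 < h n" and h_lim: "h \<longlonglongrightarrow> 0"
    and h_nested: "\<And>n. range (\<lambda>k. real k * h n) \<subseteq> range (\<lambda>k. real k * h (Suc n))"
begin

definition Jn where "Jn n t = J (h n) ^^ step_count (h n) t"

text \<open>\<open>lim\<close> is meaningful only for convergent sequences; \<open>S_tendsto\<close>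
  supplies the convergence on \<open>bcontfun\<close> at times at least 0.\<close>

definition S where "S t f x = lim (\<lambda>n. Jn n t f x)"

definition grid where "grid n t = real (step_count (h n) t) * h n"

lemma grid_le: "0 \<le> t \<Longrightarrow> grid n t \<le> t"
  and grid_gt: "0 \<le> t \<Longrightarrow> t < grid n t + h n"
  and grid_nonneg: "0 \<le> grid n t"
  using step_count_properties[OF h_pos] h_pos[of n] by (auto simp: grid_def)

lemma grid_tendsto:
  assumes "0 \<le> t"
  shows "(\<lambda>n. grid n t) \<longlonglongrightarrow> t"
proof (rule tendsto_sandwich[OF _ _ _ tendsto_const])
  show "(\<lambda>n. t - h n) \<longlonglongrightarrow> t" using tendsto_diff[OF tendsto_const h_lim, of t] by simp
  show "\<forall>\<^sub>F n in sequentially. t - h n \<le> grid n t"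
    using grid_gt[OF assms] by (intro always_eventually allI) (smt (verit))
qed (use grid_le[OF assms] in simp)

lemma adm_J_steps: "adm (real k * h n) (J (h n) ^^ k)"
  by (rule adm_power[OF adm_J[OF h_pos]])

lemma adm_Jn: "adm (grid n t) (Jn n t)"
  unfolding grid_def Jn_def by (rule adm_J_steps)

text \<open>The inclusion of two consecutive grids, read at the point \<open>h n\<close> itself,
  gives an integer ratio; ratios multiply.\<close>

lemma h_multiple:
  assumes "N \<le> n"
  shows "\<exists>k\<ge>1. h N = real k * h n"
  using assms
proof (induction n rule: dec_induct)
  case base
  show ?case by (intro exI[of _ 1]) simp
next
  case (step n)
  then obtain k where k: "1 \<le> k" "h N = real k * h n" by blast
  have "1 * h n \<in> range (\<lambda>k. real k * h n)" by (rule image_eqI[of _ _ 1]) auto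
  then obtain j where j: "h n = real j * h (Suc n)" using h_nested[of n] by auto
  then have "j \<noteq> 0" using h_pos[of n] by (intro notI) simp
  then show ?case using k j by (intro exI[of _ "k * j"]) (auto simp: Suc_leI)
qed

lemma h_eventually_less:
  assumes "0 < e"
  obtains N where "\<And>n. N \<le> n \<Longrightarrow> h n < e"
  using order_tendstoD(2)[OF h_lim assms] by (auto simp: eventually_sequentially)

text \<open>Grids of different fineness reach \<open>t\<close> only approximately, so all are
  compared at one point \<open>s\<close> of a coarse grid, which belongs to every later one. Passing
  between \<open>t\<close> and \<open>s\<close> costs \<open>e / 3\<close> for each of the two
  iterates by \<open>adm_near_id\<close>, and refinement at \<open>s\<close> another
  \<open>e / 3\<close>.\<close>

lemma Jn_convergent_lipschitz:
  assumes f: "blip \<Lambda> f" and t: "0 \<le> t"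
  shows "convergent (\<lambda>n. Jn n t f x)"
proof -
  note fb = blip_bcontfun[OF f]
  obtain r where r: "\<And>x. \<bar>f x\<bar> \<le> r" using bcontfun_bound[OF fb] by blast
  define \<Lambda>' where "\<Lambda>' = exp (L * t) * \<Lambda>"
  have l': "0 \<le> \<Lambda>'" using blip_nonneg[OF f] by (simp add: \<Lambda>'_def)
  define C where "C = \<Lambda>' * L * vmax \<Lambda>'"
  have C: "0 \<le> C" using l' L_nonneg vmax(1)[OF l'] by (simp add: C_def)
  show ?thesis
  proof (rule almost_incseq_convergent)
    show "\<bar>Jn n t f x\<bar> \<le> r" for n by (rule adm_abs_le[OF adm_Jn fb r])
    fix e :: real assume e: "0 < e"
    then have e3: "0 < e / 3" by simp
    obtain \<delta> where \<delta>: "0 < \<delta>" "\<forall>s T f y. adm s T \<longrightarrow> s \<le> \<delta> \<longrightarrow> blip \<Lambda>' f \<longrightarrow> norm y \<le> norm x \<longrightarrow> \<bar>T f y - f y\<bar> \<le> e / 3"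
      using adm_near_id[OF l' e3] .
    \<comment> \<open>Bounds the distance from \<open>s\<close> to \<open>t\<close>, admits
      \<open>J_refine_iterate\<close> and makes its total error at most
      \<open>e / 3\<close>.\<close>
    define \<eta> where "\<eta> = min \<delta> (min 1 (e / (3 * (C * t + 1))))"
    have Ct: "0 < C * t + 1" using C t by (simp add: add_nonneg_pos)
    have \<eta>: "0 < \<eta>" using \<delta> e Ct by (simp add: \<eta>_def)
    obtain N where N: "\<And>n. N \<le> n \<Longrightarrow> h n < \<eta>" using h_eventually_less[OF \<eta>] by blast
    define s where "s = grid N t"
    define k where "k = step_count (h N) t"
    have s: "s = real k * h N" "s \<le> t" "t < s + h N" "0 \<le> s"
      using grid_le[OF t, of N] grid_gt[OF t, of N] grid_nonneg[of N t] by (auto simp: s_def k_def grid_def)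
    have near: "\<exists>q. s = real q * h n \<and> \<bar>Jn n t f x - (J (h n) ^^ q) f x\<bar> \<le> e / 3" if n: "N \<le> n" for n
    proof -
      obtain i where i: "1 \<le> i" "h N = real i * h n" using h_multiple[OF n] by blast
      define q where "q = k * i"
      have q: "s = real q * h n" by (simp add: s(1) i(2) q_def)
      have "real q * h n < (real (step_count (h n) t) + 1) * h n"
        using grid_gt[OF t, of n] s(2) q by (simp add: grid_def distrib_right)
      then have "q \<le> step_count (h n) t" using h_pos[of n] by simp
      then obtain j where j: "step_count (h n) t = j + q" using le_Suc_ex by (metis add.commute)
      have "real j * h n = grid n t - s" by (simp add: grid_def j q algebra_simps)
      also have "\<dots> \<le> \<delta>" using grid_le[OF t, of n] s(3) N[of N] by (simp add: \<eta>_def)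
      finally have jd: "real j * h n \<le> \<delta>" .
      define g where "g = (J (h n) ^^ q) f"
      have g: "blip \<Lambda>' g"
        unfolding g_def \<Lambda>'_def using s(2) q by (intro adm_blip_upto[OF adm_J_steps _ f]) simp
      have "\<bar>(J (h n) ^^ j) g x - g x\<bar> \<le> e / 3"
        using \<delta>(2)[rule_format, OF adm_J_steps jd g] by simp
      then show ?thesis using q by (intro exI[of _ q]) (simp add: Jn_def j funpow_add g_def)
    qed
    show "\<exists>N. \<forall>n\<ge>N. \<forall>n'\<ge>n. Jn n t f x \<le> Jn n' t f x + e"
    proof (intro exI[of _ N] allI impI)
      fix n n' assume n: "N \<le> n" "n \<le> n'"
      obtain q where q: "s = real q * h n" "\<bar>Jn n t f x - (J (h n) ^^ q) f x\<bar> \<le> e / 3"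
        using near[OF n(1)] by blast
      obtain q' where q': "s = real q' * h n'" "\<bar>Jn n' t f x - (J (h n') ^^ q') f x\<bar> \<le> e / 3"
        using near[of n'] n by auto
      obtain i where i: "1 \<le> i" "h n = real i * h n'" using h_multiple[OF n(2)] by blast
      have "real q' * h n' = real (i * q) * h n'" using q(1) q'(1) i(2) by (simp add: mult_ac)
      then have qq: "q' = i * q" using h_pos[of n'] by (simp only: mult_cancel_right of_nat_eq_iff) auto
      have hn: "h n < \<eta>" by (rule N[OF n(1)])
      then have hn1: "h n \<le> 1" by (simp add: \<eta>_def)
      have "(J (h n) ^^ q) f x \<le> (J (h n') ^^ (i * q)) f x + real q * (C * (h n)\<^sup>2)"
        using J_refine_iterate[OF h_pos f i hn1, of q t x] s(2) q(1) by (simp add: C_def \<Lambda>'_def)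
      moreover have "real q * (C * (h n)\<^sup>2) \<le> e / 3"
      proof -
        have "real q * (C * (h n)\<^sup>2) = s * C * h n" by (simp add: q(1) power2_eq_square mult_ac)
        also have "\<dots> \<le> t * C * h n" using s(2) C h_pos[of n] by (intro mult_right_mono) auto
        also have "\<dots> \<le> (C * t + 1) * h n" using h_pos[of n] by (intro mult_right_mono) auto
        also have "\<dots> \<le> (C * t + 1) * (e / (3 * (C * t + 1)))"
          using hn Ct by (intro mult_left_mono) (auto simp: \<eta>_def)
        also have "\<dots> = e / 3" using Ct by (simp add: field_simps)
        finally show ?thesis .
      qed
      ultimately show "Jn n t f x \<le> Jn n' t f x + e" using q(2) q'(2) unfolding qq by linarith
    qed
  qed
qed

lemma S_tendsto:
  assumes f: "f \<in> bcontfun" and t: "0 \<le> t"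
  shows "(\<lambda>n. Jn n t f x) \<longlonglongrightarrow> S t f x"
proof -
  obtain r where r: "r \<ge> 0" "\<And>x. \<bar>f x\<bar> \<le> r" using bcontfun_bound[OF f] by blast
  have "Cauchy (\<lambda>n. Jn n t f x)"
  proof (rule metric_CauchyI)
    fix e :: real assume e: "0 < e"
    then have e4: "0 < e / 4" by simp
    obtain M \<delta> where M: "equi_modulus t r (norm x) (e / 4) M \<delta>" using adm_equicontinuous[OF t e4 r(1)] .
    obtain g \<Lambda> where g: "blip \<Lambda> g" "\<forall>x. \<bar>g x\<bar> \<le> r" "\<forall>x. norm x \<le> M \<longrightarrow> \<bar>f x - g x\<bar> \<le> \<delta>"
      using lipschitz_approx[OF f r(2) equi_modulusD(1)[OF M]] .
    have fg: "\<bar>Jn n t f x - Jn n t g x\<bar> \<le> e / 4" for n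
      by (rule equi_modulusD(2)[OF M adm_Jn grid_le[OF t] f blip_bcontfun[OF g(1)] r(2)]) (use g in auto)
    have "Cauchy (\<lambda>n. Jn n t g x)" using Jn_convergent_lipschitz[OF g(1) t] by (rule convergent_Cauchy)
    from metric_CauchyD[OF this e4] obtain N where
      N: "\<And>n m. N \<le> n \<Longrightarrow> N \<le> m \<Longrightarrow> \<bar>Jn n t g x - Jn m t g x\<bar> < e / 4"
      by (auto simp: dist_real_def)
    show "\<exists>N. \<forall>n\<ge>N. \<forall>m\<ge>N. dist (Jn n t f x) (Jn m t f x) < e"
    proof (intro exI[of _ N] allI impI)
      fix n m assume "N \<le> n" "N \<le> m"
      from N[OF this] show "dist (Jn n t f x) (Jn m t f x) < e"
        using fg[of n] fg[of m] unfolding dist_real_def by linarith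
    qed
  qed
  then have "convergent (\<lambda>n. Jn n t f x)" by (rule Cauchy_convergent)
  then show ?thesis unfolding S_def by (simp add: convergent_LIMSEQ_iff)
qed

text \<open>All conditions survive pointwise limits. The iterates live at time
  \<open>grid n t\<close>, so the bounds by \<open>R\<close> also use continuity of \<open>R\<close>
  at \<open>t\<close> from the left.\<close>

lemma adm_S:
  assumes t: "0 \<le> t"
  shows "adm t (S t)"
  unfolding adm_def
proof (intro conjI ballI allI impI t)
  fix f g :: "'a \<Rightarrow> real" and x assume f: "f \<in> bcontfun" and g: "g \<in> bcontfun"
  show "S t f x \<le> S t g x" if "\<forall>x. f x \<le> g x"
    by (rule LIMSEQ_le[OF S_tendsto[OF f t] S_tendsto[OF g t]])
      (use that in \<open>auto intro!: adm_mono[OF adm_Jn f g]\<close>)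
  fix l :: real assume l: "l \<in> {0..1}"
  have b: "(\<lambda>y. l * f y + (1 - l) * g y) \<in> bcontfun" using f g by (intro plus_cont bcontfun_mult_left)
  have "(\<lambda>n. l * Jn n t f x + (1 - l) * Jn n t g x) \<longlonglongrightarrow> l * S t f x + (1 - l) * S t g x"
    by (intro tendsto_intros S_tendsto f g t)
  then show "S t (\<lambda>y. l * f y + (1 - l) * g y) x \<le> l * S t f x + (1 - l) * S t g x"
    by (rule LIMSEQ_le[OF S_tendsto[OF b t]]) (use l in \<open>auto intro!: adm_convex[OF adm_Jn f g]\<close>)
next
  fix f :: "'a \<Rightarrow> real" and c x assume f: "f \<in> bcontfun"
  have "(\<lambda>n. Jn n t f x + c) \<longlonglongrightarrow> S t f x + c" by (intro tendsto_intros S_tendsto f t)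
  then have "(\<lambda>n. Jn n t (\<lambda>y. f y + c) x) \<longlonglongrightarrow> S t f x + c" by (simp add: adm_add_const[OF adm_Jn f])
  then show "S t (\<lambda>y. f y + c) x = S t f x + c"
    using S_tendsto[OF bcontfun_add_const[OF f] t] LIMSEQ_unique by blast
next
  fix \<Lambda> x y and f :: "'a \<Rightarrow> real" assume f: "blip \<Lambda> f"
  note l0 = blip_nonneg[OF f]
  note lim = S_tendsto[OF blip_bcontfun[OF f] t]
  note glim = R_tendsto[OF f grid_nonneg grid_le[OF t] grid_tendsto[OF t]]
  have "(\<lambda>n. Jn n t f x - Jn n t f y) \<longlonglongrightarrow> S t f x - S t f y" by (intro tendsto_diff lim)
  then show "S t f x - S t f y \<le> exp (L * t) * \<Lambda> * norm (x - y)"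
    by (rule LIMSEQ_le_const2) (use blip_diff[OF adm_blip_upto[OF adm_Jn grid_le[OF t] f]] in auto)
  show "R t f x \<le> S t f x"
    by (rule LIMSEQ_le[OF glim lim]) (auto intro!: adm_ge_R[OF adm_Jn f])
  have le: "Jn n t f x \<le> R (grid n t) f x + t * \<Phi> (exp (L * t) * \<Lambda>)" for n
  proof -
    have "exp (L * grid n t) * \<Lambda> \<le> exp (L * t) * \<Lambda>"
      using grid_le[OF t, of n] l0 L_nonneg by (auto intro!: mult_right_mono mult_left_mono)
    then have "\<Phi> (exp (L * grid n t) * \<Lambda>) \<le> \<Phi> (exp (L * t) * \<Lambda>)" using l0 by (intro conjugate_mono) auto
    moreover have "0 \<le> \<Phi> (exp (L * t) * \<Lambda>)" using l0 by (intro conjugate_nonneg) auto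
    ultimately have "grid n t * \<Phi> (exp (L * grid n t) * \<Lambda>) \<le> t * \<Phi> (exp (L * t) * \<Lambda>)"
      using grid_le[OF t, of n] grid_nonneg[of n t] t
      by (meson mult_left_mono mult_right_mono order_trans)
    then show ?thesis using adm_le_R[OF adm_Jn f, of n t x] by linarith
  qed
  have "(\<lambda>n. R (grid n t) f x + t * \<Phi> (exp (L * t) * \<Lambda>)) \<longlonglongrightarrow> R t f x + t * \<Phi> (exp (L * t) * \<Lambda>)"
    by (intro tendsto_intros glim)
  then show "S t f x \<le> R t f x + t * \<Phi> (exp (L * t) * \<Lambda>)"
    by (rule LIMSEQ_le[OF lim]) (use le in auto)
qed

text \<open>On Lipschitz functions pointwise convergence is already locally uniform; equicontinuity
  carries this to all of \<open>bcontfun\<close>.\<close>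

lemma S_mixed_lim:
  assumes f: "f \<in> bcontfun" and t: "0 \<le> t"
  shows "mixed_lim (\<lambda>n. Jn n t f) (S t f)"
proof -
  obtain r where r: "r \<ge> 0" "\<And>x. \<bar>f x\<bar> \<le> r" using bcontfun_bound[OF f] by blast
  show ?thesis
  proof (rule mixed_limI)
    show "Jn n t f \<in> bcontfun" for n by (rule adm_bcontfun[OF adm_Jn f])
    show "S t f \<in> bcontfun" by (rule adm_bcontfun[OF adm_S[OF t] f])
    show "\<bar>Jn n t f x\<bar> \<le> r" for n x by (rule adm_abs_le[OF adm_Jn f r(2)])
    fix M0 e :: real assume e: "0 < e"
    then have e3: "0 < e / 3" by simp
    obtain M \<delta> where M: "equi_modulus t r M0 (e / 3) M \<delta>" using adm_equicontinuous[OF t e3 r(1)] .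
    obtain g \<Lambda> where g: "blip \<Lambda> g" "\<forall>x. \<bar>g x\<bar> \<le> r" "\<forall>x. norm x \<le> M \<longrightarrow> \<bar>f x - g x\<bar> \<le> \<delta>"
      using lipschitz_approx[OF f r(2) equi_modulusD(1)[OF M]] .
    have "(exp (L * t) * \<Lambda>)-lipschitz_on UNIV (Jn n t g)" for n
      using adm_blip_upto[OF adm_Jn grid_le[OF t] g(1)] by (simp add: blip_def)
    then have "uniform_limit (cball 0 M0) (\<lambda>n. Jn n t g) (S t g) sequentially"
      by (rule equilipschitz_uniform_limit) (auto intro: S_tendsto blip_bcontfun[OF g(1)] t)
    from uniform_limitD[OF this e3]
    show "\<forall>\<^sub>F n in sequentially. \<forall>x\<in>cball 0 M0. \<bar>Jn n t f x - S t f x\<bar> \<le> e"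
    proof eventually_elim
      case (elim n)
      show ?case
      proof
        fix x :: 'a assume x: "x \<in> cball 0 M0"
        have "\<bar>Jn n t f x - Jn n t g x\<bar> \<le> e / 3"
          by (rule equi_modulusD(2)[OF M adm_Jn grid_le[OF t] f blip_bcontfun[OF g(1)] r(2)]) (use g x in auto)
        moreover have "\<bar>S t f x - S t g x\<bar> \<le> e / 3"
          by (rule equi_modulusD(2)[OF M adm_S[OF t] order_refl f blip_bcontfun[OF g(1)] r(2)]) (use g x in auto)
        ultimately show "\<bar>Jn n t f x - S t f x\<bar> \<le> e"
          using elim[rule_format, OF x] unfolding dist_real_def by linarith
      qed
    qed
  qed
qed

lemma S_0: "f \<in> bcontfun \<Longrightarrow> S 0 f = f"
proof -
  assume f: "f \<in> bcontfun"
  have "step_count (h n) 0 = 0" for n using h_pos[of n] by (intro step_count_eqI) auto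
  then have "(\<lambda>n. Jn n 0 f x) \<longlonglongrightarrow> f x" for x by (simp add: Jn_def)
  then show ?thesis using S_tendsto[OF f, of 0] LIMSEQ_unique by (intro ext) blast
qed

lemma S_add:
  assumes f: "f \<in> bcontfun" and s: "0 \<le> s" and t: "0 \<le> t"
  shows "S (s + t) f = S s (S t f)"
proof -
  \<comment> \<open>Rounding down loses less than one step for each of \<open>s\<close> and
    \<open>t\<close>, so the counts differ by 0 or 1. The surplus step tends to the
    identity.\<close>
  define i where "i n = step_count (h n) (s + t) - (step_count (h n) s + step_count (h n) t)" for n
  have i: "step_count (h n) (s + t) = i n + (step_count (h n) s + step_count (h n) t) \<and> i n \<le> 1" for n
  proof -
    note a = step_count_properties[OF h_pos[of n]]
    have st: "0 \<le> s + t" using s t by simp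
    have "(real (step_count (h n) s) + real (step_count (h n) t)) * h n < (real (step_count (h n) (s + t)) + 1) * h n"
      using a(1)[OF s] a(1)[OF t] a(2)[OF st] by (simp add: distrib_right)
    then have 1: "step_count (h n) s + step_count (h n) t \<le> step_count (h n) (s + t)" using h_pos[of n] by simp
    have "real (step_count (h n) (s + t)) * h n < (real (step_count (h n) s) + real (step_count (h n) t) + 2) * h n"
      using a(2)[OF s] a(2)[OF t] a(1)[OF st] by (simp add: distrib_right)
    then have "step_count (h n) (s + t) < step_count (h n) s + step_count (h n) t + 2" using h_pos[of n] by simp
    then show ?thesis using 1 by (simp add: i_def)
  qed
  have "mixed_lim (\<lambda>n. Jn n s (Jn n t f)) (S s (S t f))"
    by (rule mixed_lim_compose_adm[OF S_mixed_lim[OF f t] adm_Jn grid_le[OF s]])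
      (rule S_mixed_lim[OF adm_bcontfun[OF adm_S[OF t] f] s])
  moreover obtain H where H: "\<And>n. h n \<le> H"
    using convergent_imp_Bseq[OF convergentI[OF h_lim]] by (auto simp: Bseq_def abs_le_iff)
  have ih: "real (i n) * h n \<le> h n" for n
    using i[of n] h_pos[of n] by (intro mult_left_le_one_le) auto
  have ihH: "real (i n) * h n \<le> H" for n using ih[of n] H[of n] by linarith
  have "(\<lambda>n. real (i n) * h n) \<longlonglongrightarrow> 0"
    by (rule tendsto_sandwich[OF _ _ tendsto_const h_lim])
      (use ih h_pos in \<open>auto intro!: always_eventually simp: less_imp_le\<close>)
  then have "mixed_lim (\<lambda>n. (J (h n) ^^ i n) (S s (S t f))) (S s (S t f))"
    by (intro mixed_lim_near_id[OF adm_J_steps ihH] adm_bcontfun[OF adm_S] s t f)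
  ultimately have "mixed_lim (\<lambda>n. (J (h n) ^^ i n) (Jn n s (Jn n t f))) (S s (S t f))"
    by (rule mixed_lim_compose_adm[OF _ adm_J_steps ihH])
  moreover have "(J (h n) ^^ i n) (Jn n s (Jn n t f)) = Jn n (s + t) f" for n
    using i[of n] by (simp add: Jn_def funpow_add)
  ultimately have "mixed_lim (\<lambda>n. Jn n (s + t) f) (S s (S t f))" by simp
  moreover have "mixed_lim (\<lambda>n. Jn n (s + t) f) (S (s + t) f)" using s t by (intro S_mixed_lim f) simp
  ultimately show ?thesis by (rule mixed_lim_unique[symmetric])
qed

lemma S_time_continuous:
  assumes f: "f \<in> bcontfun" and s: "\<And>n. 0 \<le> s n" "s \<longlonglongrightarrow> t" and t: "0 \<le> t"
  shows "mixed_lim (\<lambda>n. S (s n) f) (S t f)"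
proof -
  \<comment> \<open>Earlier time and gap: \<open>d n + a n\<close> is the later time, so the
    semigroup law applies whichever of \<open>s n\<close> and \<open>t\<close> comes first.\<close>
  define a where "a n = min (s n) t" for n
  define d where "d n = \<bar>s n - t\<bar>" for n
  have ad: "0 \<le> a n" "0 \<le> d n" for n using s t by (auto simp: a_def d_def)
  have d0: "d \<longlonglongrightarrow> 0" using tendsto_rabs[OF tendsto_diff[OF s(2) tendsto_const, of t]] by (simp add: d_def[abs_def])
  obtain B where B: "\<And>n. s n \<le> B"
    using convergent_imp_Bseq[OF convergentI[OF s(2)]] by (auto simp: Bseq_def abs_le_iff)
  obtain r where r: "r \<ge> 0" "\<And>x. \<bar>f x\<bar> \<le> r" using bcontfun_bound[OF f] by blast
  define T0 where "T0 = max B t"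
  have T0: "0 \<le> T0" "s n \<le> T0" "t \<le> T0" for n using B[of n] t by (auto simp: T0_def)
  show ?thesis
  proof (rule mixed_limI)
    show "S (s n) f \<in> bcontfun" for n by (rule adm_bcontfun[OF adm_S[OF s(1)] f])
    show "S t f \<in> bcontfun" by (rule adm_bcontfun[OF adm_S[OF t] f])
    show "\<bar>S (s n) f x\<bar> \<le> r" for n x by (rule adm_abs_le[OF adm_S[OF s(1)] f r(2)])
    fix M0 e :: real assume e: "0 < e"
    then have e3: "0 < e / 3" by simp
    obtain M \<delta> where M: "equi_modulus T0 r M0 (e / 3) M \<delta>" using adm_equicontinuous[OF T0(1) e3 r(1)] .
    obtain g \<Lambda> where g: "blip \<Lambda> g" "\<forall>x. \<bar>g x\<bar> \<le> r" "\<forall>x. norm x \<le> M \<longrightarrow> \<bar>f x - g x\<bar> \<le> \<delta>"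
      using lipschitz_approx[OF f r(2) equi_modulusD(1)[OF M]] .
    note gb = blip_bcontfun[OF g(1)]
    define \<Lambda>' where "\<Lambda>' = exp (L * T0) * \<Lambda>"
    have l': "0 \<le> \<Lambda>'" using blip_nonneg[OF g(1)] by (simp add: \<Lambda>'_def)
    obtain \<eta> where \<eta>: "0 < \<eta>" "\<forall>t T f x. adm t T \<longrightarrow> t \<le> \<eta> \<longrightarrow> blip \<Lambda>' f \<longrightarrow> norm x \<le> M0 \<longrightarrow> \<bar>T f x - f x\<bar> \<le> e / 3"
      using adm_near_id[OF l' e3] .
    have "\<forall>\<^sub>F n in sequentially. d n < \<eta>" using order_tendstoD(2)[OF d0 \<eta>(1)] .
    then show "\<forall>\<^sub>F n in sequentially. \<forall>x\<in>cball 0 M0. \<bar>S (s n) f x - S t f x\<bar> \<le> e"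
    proof eventually_elim
      case (elim n)
      show ?case
      proof
        fix x :: 'a assume "x \<in> cball 0 M0"
        then have x: "norm x \<le> M0" by simp
        have c: "\<bar>S \<tau> f x - S \<tau> g x\<bar> \<le> e / 3" if "0 \<le> \<tau>" "\<tau> \<le> T0" for \<tau>
          by (rule equi_modulusD(2)[OF M adm_S[OF that(1)] that(2) f gb r(2) _ _ x]) (use g in auto)
        have ag: "blip \<Lambda>' (S (a n) g)"
          unfolding \<Lambda>'_def using T0(3) by (intro adm_blip_upto[OF adm_S[OF ad(1)] _ g(1)]) (auto simp: a_def)
        have "\<bar>S (d n) (S (a n) g) x - S (a n) g x\<bar> \<le> e / 3"
          using \<eta>(2)[rule_format, OF adm_S[OF ad(2)] _ ag x] elim by simp
        then have "\<bar>S (d n + a n) g x - S (a n) g x\<bar> \<le> e / 3" by (simp add: S_add[OF gb ad(2,1)])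
        moreover have "d n + a n = max (s n) t" by (auto simp: d_def a_def)
        ultimately have "\<bar>S (s n) g x - S t g x\<bar> \<le> e / 3" by (auto simp: a_def max_def min_def abs_minus_commute split: if_splits)
        then show "\<bar>S (s n) f x - S t f x\<bar> \<le> e"
          using c[OF s(1) T0(2), of n] c[OF t T0(3)] by linarith
      qed
    qed
  qed
qed

theorem convex_monotone_semigroup_S: "convex_monotone_semigroup S"
  unfolding convex_monotone_semigroup_def
proof (intro conjI allI impI ballI)
  show "Cb_semigroup S"
    unfolding Cb_semigroup_def using adm_bcontfun[OF adm_S] S_0 S_add by blast
  show "S t (\<lambda>y. l * f y + (1 - l) * g y) x \<le> l * S t f x + (1 - l) * S t g x"
    if "0 \<le> t" "f \<in> bcontfun" "g \<in> bcontfun" "l \<in> {0..1}" for t f g l x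
    using adm_convex[OF adm_S[OF that(1)] that(2,3)] that(4) by simp
  show "S t f \<le> S t g" if "0 \<le> t" "f \<in> bcontfun" "g \<in> bcontfun" "f \<le> g" for t f g
    using adm_mono[OF adm_S[OF that(1)] that(2,3)] that(4) by (simp add: le_fun_def)
  show "bdd_above ((\<lambda>t. sup_norm (S t (\<lambda>_. r))) ` {0..T})" for r T
  proof (rule bdd_aboveI2)
    fix t assume "t \<in> {0..T}"
    then show "sup_norm (S t (\<lambda>_. r)) \<le> \<bar>r\<bar>" using adm_const[OF adm_S, of t r] by (intro sup_norm_le) simp
  qed
  fix t :: real assume t: "0 \<le> t"
  fix F :: "nat \<Rightarrow> 'a \<Rightarrow> real"
  assume F: "(\<forall>n. F n \<in> bcontfun) \<and> decseq F \<and> (\<forall>x. (\<lambda>n. F n x) \<longlonglongrightarrow> 0)"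
  then have Fb: "\<And>n. F n \<in> bcontfun" and dec: "decseq F" and lim: "\<And>x. (\<lambda>n. F n x) \<longlonglongrightarrow> 0" by auto
  show "decseq (\<lambda>n. S t (F n))"
    by (intro decseq_SucI le_funI adm_mono[OF adm_S[OF t] Fb Fb] le_funD[OF decseqD[OF dec]]) simp
  obtain r where r: "\<And>x. \<bar>F 0 x\<bar> \<le> r" using bcontfun_bound[OF Fb] by blast
  \<comment> \<open>Continuity from above reduces to mixed continuity of \<open>S t\<close>, once
    Dini's theorem upgrades the monotone pointwise convergence.\<close>
  have "mixed_lim F (\<lambda>_. 0)"
  proof (rule mixed_limI)
    show "\<bar>F n x\<bar> \<le> r" for n x
    proof -
      have "0 \<le> F n x"
        by (rule LIMSEQ_le_const2[OF lim]) (use decseqD[OF dec] in \<open>auto simp: le_fun_def intro!: exI[of _ n]\<close>)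
      then show ?thesis using le_funD[OF decseqD[OF dec, of 0 n], of x] r[of x] by linarith
    qed
    show "\<forall>\<^sub>F n in sequentially. \<forall>x\<in>cball 0 M. \<bar>F n x - 0\<bar> \<le> e" if "0 < e" for M e
      using Dini_zero[OF bcontfun_continuous[OF Fb] dec lim that] by simp
  qed (use Fb in \<open>auto simp: const_bcontfun\<close>)
  moreover have "S t (\<lambda>_. 0) = (\<lambda>_. 0)" using adm_const[OF adm_S[OF t]] by auto
  then have "mixed_lim (\<lambda>n. S t (\<lambda>_. 0)) (\<lambda>_. 0)"
    by (auto intro!: mixed_limI[of _ _ 0] simp: const_bcontfun)
  ultimately have "mixed_lim (\<lambda>n. S t (F n)) (\<lambda>_. 0)"
    by (rule mixed_lim_compose_adm[OF _ adm_S[OF t] order_refl])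
  then show "(\<lambda>n. S t (F n) x) \<longlonglongrightarrow> 0" for x by (rule mixed_lim_tendsto)
next
  fix f :: "'a \<Rightarrow> real" and t :: real and x s and y :: "nat \<Rightarrow> 'a"
  assume f: "f \<in> bcontfun" and t: "0 \<le> t" and a: "(\<forall>n. 0 \<le> s n) \<and> s \<longlonglongrightarrow> t \<and> y \<longlonglongrightarrow> x"
  then have s: "\<And>n. 0 \<le> s n" "s \<longlonglongrightarrow> t" and y: "y \<longlonglongrightarrow> x" by auto
  have ml: "mixed_lim (\<lambda>n. S (s n) f) (S t f)" by (rule S_time_continuous[OF f s t])
  have "bounded (range y)" using convergent_imp_bounded[OF y] .
  then obtain M where M: "\<And>n. norm (y n) \<le> M" by (auto simp: bounded_iff)
  \<comment> \<open>Joint continuity is obtained, which is more than the upper bound on the limit: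
    the points \<open>y n\<close> stay in a ball, where convergence in time is uniform.\<close>
  have "(\<lambda>n. S (s n) f (y n) - S t f (y n)) \<longlonglongrightarrow> 0"
  proof (rule LIMSEQ_I)
    fix e :: real assume e: "0 < e"
    have "\<forall>\<^sub>F n in sequentially. norm (S (s n) f (y n) - S t f (y n) - 0) < e"
      using mixed_limD[OF ml half_gt_zero[OF e], of M]
    proof eventually_elim
      case (elim n)
      have "y n \<in> cball 0 M" using M[of n] by simp
      from elim(1)[rule_format, OF this] show ?case using e by simp
    qed
    then show "\<exists>N. \<forall>n\<ge>N. norm (S (s n) f (y n) - S t f (y n) - 0) < e" by (simp add: eventually_sequentially)
  qed
  moreover have "(\<lambda>n. S t f (y n)) \<longlonglongrightarrow> S t f x"
    using bcontfun_continuous[OF adm_bcontfun[OF adm_S[OF t] f]] y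
    by (auto simp: continuous_on_eq_continuous_at intro: isCont_tendsto_compose)
  ultimately have "(\<lambda>n. (S (s n) f (y n) - S t f (y n)) + S t f (y n)) \<longlonglongrightarrow> 0 + S t f x"
    by (rule tendsto_add)
  then have "(\<lambda>n. ereal (S (s n) f (y n))) \<longlonglongrightarrow> ereal (S t f x)" by simp
  then show "limsup (\<lambda>n. ereal (S (s n) f (y n))) \<le> ereal (S t f x)"
    by (intro eq_refl lim_imp_Limsup) simp_all
qed

theorem strongly_continuous_S: "strongly_continuous S"
  unfolding strongly_continuous_def mixed_lim_at_0_def
proof (intro ballI allI impI)
  fix f :: "'a \<Rightarrow> real" and s :: "nat \<Rightarrow> real"
  assume f: "f \<in> bcontfun" and s: "(\<forall>n. 0 < s n) \<and> s \<longlonglongrightarrow> 0"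
  then have "mixed_lim (\<lambda>n. S (s n) f) (S 0 f)" by (intro S_time_continuous) (auto simp: less_imp_le)
  then show "mixed_lim (\<lambda>n. S (s n) f) f" by (simp add: S_0[OF f])
qed

end

section \<open>Comparison of the Wasserstein and the drift perturbation\<close>

lemma powr_one_minus_small:
  fixes p \<delta> :: real
  assumes "1 < p" "0 < \<delta>"
  obtains N where "1 \<le> N" "N powr (1 - p) \<le> \<delta>"
proof -
  define N where "N = max 1 (\<delta> powr (1 / (1 - p)))"
  have "N powr (1 - p) \<le> (\<delta> powr (1 / (1 - p))) powr (1 - p)"
    unfolding N_def using assms by (intro powr_mono2') auto
  also have "\<dots> = \<delta>" using assms by (simp add: powr_powr)
  finally show ?thesis using that[of N] by (simp add: N_def)
qed

context wasserstein_perturbation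
begin

lemma I_bounds:
  assumes t: "0 < t" and f: "f \<in> bcontfun"
  shows I_ge: "\<And>\<nu> x. \<nu> \<in> P_space p \<Longrightarrow> wasserstein p (\<mu> t) \<nu> / t \<in> dom \<Longrightarrow>
      (\<integral>z. f (\<psi> t x + z) \<partial>\<nu>) - t * cost (wasserstein p (\<mu> t) \<nu> / t) \<le> I t f x"
    and I_le: "\<And>x a. (\<And>\<nu>. \<nu> \<in> P_space p \<Longrightarrow> wasserstein p (\<mu> t) \<nu> / t \<in> dom \<Longrightarrow>
      (\<integral>z. f (\<psi> t x + z) \<partial>\<nu>) - t * cost (wasserstein p (\<mu> t) \<nu> / t) \<le> a) \<Longrightarrow> I t f x \<le> a"
proof -
  note t0 = less_imp_le[OF t]
  define W where "W \<nu> = wasserstein p (\<mu> t) \<nu>" for \<nu>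
  define A where "A x \<nu> = ereal (\<integral>z. f (\<psi> t x + z) \<partial>\<nu>) - perspective \<phi> t (W \<nu>)" for x \<nu>
  have I: "I t f x = real_of_ereal (SUP \<nu>\<in>P_space p. A x \<nu>)" for x
    unfolding I_op_def A_def W_def ..
  obtain r where r: "\<And>x. \<bar>f x\<bar> \<le> r" using bcontfun_bound[OF f] by blast
  have bound: "\<bar>\<integral>z. f (\<psi> t x + z) \<partial>\<nu>\<bar> \<le> r" if \<nu>: "\<nu> \<in> P_space p" for \<nu> x
  proof -
    interpret prob_space \<nu> by (rule P_spaceD(1)[OF \<nu>])
    have "(\<lambda>z. \<psi> t x + z) \<in> borel_measurable \<nu>" by (simp add: measurable_cong_sets[OF P_spaceD(2)[OF \<nu>] refl])
    then have i: "integrable \<nu> (\<lambda>z. f (\<psi> t x + z))" by (rule integrable_bcontfun_compose[OF finite_measure_axioms f])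
    have "norm (\<integral>z. f (\<psi> t x + z) \<partial>\<nu>) \<le> (\<integral>z. norm (f (\<psi> t x + z)) \<partial>\<nu>)" by (rule integral_norm_bound)
    also have "\<dots> \<le> r" using i r by (intro integral_le_const) auto
    finally show ?thesis by simp
  qed
  have Ad: "A x \<nu> = ereal ((\<integral>z. f (\<psi> t x + z) \<partial>\<nu>) - t * cost (W \<nu> / t))" if "W \<nu> / t \<in> dom" for x \<nu>
    using perspective_cost[OF t that] by (simp add: A_def)
  have An: "A x \<nu> = - \<infinity>" if "W \<nu> / t \<notin> dom" for x \<nu>
    using perspective_infinite[OF t _ that] wasserstein_nonneg[of p "\<mu> t" \<nu>] by (simp add: A_def W_def)
  have ub: "A x \<nu> \<le> ereal r" if \<nu>: "\<nu> \<in> P_space p" for x \<nu>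
  proof (cases "W \<nu> / t \<in> dom")
    case True
    have "0 \<le> t * cost (W \<nu> / t)" using t0 cost_nonneg[OF True] by simp
    then show ?thesis using Ad[OF True, of x] bound[OF \<nu>, of x] by (simp add: abs_le_iff)
  qed (simp add: An)
  \<comment> \<open>Seen as translation by 0; it makes \<open>\<mu> t\<close> a competitor without
    penalty.\<close>
  have W0: "W (\<mu> t) = 0"
  proof -
    have "distr (\<mu> t) borel (\<lambda>y. y + 0) = \<mu> t" by (simp add: distr_id2[OF sets_mu[OF t0, symmetric]])
    then show ?thesis using shift_P_space(2)[OF p mu[OF t0], of 0] wasserstein_nonneg[of p "\<mu> t" "\<mu> t"] by (simp add: W_def)
  qed
  have lb: "ereal (- r) \<le> A x (\<mu> t)" for x
    using Ad[of "\<mu> t" x] zero_dom bound[OF mu[OF t0], of x] by (simp add: W0 cost_0 abs_le_iff)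
  note S = real_of_SUP_bounds[where X="P_space p" and A="A x" for x, OF mu[OF t0] lb ub]
  show "(\<integral>z. f (\<psi> t x + z) \<partial>\<nu>) - t * cost (wasserstein p (\<mu> t) \<nu> / t) \<le> I t f x"
    if "\<nu> \<in> P_space p" "wasserstein p (\<mu> t) \<nu> / t \<in> dom" for \<nu> x
    unfolding I using that by (intro S(1)[where i=\<nu>]) (simp_all add: Ad W_def)
  show "I t f x \<le> a" if *: "\<And>\<nu>. \<nu> \<in> P_space p \<Longrightarrow> wasserstein p (\<mu> t) \<nu> / t \<in> dom \<Longrightarrow>
      (\<integral>z. f (\<psi> t x + z) \<partial>\<nu>) - t * cost (wasserstein p (\<mu> t) \<nu> / t) \<le> a" for x a
    unfolding I
  proof (rule S(2))
    show "A x \<nu> \<le> ereal a" if "\<nu> \<in> P_space p" for \<nu>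
      using Ad[of \<nu> x] An[of \<nu> x] *[OF that] by (cases "W \<nu> / t \<in> dom") (auto simp: W_def)
  qed
qed

text \<open>A drift is the special transport that translates all mass; its distance is at most
  \<open>t |b|\<close>, and the penalty is nondecreasing.\<close>

lemma J_le_I:
  assumes t: "0 < t" and f: "f \<in> bcontfun"
  shows "J t f x \<le> I t f x"
proof (rule J_le[OF t f])
  note t0 = less_imp_le[OF t]
  fix b :: 'a assume b: "norm b \<in> dom"
  define \<nu> where "\<nu> = distr (\<mu> t) borel (\<lambda>y. y + t *\<^sub>R b)"
  note sh = shift_P_space[OF p mu[OF t0], of "t *\<^sub>R b", folded \<nu>_def]
  have w: "wasserstein p (\<mu> t) \<nu> / t \<le> norm b" using sh(2) t by (simp add: field_simps)
  note d = dom_mono[OF b _ w]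
  have w0: "0 \<le> wasserstein p (\<mu> t) \<nu> / t" using wasserstein_nonneg[of p "\<mu> t" \<nu>] t0 by simp
  have fm: "(\<lambda>z. f (\<psi> t x + z)) \<in> borel_measurable borel"
    using bcontfun_measurable[OF bcontfun_shift[OF f, of "\<psi> t x"]] by (simp add: add.commute)
  have "(\<integral>z. f (\<psi> t x + z) \<partial>\<nu>) = R t (\<lambda>z. f (z + t *\<^sub>R b)) x"
    unfolding \<nu>_def R_op_def
    by (subst integral_distr[OF _ fm]) (auto intro: measurable_mu[OF t0] simp: add.assoc)
  moreover have "t * cost (wasserstein p (\<mu> t) \<nu> / t) \<le> t * cost (norm b)"
    using d(2)[OF w0] t0 by (rule mult_left_mono)
  ultimately show "R t (\<lambda>z. f (z + t *\<^sub>R b)) x - t * cost (norm b) \<le> I t f x"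
    using I_ge[OF t f sh(1) d(1)[OF w0], of x] by simp
qed

lemma integral_P_space:
  assumes \<nu>: "\<nu> \<in> P_space p" and f: "f \<in> bcontfun"
  shows "integrable \<nu> (\<lambda>z. f (c + z) :: real)"
proof -
  interpret prob_space \<nu> by (rule P_spaceD(1)[OF \<nu>])
  have "(\<lambda>z. c + z) \<in> borel_measurable \<nu>" by (simp add: measurable_cong_sets[OF P_spaceD(2)[OF \<nu>] refl])
  then show ?thesis by (rule integrable_bcontfun_compose[OF finite_measure_axioms f])
qed

text \<open>Speed is the Wasserstein distance per unit of time: against \<Lambda>-Lipschitz
  functions the gain is at most \<open>\<Lambda>\<close> times the distance, and the conjugate
  bounds gain minus penalty.\<close>

lemma adm_I:
  assumes t: "0 < t"
  shows "adm t (I t)"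
proof (rule adm_of_sup[where X="{\<nu> \<in> P_space p. wasserstein p (\<mu> t) \<nu> / t \<in> dom}"
      and A="\<lambda>\<nu> f x. \<integral>z. f (\<psi> t x + z) \<partial>\<nu>" and P="\<lambda>\<nu>. t * cost (wasserstein p (\<mu> t) \<nu> / t)"])
  note t0 = less_imp_le[OF t]
  let ?X = "{\<nu> \<in> P_space p. wasserstein p (\<mu> t) \<nu> / t \<in> dom}"
  show "0 \<le> t" by fact
  show "(\<integral>z. f (\<psi> t x + z) \<partial>\<nu>) - t * cost (wasserstein p (\<mu> t) \<nu> / t) \<le> R t f x + t * \<Phi> \<Lambda>"
    if \<nu>: "\<nu> \<in> ?X" and f: "blip \<Lambda> f" for \<nu> f \<Lambda> x
  proof -
    have "t * (wasserstein p (\<mu> t) \<nu> / t * \<Lambda> - cost (wasserstein p (\<mu> t) \<nu> / t)) \<le> t * \<Phi> \<Lambda>"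
      using \<nu> t0 blip_nonneg[OF f] by (intro mult_left_mono conjugate_ge) auto
    moreover have "(\<integral>z. f (\<psi> t x + z) \<partial>\<nu>) \<le> R t f x + \<Lambda> * wasserstein p (\<mu> t) \<nu>"
      unfolding R_op_def using \<nu> by (intro integral_diff_le_wasserstein[OF p mu[OF t0] _ f]) auto
    ultimately show ?thesis using t by (simp add: algebra_simps)
  qed
  show "(\<integral>z. f (\<psi> t x + z) \<partial>\<nu>) - (\<integral>z. f (\<psi> t y + z) \<partial>\<nu>) \<le> \<Lambda> * norm (\<psi> t x - \<psi> t y)"
    if \<nu>: "\<nu> \<in> ?X" and f: "blip \<Lambda> f" for \<nu> f \<Lambda> x y
  proof -
    interpret prob_space \<nu> using \<nu> P_spaceD(1) by blast
    have i: "integrable \<nu> (\<lambda>z. f (c + z))" for c using \<nu> by (intro integral_P_space blip_bcontfun[OF f]) auto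
    have "(\<integral>z. f (\<psi> t x + z) \<partial>\<nu>) - (\<integral>z. f (\<psi> t y + z) \<partial>\<nu>) = (\<integral>z. f (\<psi> t x + z) - f (\<psi> t y + z) \<partial>\<nu>)"
      using i by simp
    also have "\<dots> \<le> \<Lambda> * norm (\<psi> t x - \<psi> t y)"
      using i blip_diff[OF f, of "\<psi> t x + z" "\<psi> t y + z" for z] by (intro integral_le_const) auto
    finally show ?thesis .
  qed
  show "(\<integral>z. f (\<psi> t x + z) \<partial>\<nu>) - t * cost (wasserstein p (\<mu> t) \<nu> / t) \<le> I t f x"
    if "\<nu> \<in> ?X" "f \<in> bcontfun" for \<nu> f x using I_ge[OF t that(2)] that(1) by simp
  show "I t f x \<le> a" if "f \<in> bcontfun"
    "\<And>\<nu>. \<nu> \<in> ?X \<Longrightarrow> (\<integral>z. f (\<psi> t x + z) \<partial>\<nu>) - t * cost (wasserstein p (\<mu> t) \<nu> / t) \<le> a" for f x a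
    using I_le[OF t that(1)] that(2) by simp
  show "R t f x \<le> I t f x" if "blip \<Lambda> f" for \<Lambda> f x
    using R_le_J[OF t blip_bcontfun[OF that], of x] J_le_I[OF t blip_bcontfun[OF that], of x] by linarith
  show "(\<integral>z. f (\<psi> t x + z) \<partial>\<nu>) \<le> (\<integral>z. g (\<psi> t x + z) \<partial>\<nu>)"
    if "\<nu> \<in> ?X" "f \<in> bcontfun" "g \<in> bcontfun" "\<And>x. f x \<le> g x" for \<nu> and f g :: "'a \<Rightarrow> real" and x
    using that by (intro integral_mono integral_P_space) auto
  show "(\<integral>z. f (\<psi> t x + z) + g (\<psi> t x + z) \<partial>\<nu>) = (\<integral>z. f (\<psi> t x + z) \<partial>\<nu>) + (\<integral>z. g (\<psi> t x + z) \<partial>\<nu>)"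
    if "\<nu> \<in> ?X" "f \<in> bcontfun" "g \<in> bcontfun" for \<nu> and f g :: "'a \<Rightarrow> real" and x
    using that by (intro Bochner_Integration.integral_add integral_P_space) auto
  show "(\<integral>z. c \<partial>\<nu>) = c" if "\<nu> \<in> ?X" for \<nu> and c :: real
    using that prob_space.prob_space[OF P_spaceD(1)] by auto
qed simp

text \<open>A coupling moves mass along its increments \<open>\<xi>\<close>. Increments up to \<open>N h\<close> are handled by the quadratic
  remainder, longer ones by \<open>\<bar>\<xi>\<bar> \<le> \<bar>\<xi>\<bar>\<^sup>p (N h)\<^bsup>1 - p\<^esup>\<close>.\<close>

lemma coupling_gain_le:
  assumes h: "0 < h" and \<nu>: "\<nu> \<in> P_space p" and g: "blip \<Lambda> g" and q: "quadratic_remainder K G g"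
    and w: "wasserstein p (\<mu> h) \<nu> < V * h" and N: "1 \<le> N"
  shows "(\<integral>y. g (z + y) \<partial>\<nu>) \<le> (\<integral>y. g (z + y) \<partial>\<mu> h) + norm (G z) * wasserstein p (\<mu> h) \<nu>
    + h * (6 * K * N * (m h + V * h) + 2 * \<Lambda> * N powr (1 - p) * V powr p)"
proof -
  note h0 = less_imp_le[OF h]
  note l0 = blip_nonneg[OF g]
  have K: "0 \<le> K" using q by (rule quadratic_remainderD)
  define W where "W = wasserstein p (\<mu> h) \<nu>"
  have W: "0 \<le> W" "W < V * h" using w wasserstein_nonneg by (auto simp: W_def)
  then have V: "0 < V" using h by (metis less_le_not_le linorder_neqE_linordered_idom mult_eq_0_iff mult_less_0_iff order_le_less_trans)
  define E where "E = h * (6 * K * N * (m h + V * h) + 2 * \<Lambda> * N powr (1 - p) * V powr p)"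
  have gm: "(\<lambda>y. g (z + y)) \<in> borel_measurable borel"
    using bcontfun_measurable[OF bcontfun_shift[OF blip_bcontfun[OF g], of z]] by (simp add: add.commute)
  \<comment> \<open>Room above the distance is needed for a near-optimal coupling, and
    \<open>s \<le> V * h\<close> bounds its \<open>p\<close>-th moment.\<close>
  have *: "(\<integral>y. g (z + y) \<partial>\<nu>) - (\<integral>y. g (z + y) \<partial>\<mu> h) \<le> norm (G z) * s + E" if s: "W < s" "s \<le> V * h" for s
  proof -
    obtain \<pi> where \<pi>: "\<pi> \<in> couplings (\<mu> h) \<nu>" and le: "(\<integral>u. norm (fst u - snd u) powr p \<partial>\<pi>) \<le> s powr p"
      using near_optimal_coupling[OF p mu[OF h0] \<nu> s(1)[unfolded W_def]] .
    note c = couplingsD[OF \<pi>]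
    note ip = integrable_coupling_cost[OF p mu[OF h0] \<nu> \<pi>]
    interpret prob_space \<pi> using c(1) .
    have s0: "0 < s" using W s by linarith
    define \<xi> where "\<xi> u = snd u - fst u" for u :: "'a \<times> 'a"
    have n\<xi>: "norm (fst u - snd u) = norm (\<xi> u)" for u by (simp add: \<xi>_def norm_minus_commute)
    have n: "(\<lambda>u. norm (\<xi> u)) \<in> borel_measurable \<pi>" unfolding \<xi>_def using c(5,6) by simp
    note e = expectation_le_of_powr[OF c(1) n norm_ge_zero p ip[unfolded n\<xi>] le[unfolded n\<xi>] s0]
    have if1: "integrable \<pi> (\<lambda>u. norm (fst u))"
      using integrable_distr[OF c(5), of norm] integrable_norm_mu[OF h0] c(3) by simp
    have mf: "(\<integral>u. norm (fst u) \<partial>\<pi>) = m h"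
      unfolding m_def by (rule integral_coupling_fst[OF \<pi>, symmetric]) (intro borel_measurable_continuous_onI continuous_on_norm continuous_on_id)
    have i: "integrable \<pi> (\<lambda>u. g (z + fst u))" "integrable \<pi> (\<lambda>u. g (z + snd u))"
      using c(5,6) by (auto intro!: integrable_bcontfun_compose[OF finite_measure_axioms blip_bcontfun[OF g]])
    \<comment> \<open>Gradient term, cost of freezing the gradient at \<open>z\<close> for short
      displacements, and long displacements weighted by their \<open>p\<close>-th power.\<close>
    define B where "B u = norm (G z) * norm (\<xi> u) + 6 * K * N * h * (norm (fst u) + norm (\<xi> u))
       + 2 * \<Lambda> * (N * h) powr (1 - p) * norm (\<xi> u) powr p" for u
    have pt: "g (z + snd u) - g (z + fst u) \<le> B u" for u
    proof -
      have Nh: "0 < N * h" using N h by simp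
      have eq: "z + fst u + \<xi> u = z + snd u" by (simp add: \<xi>_def)
      have Gx: "\<bar>G z \<bullet> \<xi> u\<bar> \<le> norm (G z) * norm (\<xi> u)" by (rule Cauchy_Schwarz_ineq2)
      have nn: "0 \<le> 6 * K * N * h * (norm (fst u) + norm (\<xi> u))" "0 \<le> 2 * \<Lambda> * (N * h) powr (1 - p) * norm (\<xi> u) powr p"
        using K N h l0 by auto
      show ?thesis
      proof (cases "norm (\<xi> u) \<le> N * h")
        case True
        have "6 * K * norm (\<xi> u) * (norm (fst u) + norm (\<xi> u)) \<le> 6 * K * (N * h) * (norm (fst u) + norm (\<xi> u))"
          using True K by (intro mult_right_mono mult_left_mono) auto
        then show ?thesis
          using quadratic_remainder_increment[OF q, of z "fst u" "\<xi> u"] Gx nn unfolding eq B_def mult.assoc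
          by linarith
      next
        case False
        then have x: "N * h < norm (\<xi> u)" by simp
        have "norm (\<xi> u) = norm (\<xi> u) powr (1 - p) * norm (\<xi> u) powr p"
          using x Nh by (simp flip: powr_add)
        also have "\<dots> \<le> (N * h) powr (1 - p) * norm (\<xi> u) powr p"
          using x Nh p by (intro mult_right_mono powr_mono2') auto
        finally have "\<Lambda> * norm (\<xi> u) \<le> \<Lambda> * ((N * h) powr (1 - p) * norm (\<xi> u) powr p)"
          using l0 by (intro mult_left_mono)
        moreover have "g (z + snd u) - g (z + fst u) \<le> \<Lambda> * norm (\<xi> u)"
          using blip_diff[OF g, of "z + snd u" "z + fst u"] by (simp add: \<xi>_def)
        moreover have "0 \<le> \<Lambda> * norm (\<xi> u)" using l0 by simp
        moreover have "0 \<le> norm (G z) * norm (\<xi> u)" by simp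
        ultimately show ?thesis using nn unfolding B_def mult.assoc by linarith
      qed
    qed
    have iB: "integrable \<pi> B" unfolding B_def using e(1) if1 ip[unfolded n\<xi>] by simp
    have "(\<integral>y. g (z + y) \<partial>\<nu>) - (\<integral>y. g (z + y) \<partial>\<mu> h) = (\<integral>u. g (z + snd u) - g (z + fst u) \<partial>\<pi>)"
      using i by (simp add: integral_coupling_fst[OF \<pi> gm] integral_coupling_snd[OF \<pi> gm])
    also have "\<dots> \<le> (\<integral>u. B u \<partial>\<pi>)" using i iB pt by (intro integral_mono) auto
    also have "\<dots> = norm (G z) * (\<integral>u. norm (\<xi> u) \<partial>\<pi>) + 6 * K * N * h * (m h + (\<integral>u. norm (\<xi> u) \<partial>\<pi>))
        + 2 * \<Lambda> * (N * h) powr (1 - p) * (\<integral>u. norm (\<xi> u) powr p \<partial>\<pi>)"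
      unfolding B_def using e(1) if1 ip[unfolded n\<xi>] by (simp add: mf)
    also have "\<dots> \<le> norm (G z) * s + 6 * K * N * h * (m h + V * h) + 2 * \<Lambda> * (N * h) powr (1 - p) * (V * h) powr p"
    proof (intro add_mono mult_left_mono order_refl)
      have "s powr p \<le> (V * h) powr p" using s s0 p by (intro powr_mono2) auto
      then show "(\<integral>u. norm (\<xi> u) powr p \<partial>\<pi>) \<le> (V * h) powr p" using le[unfolded n\<xi>] by linarith
    qed (use e(2) s K N h0 l0 in auto)
    \<comment> \<open>The powers of \<open>h\<close> combine to exactly \<open>h\<close>: this bound
      on long jumps is of first order, and only large \<open>N\<close> makes it negligible.\<close>
    also have "(N * h) powr (1 - p) * (V * h) powr p = h * (N powr (1 - p) * V powr p)"
    proof -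
      have "(N * h) powr (1 - p) * (V * h) powr p = (h powr (1 - p) * h powr p) * (N powr (1 - p) * V powr p)"
        using N h V by (simp add: powr_mult)
      also have "h powr (1 - p) * h powr p = h" using h by (simp flip: powr_add)
      finally show ?thesis .
    qed
    then have "norm (G z) * s + 6 * K * N * h * (m h + V * h) + 2 * \<Lambda> * (N * h) powr (1 - p) * (V * h) powr p
       = norm (G z) * s + E" by (simp add: E_def mult.assoc algebra_simps)
    finally show ?thesis .
  qed
  have "(\<integral>y. g (z + y) \<partial>\<nu>) - (\<integral>y. g (z + y) \<partial>\<mu> h) \<le> norm (G z) * W + E"
  proof (rule field_le_epsilon)
    fix e :: real assume e: "0 < e"
    define s where "s = min (V * h) (W + e / (norm (G z) + 1))"
    have s: "W < s" "s \<le> V * h" using W e by (auto simp: s_def add_nonneg_pos)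
    have "norm (G z) * s \<le> norm (G z) * (W + e / (norm (G z) + 1))" by (intro mult_left_mono) (auto simp: s_def)
    also have "\<dots> \<le> norm (G z) * W + e"
    proof -
      have "0 < norm (G z) + 1" by (simp add: add_nonneg_pos)
      then have "norm (G z) * (e / (norm (G z) + 1)) \<le> e" using e by (simp add: pos_divide_le_eq algebra_simps)
      then show ?thesis by (simp add: distrib_left)
    qed
    finally show "(\<integral>y. g (z + y) \<partial>\<nu>) - (\<integral>y. g (z + y) \<partial>\<mu> h) \<le> norm (G z) * W + E + e"
      using *[OF s] by linarith
  qed
  then show ?thesis unfolding E_def W_def by linarith
qed

text \<open>The optimal drift against a smooth function points along its gradient.\<close>

lemma J_ge_gradient:
  assumes h: "0 < h" and g: "blip \<Lambda> g" and q: "quadratic_remainder K G g" and v: "v \<in> dom"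
  shows "R h g x + h * (v * norm (G (\<psi> h x)) - cost v) - h * (6 * K * v * (m h + v * h)) \<le> J h g x"
proof -
  note h0 = less_imp_le[OF h]
  interpret prob_space "\<mu> h" by (rule prob[OF h0])
  note gb = blip_bcontfun[OF g]
  have K: "0 \<le> K" using q by (rule quadratic_remainderD)
  note v0 = dom_nonneg[OF v]
  define z where "z = \<psi> h x"
  define b where "b = v *\<^sub>R sgn (G z)"
  have nb: "norm b \<le> v" using v0 by (simp add: b_def norm_sgn)
  note d = dom_mono[OF v norm_ge_zero nb]
  have Gb: "G z \<bullet> (h *\<^sub>R b) = h * (v * norm (G z))"
    by (cases "G z = 0") (auto simp: b_def sgn_div_norm power2_norm_eq_inner[symmetric] power2_eq_square)
  have nhb: "norm (h *\<^sub>R b) \<le> h * v" using nb h by simp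
  have pt: "g (z + y) + (h * (v * norm (G z)) - 6 * K * (h * v) * (norm y + h * v)) \<le> g (z + y + h *\<^sub>R b)" for y
  proof -
    have "6 * K * norm (h *\<^sub>R b) * (norm y + norm (h *\<^sub>R b)) \<le> 6 * K * (h * v) * (norm y + h * v)"
      using nhb K h0 v0 by (intro mult_mono mult_left_mono add_left_mono) auto
    then show ?thesis using quadratic_remainder_increment[OF q, of z y "h *\<^sub>R b"] Gb by linarith
  qed
  have i1: "integrable (\<mu> h) (\<lambda>y. g (z + y))" by (rule integrable_R[OF h0 gb])
  have i2: "integrable (\<mu> h) (\<lambda>y. g (z + y + h *\<^sub>R b))"
    using integrable_R[OF h0 bcontfun_shift[OF gb, of "h *\<^sub>R b"], of z] .
  have "(\<integral>y. g (z + y) + (h * (v * norm (G z)) - 6 * K * (h * v) * (norm y + h * v)) \<partial>\<mu> h)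
     \<le> (\<integral>y. g (z + y + h *\<^sub>R b) \<partial>\<mu> h)"
    using i1 i2 integrable_norm_mu[OF h0] by (intro integral_mono pt) auto
  moreover have "(\<integral>y. g (z + y) + (h * (v * norm (G z)) - 6 * K * (h * v) * (norm y + h * v)) \<partial>\<mu> h)
     = R h g x + h * (v * norm (G z)) - 6 * K * (h * v) * (m h + h * v)"
    unfolding R_op_def z_def[symmetric] using i1 integrable_norm_mu[OF h0] by (simp add: m_def prob_space)
  moreover have "(\<integral>y. g (z + y + h *\<^sub>R b) \<partial>\<mu> h) = R h (\<lambda>z. g (z + h *\<^sub>R b)) x"
    unfolding R_op_def z_def ..
  moreover have "h * cost (norm b) \<le> h * cost v" using d(2) h0 by (rule mult_left_mono)
  ultimately show ?thesis using J_ge[OF h gb d(1), of x] unfolding z_def by (simp add: algebra_simps)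
qed

text \<open>Both operators are compared at the same speed \<open>W / h\<close>, so no optimiser has
  to be identified. Large \<open>N\<close> settles the long jumps, then small \<open>h\<close> the
  rest. \<open>\<delta>\<close> depends on \<open>\<Lambda>\<close>, \<open>K\<close> and
  \<open>\<epsilon>\<close> only, because the function changes from step to step when the operators
  are iterated.\<close>

lemma I_le_J_smooth:
  assumes \<Lambda>: "0 \<le> \<Lambda>" and K: "0 \<le> K" and \<epsilon>: "0 < \<epsilon>"
  obtains \<delta> where "0 < \<delta>" "\<delta> \<le> 1" "\<forall>h g G x. 0 < h \<longrightarrow> h \<le> \<delta> \<longrightarrow> blip \<Lambda> g \<longrightarrow> quadratic_remainder K G g \<longrightarrow>
    I h g x \<le> J h g x + h * \<epsilon>"
proof -
  define V where "V = vmax \<Lambda>"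
  have V: "0 \<le> V" using vmax(1)[OF \<Lambda>] by (simp add: V_def)
  \<comment> \<open>\<open>V + 1\<close> instead of \<open>V\<close>, since
    \<open>coupling_gain_le\<close> asks for a distance strictly below its speed bound times
    \<open>h\<close>.\<close>
  define c where "c = 2 * \<Lambda> * (V + 1) powr p"
  have c: "0 \<le> c" using \<Lambda> by (simp add: c_def)
  have "0 < \<epsilon> / (3 * (c + 1))" using \<epsilon> c by simp
  then obtain N where N: "1 \<le> N" "N powr (1 - p) \<le> \<epsilon> / (3 * (c + 1))" using powr_one_minus_small[OF p] by blast
  have cN: "2 * \<Lambda> * N powr (1 - p) * (V + 1) powr p \<le> \<epsilon> / 3"
  proof -
    have "c * N powr (1 - p) \<le> c * (\<epsilon> / (3 * (c + 1)))" using N c by (intro mult_left_mono)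
    also have "\<dots> \<le> \<epsilon> / 3" using c \<epsilon> by (simp add: field_simps)
    finally show ?thesis by (simp add: c_def mult_ac)
  qed
  define \<kappa> where "\<kappa> = \<epsilon> / (36 * (K * (N + V) + 1))"
  have KN: "0 \<le> K * (N + V)" using K N V by simp
  have \<kappa>: "0 < \<kappa>" "12 * (K * (N + V)) * \<kappa> \<le> \<epsilon> / 3"
    using \<epsilon> KN by (auto simp: \<kappa>_def field_simps)
  obtain d where d: "0 < d" "d \<le> 1" "\<And>t. 0 < t \<Longrightarrow> t \<le> d \<Longrightarrow> m t \<le> \<kappa>" using m_small[OF \<kappa>(1)] by blast
  define \<delta> where "\<delta> = min d (\<kappa> / (V + 1))"
  have main: "I h g x \<le> J h g x + h * \<epsilon>"
    if h: "0 < h" "h \<le> \<delta>" and g: "blip \<Lambda> g" and q: "quadratic_remainder K G g" for h g G x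
  proof (rule I_le[OF h(1) blip_bcontfun[OF g]])
    note h0 = less_imp_le[OF h(1)]
    have mh: "m h \<le> \<kappa>" using d(3) h by (simp add: \<delta>_def)
    have Vh: "(V + 1) * h \<le> \<kappa>"
    proof -
      have "h \<le> \<kappa> / (V + 1)" using h by (simp add: \<delta>_def)
      then show ?thesis using V by (simp add: pos_le_divide_eq mult.commute)
    qed
    fix \<nu> assume \<nu>: "\<nu> \<in> P_space p" and w: "wasserstein p (\<mu> h) \<nu> / h \<in> dom"
    define v where "v = wasserstein p (\<mu> h) \<nu> / h"
    have W: "wasserstein p (\<mu> h) \<nu> = v * h" using h(1) by (simp add: v_def)
    have vd: "v \<in> dom" using w by (simp add: v_def)
    note v0 = dom_nonneg[OF vd]
    show "(\<integral>z. g (\<psi> h x + z) \<partial>\<nu>) - h * cost (wasserstein p (\<mu> h) \<nu> / h) \<le> J h g x + h * \<epsilon>"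
    proof (cases "V < v")
      case True
      have "h * (\<Lambda> * v) \<le> h * cost v" using vmax(2)[OF \<Lambda> vd] True h0 by (intro mult_left_mono) (auto simp: V_def)
      moreover have "(\<integral>z. g (\<psi> h x + z) \<partial>\<nu>) \<le> R h g x + \<Lambda> * (v * h)"
        unfolding R_op_def W[symmetric] by (rule integral_diff_le_wasserstein[OF p mu[OF h0] \<nu> g])
      moreover have "0 \<le> h * \<epsilon>" using h0 \<epsilon> by simp
      ultimately show ?thesis
        using R_le_J[OF h(1) blip_bcontfun[OF g], of x] unfolding v_def[symmetric] by (simp add: algebra_simps)
    next
      case False
      define X where "X = h * (6 * K * N * (m h + (V + 1) * h) + 2 * \<Lambda> * N powr (1 - p) * (V + 1) powr p)"
      define Y where "Y = h * (6 * K * v * (m h + v * h))"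
      have "v * h < (V + 1) * h" using False h by (intro mult_strict_right_mono) auto
      then have up: "(\<integral>z. g (\<psi> h x + z) \<partial>\<nu>) \<le> R h g x + norm (G (\<psi> h x)) * (v * h) + X"
        using coupling_gain_le[OF h(1) \<nu> g q _ N(1), of "V + 1" "\<psi> h x"] unfolding W R_op_def X_def by blast
      have low: "R h g x + h * (v * norm (G (\<psi> h x)) - cost v) - Y \<le> J h g x"
        unfolding Y_def by (rule J_ge_gradient[OF h(1) g q vd])
      have "v * h \<le> (V + 1) * h" using False h0 by (intro mult_right_mono) auto
      then have mV: "m h + v * h \<le> 2 * \<kappa>" "m h + (V + 1) * h \<le> 2 * \<kappa>" using mh Vh by auto
      have "K * v \<le> K * V" using False K by (intro mult_left_mono) auto
      then have "6 * K * v * (m h + v * h) \<le> 6 * K * V * (2 * \<kappa>)"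
        using mV(1) K v0 V m_nonneg[of h] h0 by (intro mult_mono[of "6 * K * v"]) auto
      moreover have "6 * K * N * (m h + (V + 1) * h) \<le> 6 * K * N * (2 * \<kappa>)"
        using mV(2) K N by (intro mult_left_mono) auto
      ultimately have "6 * K * N * (m h + (V + 1) * h) + 2 * \<Lambda> * N powr (1 - p) * (V + 1) powr p + 6 * K * v * (m h + v * h)
          \<le> 12 * (K * (N + V)) * \<kappa> + \<epsilon> / 3" using cN by (simp add: algebra_simps)
      also have "\<dots> \<le> \<epsilon>" using \<kappa>(2) \<epsilon> by linarith
      finally have "X + Y \<le> h * \<epsilon>" unfolding X_def Y_def distrib_left[symmetric] using h0 by (rule mult_left_mono)
      then show ?thesis using up low unfolding v_def[symmetric] by (simp add: algebra_simps)
    qed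
  qed
  have "0 < \<delta>" "\<delta> \<le> 1" using d \<kappa> V by (auto simp: \<delta>_def)
  then show ?thesis using that main by blast
qed

text \<open>A convex operator commuting with translations up to small errors is dominated on convolutions by the
  convolution of its values.\<close>

lemma J_mollify:
  assumes h: "0 < h" "h \<le> 1" and u: "blip \<Lambda> u" and \<rho>: "is_mollifier \<epsilon> \<rho>"
  shows "J h (mollify \<rho> u) x \<le> mollify \<rho> (J h u) x + \<Lambda> * L * h * \<epsilon>"
proof (rule J_le[OF h(1) blip_bcontfun[OF blip_mollify[OF \<rho> u]]])
  note h0 = less_imp_le[OF h(1)]
  note l0 = blip_nonneg[OF u]
  note ub = blip_bcontfun[OF u]
  fix b :: 'a assume b: "norm b \<in> dom"
  interpret a: prob_space "\<mu> h" by (rule prob[OF h0])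
  interpret r: prob_space \<rho> by (rule is_mollifierD(1)[OF \<rho>])
  interpret pair_prob_space "\<mu> h" \<rho> ..
  define c where "c = \<psi> h x + h *\<^sub>R b"
  have s: "sets (\<mu> h \<Otimes>\<^sub>M \<rho>) = sets borel"
    using sets_pair_measure_cong[OF sets_mu[OF h0] is_mollifierD(2)[OF \<rho>]] by (metis borel_prod)
  have "(\<lambda>q. c + fst q + snd q) \<in> borel_measurable (\<mu> h \<Otimes>\<^sub>M \<rho>)"
    unfolding measurable_cong_sets[OF s refl] by (intro borel_measurable_continuous_onI continuous_intros)
  then have int: "integrable (\<mu> h \<Otimes>\<^sub>M \<rho>) (\<lambda>q. u (c + fst q + snd q))"
    by (rule integrable_bcontfun_compose[OF finite_measure_axioms ub])
  have inner: "(\<integral>y'. u (c + y' + y) \<partial>\<mu> h) = R h (\<lambda>z. u (z + h *\<^sub>R b + y)) x" for y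
    unfolding R_op_def c_def by (simp add: algebra_simps)
  note Jb = adm_bcontfun[OF adm_J[OF h(1)] ub]
  have "R h (\<lambda>z. mollify \<rho> u (z + h *\<^sub>R b)) x = (\<integral>y'. (\<integral>y. u (c + y' + y) \<partial>\<rho>) \<partial>\<mu> h)"
    unfolding R_op_def mollify_def c_def by (simp add: algebra_simps)
  \<comment> \<open>For a fixed drift the averages over \<open>\<rho>\<close> and
    \<open>\<mu> h\<close> commute; choosing the best drift separately for each \<open>y\<close> can
    only increase the value.\<close>
  also have "\<dots> = (\<integral>y. (\<integral>y'. u (c + y' + y) \<partial>\<mu> h) \<partial>\<rho>)"
    by (rule Fubini_integral[symmetric]) (use int in \<open>simp add: case_prod_beta'\<close>)
  also have "\<dots> \<le> (\<integral>y. J h u (x + y) + (h * cost (norm b) + \<Lambda> * L * h * \<epsilon>) \<partial>\<rho>)"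
  proof (rule integral_mono_AE)
    show "integrable \<rho> (\<lambda>y. \<integral>y'. u (c + y' + y) \<partial>\<mu> h)"
      using integrable_snd[of "\<lambda>y' y. u (c + y' + y)"] int by (simp add: case_prod_beta')
    show "integrable \<rho> (\<lambda>y. J h u (x + y) + (h * cost (norm b) + \<Lambda> * L * h * \<epsilon>))"
      using integrable_mollify[OF \<rho> Jb] by simp
    show "AE y in \<rho>. (\<integral>y'. u (c + y' + y) \<partial>\<mu> h) \<le> J h u (x + y) + (h * cost (norm b) + \<Lambda> * L * h * \<epsilon>)"
      using is_mollifierD(3)[OF \<rho>]
    proof eventually_elim
      case (elim y)
      have "R h (\<lambda>z. u (z + h *\<^sub>R b + y)) x \<le> R h (\<lambda>z. u (z + h *\<^sub>R b)) (x + y) + \<Lambda> * L * h * norm y"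
        using R_commutator[OF h0 h(2) blip_shift[OF u, of "h *\<^sub>R b"], of y x] by (simp add: algebra_simps)
      also have "\<Lambda> * L * h * norm y \<le> \<Lambda> * L * h * \<epsilon>"
        using elim l0 L_nonneg h0 by (intro mult_left_mono) auto
      finally show ?case unfolding inner using J_ge[OF h(1) ub b, of "x + y"] by linarith
    qed
  qed
  also have "\<dots> = mollify \<rho> (J h u) x + (h * cost (norm b) + \<Lambda> * L * h * \<epsilon>)"
    using integrable_mollify[OF \<rho> Jb] by (simp add: mollify_def r.prob_space)
  finally show "R h (\<lambda>z. mollify \<rho> u (z + h *\<^sub>R b)) x - h * cost (norm b) \<le> mollify \<rho> (J h u) x + \<Lambda> * L * h * \<epsilon>"
    by linarith
qed

section \<open>Comparison of the iterates\<close>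

lemma J_power_le_I_power:
  assumes h: "0 < h" and f: "f \<in> bcontfun"
  shows "(J h ^^ k) f x \<le> (I h ^^ k) f x"
proof (induction k arbitrary: x)
  case (Suc k)
  note Ib = adm_bcontfun[OF adm_power[OF adm_I[OF h], of k] f]
  have "J h ((J h ^^ k) f) x \<le> J h ((I h ^^ k) f) x"
    by (rule adm_mono[OF adm_J[OF h] J_power_bcontfun[OF h f] Ib Suc])
  also have "\<dots> \<le> I h ((I h ^^ k) f) x" by (rule J_le_I[OF h Ib])
  finally show ?case by simp
qed simp

lemma I_power_le_J_power:
  assumes \<Lambda>: "0 \<le> \<Lambda>" and T0: "0 \<le> T0" and \<epsilon>: "0 < \<epsilon>"
  obtains \<delta> where "0 < \<delta>" "\<forall>h k f x. 0 < h \<longrightarrow> h \<le> \<delta> \<longrightarrow> real k * h \<le> T0 \<longrightarrow> blip \<Lambda> f \<longrightarrow> (\<forall>x. \<bar>f x\<bar> \<le> r) \<longrightarrow>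
    (I h ^^ k) f x \<le> (J h ^^ k) f x + \<epsilon>"
proof -
  define \<Lambda>' where "\<Lambda>' = exp (L * T0) * \<Lambda>"
  have ll: "\<Lambda> \<le> \<Lambda>'" unfolding \<Lambda>'_def using mult_right_mono[OF exp_L_ge_1[OF T0] \<Lambda>] by simp
  then have l': "0 \<le> \<Lambda>'" using \<Lambda> by linarith
  \<comment> \<open>\<open>2 * \<Lambda>'\<close> pays for mollifying at the start and undoing it at
    the end, \<open>T0 * \<Lambda>' * L\<close> for pulling the mollifier out of every step.\<close>
  define D where "D = 2 * \<Lambda>' + T0 * \<Lambda>' * L"
  have D: "0 \<le> D" using l' T0 L_nonneg by (simp add: D_def)
  define \<eta> where "\<eta> = \<epsilon> / (2 * (D + 1))"
  have \<eta>: "0 < \<eta>" "D * \<eta> \<le> \<epsilon> / 2" using \<epsilon> D by (auto simp: \<eta>_def field_simps)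
  obtain \<rho> :: "'a measure" where \<rho>: "is_mollifier \<eta> \<rho>"
    "\<And>r \<Lambda>. \<exists>K. \<forall>u. blip \<Lambda> u \<longrightarrow> (\<forall>x. \<bar>u x\<bar> \<le> r) \<longrightarrow> (\<exists>G. quadratic_remainder K G (mollify \<rho> u))"
    using mollifier_exists[OF \<eta>(1)] by blast
  obtain K0 where K0: "\<forall>u. blip \<Lambda>' u \<longrightarrow> (\<forall>x. \<bar>u x\<bar> \<le> r) \<longrightarrow> (\<exists>G. quadratic_remainder K0 G (mollify \<rho> u))"
    using \<rho>(2) by blast
  \<comment> \<open>\<open>K0\<close> may be negative when no function qualifies, whereas
    \<open>I_le_J_smooth\<close> asks for a nonnegative constant.\<close>
  define K where "K = \<bar>K0\<bar>"
  have K: "\<exists>G. quadratic_remainder K G (mollify \<rho> u)" if u: "blip \<Lambda>' u" "\<forall>x. \<bar>u x\<bar> \<le> r" for u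
  proof -
    obtain G where G: "quadratic_remainder K0 G (mollify \<rho> u)" using K0 u by blast
    moreover have "K = K0" using quadratic_remainderD(2)[OF G] by (simp add: K_def)
    ultimately show ?thesis by blast
  qed
  define \<epsilon>' where "\<epsilon>' = \<epsilon> / (2 * (T0 + 1))"
  have \<epsilon>': "0 < \<epsilon>'" "T0 * \<epsilon>' \<le> \<epsilon> / 2" using \<epsilon> T0 by (auto simp: \<epsilon>'_def field_simps)
  have K0': "0 \<le> K" by (simp add: K_def)
  obtain \<delta> where \<delta>: "0 < \<delta>" "\<delta> \<le> 1" "\<forall>h g G x. 0 < h \<longrightarrow> h \<le> \<delta> \<longrightarrow> blip \<Lambda>' g \<longrightarrow> quadratic_remainder K G g \<longrightarrow>
    I h g x \<le> J h g x + h * \<epsilon>'" using I_le_J_smooth[OF l' K0' \<epsilon>'(1)] .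
  have "(I h ^^ k) f x \<le> (J h ^^ k) f x + \<epsilon>"
    if h: "0 < h" "h \<le> \<delta>" and kT: "real k * h \<le> T0" and f: "blip \<Lambda> f" and r: "\<forall>x. \<bar>f x\<bar> \<le> r" for h k f x
  proof -
    note h0 = less_imp_le[OF h(1)]
    have h1: "h \<le> 1" using h \<delta> by linarith
    note fb = blip_bcontfun[OF f]
    define \<kappa> where "\<kappa> = \<Lambda>' * L * \<eta> + \<epsilon>'"
    have \<kappa>: "0 \<le> \<kappa>" using l' L_nonneg \<eta> \<epsilon>' by (simp add: \<kappa>_def)
    note mf = blip_mollify[OF \<rho>(1) f]
    have u: "blip \<Lambda>' ((J h ^^ j) f)" if "real j * h \<le> T0" for j
      unfolding \<Lambda>'_def by (rule adm_blip_upto[OF adm_power[OF adm_J[OF h(1)]] that f])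
    have step: "(I h ^^ j) (mollify \<rho> f) x \<le> mollify \<rho> ((J h ^^ j) f) x + real j * h * \<kappa>" if "real j * h \<le> T0" for j x
      using that
    proof (induction j arbitrary: x)
      case 0
      then show ?case by simp
    next
      case (Suc j)
      have jT: "real j * h \<le> T0" using Suc.prems h0 by (simp add: distrib_right)
      define w where "w = (J h ^^ j) f"
      have w: "blip \<Lambda>' w" unfolding w_def by (rule u[OF jT])
      have wr: "\<forall>x. \<bar>w x\<bar> \<le> r" unfolding w_def using adm_abs_le[OF adm_power[OF adm_J[OF h(1)]] fb] r by blast
      obtain G where G: "quadratic_remainder K G (mollify \<rho> w)" using K[OF w wr] by blast
      note mw = blip_mollify[OF \<rho>(1) w]
      have "(I h ^^ Suc j) (mollify \<rho> f) x \<le> I h (\<lambda>y. mollify \<rho> w y + real j * h * \<kappa>) x"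
        using adm_mono[OF adm_I[OF h(1)] adm_bcontfun[OF adm_power[OF adm_I[OF h(1)], of j] blip_bcontfun[OF mf]]
          bcontfun_add_const[OF blip_bcontfun[OF mw]] Suc.IH[OF jT, folded w_def], of x] by simp
      also have "\<dots> = I h (mollify \<rho> w) x + real j * h * \<kappa>"
        by (rule adm_add_const[OF adm_I[OF h(1)] blip_bcontfun[OF mw]])
      also have "I h (mollify \<rho> w) x \<le> J h (mollify \<rho> w) x + h * \<epsilon>'" using \<delta>(3) h mw G by blast
      also have "J h (mollify \<rho> w) x \<le> mollify \<rho> (J h w) x + \<Lambda>' * L * h * \<eta>" by (rule J_mollify[OF h(1) h1 w \<rho>(1)])
      finally show ?case by (simp add: w_def \<kappa>_def algebra_simps)
    qed
    note aI = adm_power[OF adm_I[OF h(1)], of k]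
    have "(I h ^^ k) f x \<le> (I h ^^ k) (\<lambda>y. mollify \<rho> f y + \<Lambda> * \<eta>) x"
    proof (rule adm_mono[OF aI fb bcontfun_add_const[OF blip_bcontfun[OF mf]]])
      show "f y \<le> mollify \<rho> f y + \<Lambda> * \<eta>" for y using mollify_approx[OF \<rho>(1) f, of y] by linarith
    qed
    also have "\<dots> = (I h ^^ k) (mollify \<rho> f) x + \<Lambda> * \<eta>" by (rule adm_add_const[OF aI blip_bcontfun[OF mf]])
    also have "(I h ^^ k) (mollify \<rho> f) x \<le> mollify \<rho> ((J h ^^ k) f) x + real k * h * \<kappa>" by (rule step[OF kT])
    also have "mollify \<rho> ((J h ^^ k) f) x \<le> (J h ^^ k) f x + \<Lambda>' * \<eta>"
      using mollify_approx[OF \<rho>(1) u[OF kT], of x] by linarith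
    finally have 1: "(I h ^^ k) f x \<le> (J h ^^ k) f x + (\<Lambda> * \<eta> + \<Lambda>' * \<eta> + real k * h * \<kappa>)" by simp
    have "real k * h * \<kappa> \<le> T0 * \<kappa>" using kT \<kappa> by (rule mult_right_mono)
    moreover have "\<Lambda> * \<eta> \<le> \<Lambda>' * \<eta>" using ll \<eta> by (intro mult_right_mono) auto
    moreover have "2 * (\<Lambda>' * \<eta>) + T0 * \<kappa> = D * \<eta> + T0 * \<epsilon>'" by (simp add: \<kappa>_def D_def algebra_simps)
    ultimately show ?thesis using 1 \<eta>(2) \<epsilon>'(2) by linarith
  qed
  then show ?thesis using that \<delta>(1) by blast
qed

section \<open>The generator\<close>

text \<open>Chain rule for Lipschitz constants: \<open>6 * K\<close> for the gradient times the
  slope \<open>vmax \<Lambda>\<close> of the conjugate on the range of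
  \<open>norm (G x)\<close>.\<close>

lemma blip_conjugate_gradient:
  assumes f: "blip \<Lambda> f" and q: "quadratic_remainder K G f"
  shows "blip (6 * K * vmax \<Lambda>) (\<lambda>x. \<Phi> (norm (G x)))"
proof (rule blipI)
  note l0 = blip_nonneg[OF f]
  have K: "0 \<le> K" using q by (rule quadratic_remainderD)
  note G = quadratic_remainder_norm_le[OF q f]
  show "0 \<le> 6 * K * vmax \<Lambda>" using K vmax(1)[OF l0] by simp
  show "\<bar>\<Phi> (norm (G x))\<bar> \<le> \<Phi> \<Lambda>" for x
    using conjugate_nonneg[OF norm_ge_zero, of "G x"] conjugate_mono[OF norm_ge_zero G] by simp
  fix x y
  have "\<bar>norm (G x) - norm (G y)\<bar> \<le> 6 * K * norm (x - y)"
    using norm_triangle_ineq3[of "G x" "G y"] quadratic_remainder_lipschitz[OF q, of x y] by linarith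
  then have "vmax \<Lambda> * \<bar>norm (G x) - norm (G y)\<bar> \<le> vmax \<Lambda> * (6 * K * norm (x - y))"
    using vmax(1)[OF l0] by (rule mult_left_mono)
  then show "\<Phi> (norm (G x)) - \<Phi> (norm (G y)) \<le> 6 * K * vmax \<Lambda> * norm (x - y)"
    using conjugate_lipschitz[OF norm_ge_zero G norm_ge_zero, of x "G y"] by (simp add: mult_ac)
qed

text \<open>The functions \<open>R s (f + s \<gamma>)\<close> are almost supersolutions: by
  Fenchel's inequality a step of length \<open>h\<close> gains at most \<open>h \<gamma>\<close>, up
  to \<open>C h (h + s)\<close>. Since \<open>C s^2 + C h (h + s) \<le> C (h + s)^2\<close>, the
  error stays below \<open>C\<close> times the squared elapsed time, whatever \<open>h\<close>. The
  correction sits inside \<open>R s\<close> so that consecutive steps fuse by the semigroup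
  law.\<close>

lemma J_power_upper:
  assumes f: "blip \<Lambda> f" and q: "quadratic_remainder K G f"
  defines "\<gamma> \<equiv> (\<lambda>x. \<Phi> (norm (G x)))"
  obtains C where "0 \<le> C" "\<And>h k x. 0 < h \<Longrightarrow> real k * h \<le> 1 \<Longrightarrow>
    (J h ^^ k) f x \<le> R (real k * h) (\<lambda>z. f z + (real k * h) * \<gamma> z) x + C * (real k * h)\<^sup>2"
proof -
  note fb = blip_bcontfun[OF f]
  note l0 = blip_nonneg[OF f]
  have K: "0 \<le> K" using q by (rule quadratic_remainderD)
  define \<Lambda>\<gamma> where "\<Lambda>\<gamma> = 6 * K * vmax \<Lambda>"
  have \<gamma>: "blip \<Lambda>\<gamma> \<gamma>" unfolding \<gamma>_def \<Lambda>\<gamma>_def by (rule blip_conjugate_gradient[OF f q])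
  note lg0 = blip_nonneg[OF \<gamma>]
  have \<gamma>0: "0 \<le> \<gamma> x" for x unfolding \<gamma>_def by (rule conjugate_nonneg) simp
  define \<Lambda>1 where "\<Lambda>1 = \<Lambda> + \<Lambda>\<gamma>"
  have l1: "0 \<le> \<Lambda>1" using l0 lg0 by (simp add: \<Lambda>1_def)
  define \<Lambda>2 where "\<Lambda>2 = exp (L * 1) * \<Lambda>1"
  have l2: "0 \<le> \<Lambda>2" using l1 by (simp add: \<Lambda>2_def)
  define V where "V = vmax \<Lambda>2"
  have V: "0 \<le> V" using vmax(1)[OF l2] by (simp add: V_def)
  \<comment> \<open>In order: quadratic remainder of \<open>f\<close>, variation of
    \<open>\<gamma>\<close> along the drift, commutator of the drift with
    \<open>R s\<close>.\<close>
  define C where "C = K * V\<^sup>2 + \<Lambda>\<gamma> * V + \<Lambda>1 * L * V"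
  have C: "0 \<le> C" using K V lg0 l1 L_nonneg by (simp add: C_def)
  have F: "blip \<Lambda>1 (\<lambda>z. f z + s * \<gamma> z)" if "0 \<le> s" "s \<le> 1" for s
    unfolding \<Lambda>1_def using that lg0 by (intro blip_mono[OF blip_add[OF f blip_cmult[OF _ \<gamma>]]]) (auto intro: mult_left_le_one_le)
  have step: "J h (R s (\<lambda>z. f z + s * \<gamma> z)) x \<le> R (h + s) (\<lambda>z. f z + (h + s) * \<gamma> z) x + C * h * (h + s)"
    if h: "0 < h" and s: "0 \<le> s" "h + s \<le> 1" for h s x
  proof -
    note h0 = less_imp_le[OF h]
    have s1: "s \<le> 1" "0 \<le> h + s" using s h by auto
    define fs where "fs z = f z + s * \<gamma> z" for z
    define fhs where "fhs z = f z + (h + s) * \<gamma> z" for z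
    have fs: "blip \<Lambda>1 fs" unfolding fs_def by (rule F[OF s(1) s1(1)])
    have fhs: "blip \<Lambda>1 fhs" unfolding fhs_def by (rule F[OF s1(2) s(2)])
    note fsb = blip_bcontfun[OF fs] and fhsb = blip_bcontfun[OF fhs]
    have Rs: "blip \<Lambda>2 (R s fs)" unfolding \<Lambda>2_def by (rule adm_blip_upto[OF adm_R[OF s(1)] s1(1) fs])
    note Rsb = blip_bcontfun[OF Rs]
    have Rle: "R h (R s fs) y \<le> R (h + s) fhs y" for y
    proof -
      have "R (h + s) fs y \<le> R (h + s) fhs y"
        by (rule R_mono[OF s1(2) fsb fhsb]) (use \<gamma>0 h0 in \<open>auto simp: fs_def fhs_def distrib_right\<close>)
      then show ?thesis using R_add_time[OF h0 s(1) fsb] by simp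
    qed
    have CC: "0 \<le> C * h * (h + s)" using C h0 s by simp
    have "J h (R s fs) x \<le> R (h + s) fhs x + C * h * (h + s)"
    proof (rule J_le[OF h Rsb])
      fix b :: 'a assume b: "norm b \<in> dom"
      show "R h (\<lambda>z. R s fs (z + h *\<^sub>R b)) x - h * cost (norm b) \<le> R (h + s) fhs x + C * h * (h + s)"
      proof (cases "V < norm b")
        case True
        have "h * (\<Lambda>2 * norm b) \<le> h * cost (norm b)"
          using vmax(2)[OF l2 b] True h0 by (intro mult_left_mono) (auto simp: V_def)
        moreover have "R h (\<lambda>z. R s fs (z + h *\<^sub>R b)) x \<le> R h (R s fs) x + h * (\<Lambda>2 * norm b)"
          using R_shift_bound[OF h0 Rs, of "h *\<^sub>R b" x] h by (simp add: algebra_simps)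
        ultimately show ?thesis using Rle[of x] CC by linarith
      next
        case False
        then have bV: "norm b \<le> V" by simp
        define c where "c = h * cost (norm b) + C * h * (h + s)"
        define c1 where "c1 = h * cost (norm b) + K * V\<^sup>2 * h\<^sup>2 + s * \<Lambda>\<gamma> * (h * V)"
        have c1: "c1 + \<Lambda>1 * L * s * (h * V) \<le> c"
        proof -
          have "0 \<le> K * V\<^sup>2 * (h * s)" "0 \<le> (\<Lambda>\<gamma> * V + \<Lambda>1 * L * V) * h\<^sup>2" using K V lg0 l1 L_nonneg h0 s by auto
          then show ?thesis by (simp add: c_def c1_def C_def algebra_simps power2_eq_square)
        qed
        have pt: "fs (y + h *\<^sub>R b) \<le> fhs y + c1" for y
        proof -
          have n: "norm (h *\<^sub>R b) = h * norm b" "h * norm b \<le> h * V" using h bV by auto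
          have "f (y + h *\<^sub>R b) \<le> f y + G y \<bullet> (h *\<^sub>R b) + K * (h * norm b)\<^sup>2"
            using quadratic_remainderD(1)[OF q, of y "h *\<^sub>R b"] unfolding n(1) by linarith
          moreover have "K * (h * norm b)\<^sup>2 \<le> K * V\<^sup>2 * h\<^sup>2"
          proof -
            have "(h * norm b)\<^sup>2 \<le> (h * V)\<^sup>2" using n h0 by (intro power_mono) auto
            then have "K * (h * norm b)\<^sup>2 \<le> K * (h * V)\<^sup>2" using K by (rule mult_left_mono)
            then show ?thesis by (simp add: power_mult_distrib mult_ac)
          qed
          moreover have "G y \<bullet> (h *\<^sub>R b) \<le> h * \<gamma> y + h * cost (norm b)"
          proof -
            have "G y \<bullet> b \<le> norm b * norm (G y)" using norm_cauchy_schwarz[of "G y" b] by (simp add: mult.commute)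
            also have "\<dots> \<le> \<gamma> y + cost (norm b)" using conjugate_ge[OF norm_ge_zero b, of "G y"] by (simp add: \<gamma>_def)
            finally have "h * (G y \<bullet> b) \<le> h * (\<gamma> y + cost (norm b))" using h0 by (rule mult_left_mono)
            then show ?thesis by (simp add: distrib_left)
          qed
          moreover have "s * \<gamma> (y + h *\<^sub>R b) \<le> s * \<gamma> y + s * \<Lambda>\<gamma> * (h * V)"
          proof -
            have "\<gamma> (y + h *\<^sub>R b) \<le> \<gamma> y + \<Lambda>\<gamma> * (h * norm b)" using blip_add_diff(1)[OF \<gamma>, of y "h *\<^sub>R b"] unfolding n(1) by linarith
            also have "\<dots> \<le> \<gamma> y + \<Lambda>\<gamma> * (h * V)" using n(2) lg0 by (rule add_left_mono[OF mult_left_mono])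
            finally have "s * \<gamma> (y + h *\<^sub>R b) \<le> s * (\<gamma> y + \<Lambda>\<gamma> * (h * V))" using s(1) by (rule mult_left_mono)
            then show ?thesis by (simp add: distrib_left mult.assoc)
          qed
          ultimately show ?thesis unfolding fs_def fhs_def c1_def by (simp add: distrib_right)
        qed
        have "R s fs (z + h *\<^sub>R b) \<le> R s fhs z + c" for z
        proof -
          have "R s fs (z + h *\<^sub>R b) \<le> R s (\<lambda>y. fs (y + h *\<^sub>R b)) z + \<Lambda>1 * L * s * (h * norm b)"
            using R_commutator[OF s(1) s1(1) fs, of "h *\<^sub>R b" z] h by (simp add: abs_le_iff)
          also have "\<Lambda>1 * L * s * (h * norm b) \<le> \<Lambda>1 * L * s * (h * V)"
            using bV l1 L_nonneg s(1) h0 by (intro mult_left_mono) auto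
          also have "R s (\<lambda>y. fs (y + h *\<^sub>R b)) z \<le> R s (\<lambda>y. fhs y + c1) z"
            by (rule R_mono[OF s(1) bcontfun_shift[OF fsb] bcontfun_add_const[OF fhsb] pt])
          also have "\<dots> = R s fhs z + c1" by (rule R_add_const[OF s(1) fhsb])
          finally show ?thesis using c1 by linarith
        qed
        then have "R h (\<lambda>z. R s fs (z + h *\<^sub>R b)) x \<le> R h (\<lambda>z. R s fhs z + c) x"
          by (intro R_mono h0 bcontfun_shift bcontfun_add_const Rsb R_bcontfun s(1) fhsb)
        also have "\<dots> = R (h + s) fhs x + c"
          using R_add_const[OF h0 R_bcontfun[OF s(1) fhsb]] R_add_time[OF h0 s(1) fhsb] by simp
        finally show ?thesis by (simp add: c_def)
      qed
    qed
    then show ?thesis unfolding fs_def[abs_def] fhs_def[abs_def] .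
  qed
  have "(J h ^^ k) f x \<le> R (real k * h) (\<lambda>z. f z + (real k * h) * \<gamma> z) x + C * (real k * h)\<^sup>2"
    if h: "0 < h" and k: "real k * h \<le> 1" for h k x
    using k
  proof (induction k arbitrary: x)
    case 0
    then show ?case using R_0[OF fb] by simp
  next
    case (Suc k)
    define s where "s = real k * h"
    have s: "0 \<le> s" "h + s \<le> 1" "s \<le> 1" using h Suc.prems by (auto simp: s_def distrib_right)
    have sk: "real (Suc k) * h = h + s" by (simp add: s_def distrib_right)
    note Rb = R_bcontfun[OF s(1) blip_bcontfun[OF F[OF s(1,3)]]]
    have "(J h ^^ Suc k) f x \<le> J h (\<lambda>y. R s (\<lambda>z. f z + s * \<gamma> z) y + C * s\<^sup>2) x"
      using adm_mono[OF adm_J[OF h] J_power_bcontfun[OF h fb] bcontfun_add_const[OF Rb] Suc.IH[folded s_def, OF s(3)], of x]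
      by simp
    also have "\<dots> = J h (R s (\<lambda>z. f z + s * \<gamma> z)) x + C * s\<^sup>2" by (rule adm_add_const[OF adm_J[OF h] Rb])
    also have "\<dots> \<le> R (h + s) (\<lambda>z. f z + (h + s) * \<gamma> z) x + C * h * (h + s) + C * s\<^sup>2"
      using step[OF h s(1,2), of x] by simp
    also have "\<dots> \<le> R (h + s) (\<lambda>z. f z + (h + s) * \<gamma> z) x + C * (h + s)\<^sup>2"
    proof -
      have "0 \<le> C * (h * s)" using C h s by simp
      then show ?thesis by (simp add: power2_eq_square algebra_simps)
    qed
    finally show ?case unfolding sk .
  qed
  then show ?thesis using that C by blast
qed

text \<open>The drift \<open>v sgn (G x)\<close> is followed over the whole interval. The gradient
  is frozen at the starting point, so the error carries the displacements by flow, noise and drift.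
  Optimising over \<open>v\<close> comes last and produces the conjugate.\<close>

lemma J_power_lower:
  assumes f: "blip \<Lambda> f" and q: "quadratic_remainder K G f" and h: "0 < h" and s: "s = real k * h" "0 < s" "s \<le> 1"
  shows "R s f x + s * \<Phi> (norm (G x))
    - s * (6 * K * vmax \<Lambda> * (L * s * norm x + m s + s * vmax \<Lambda>) + \<Lambda> * L * vmax \<Lambda> * s) \<le> (J h ^^ k) f x"
proof -
  note fb = blip_bcontfun[OF f]
  note l0 = blip_nonneg[OF f]
  have K: "0 \<le> K" using q by (rule quadratic_remainderD)
  note s0 = less_imp_le[OF s(2)]
  interpret prob_space "\<mu> s" by (rule prob[OF s0])
  define V where "V = vmax \<Lambda>"
  have V: "0 \<le> V" using vmax(1)[OF l0] by (simp add: V_def)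
  define E where "E = 6 * K * V * (L * s * norm x + m s + s * V) + \<Lambda> * L * V * s"
  have E: "0 \<le> E" using K V L_nonneg s0 l0 m_nonneg[of s] by (simp add: E_def)
  have JR: "R s f x \<le> (J h ^^ k) f x" unfolding s(1) by (rule adm_ge_R[OF adm_power[OF adm_J[OF h]] f])
  have main: "s * (v * norm (G x) - cost v) \<le> (J h ^^ k) f x - R s f x + s * E" if v: "v \<in> dom" for v
  proof (cases "V < v")
    case True
    have "v * norm (G x) \<le> v * \<Lambda>"
      using quadratic_remainder_norm_le[OF q f, of x] dom_nonneg[OF v] by (rule mult_left_mono)
    then have "v * norm (G x) - cost v \<le> 0" using vmax(2)[OF l0 v] True by (simp add: V_def mult.commute)
    then have "s * (v * norm (G x) - cost v) \<le> 0" using s0 by (simp add: mult_nonneg_nonpos)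
    moreover have "0 \<le> s * E" using s0 E by simp
    ultimately show ?thesis using JR by linarith
  next
    case False
    note v0 = dom_nonneg[OF v]
    define b where "b = v *\<^sub>R sgn (G x)"
    have nb: "norm b \<le> v" using v0 by (simp add: b_def norm_sgn)
    then have nbV: "norm b \<le> V" using False by simp
    note d = dom_mono[OF v norm_ge_zero nb]
    have Gb: "G x \<bullet> (s *\<^sub>R b) = s * (v * norm (G x))"
      by (cases "G x = 0") (auto simp: b_def sgn_div_norm power2_norm_eq_inner[symmetric] power2_eq_square)
    have nsb: "norm (s *\<^sub>R b) \<le> s * V" using nbV s0 by (simp add: mult_left_mono)
    define X where "X = L * s * norm x"
    have pt: "f (\<psi> s x + y) + (s * (v * norm (G x)) - 6 * K * (s * V) * (X + norm y + s * V)) \<le> f (\<psi> s x + y + s *\<^sub>R b)" for y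
    proof -
      define u where "u = \<psi> s x + y - x"
      have eq: "x + u = \<psi> s x + y" by (simp add: u_def)
      have "norm u \<le> X + norm y"
        using norm_triangle_ineq[of "\<psi> s x - x" y] psi_minus_id[OF s0 s(3), of x] by (simp add: u_def X_def algebra_simps)
      then have "6 * K * norm (s *\<^sub>R b) * (norm u + norm (s *\<^sub>R b)) \<le> 6 * K * (s * V) * (X + norm y + s * V)"
        using nsb K s0 V by (intro mult_mono mult_left_mono add_mono) auto
      then show ?thesis using quadratic_remainder_increment[OF q, of x u "s *\<^sub>R b"] Gb unfolding eq by linarith
    qed
    have i1: "integrable (\<mu> s) (\<lambda>y. f (\<psi> s x + y))" by (rule integrable_R[OF s0 fb])
    have i2: "integrable (\<mu> s) (\<lambda>y. f (\<psi> s x + y + s *\<^sub>R b))"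
      using integrable_R[OF s0 bcontfun_shift[OF fb, of "s *\<^sub>R b"], of "\<psi> s x"] .
    have "(\<integral>y. f (\<psi> s x + y) + (s * (v * norm (G x)) - 6 * K * (s * V) * (X + norm y + s * V)) \<partial>\<mu> s)
      \<le> (\<integral>y. f (\<psi> s x + y + s *\<^sub>R b) \<partial>\<mu> s)"
      using i1 i2 integrable_norm_mu[OF s0] by (intro integral_mono pt) auto
    moreover have "(\<integral>y. f (\<psi> s x + y) + (s * (v * norm (G x)) - 6 * K * (s * V) * (X + norm y + s * V)) \<partial>\<mu> s)
      = R s f x + s * (v * norm (G x)) - 6 * K * (s * V) * (X + m s + s * V)"
      unfolding R_op_def using i1 integrable_norm_mu[OF s0] by (simp add: m_def prob_space)
    ultimately have low: "R s f x + s * (v * norm (G x)) - 6 * K * (s * V) * (X + m s + s * V) \<le> R s (\<lambda>z. f (z + s *\<^sub>R b)) x"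
      unfolding R_op_def by simp
    have it: "R s (\<lambda>z. f (z + s *\<^sub>R b)) x - s * cost (norm b) - \<Lambda> * L * norm b * s\<^sup>2 \<le> (J h ^^ k) f x"
      using J_iterate_ge[OF h f d(1), of k x] s(1,3) by simp
    have "s * cost (norm b) \<le> s * cost v" using d(2) s0 by (rule mult_left_mono)
    moreover have "\<Lambda> * L * norm b * s\<^sup>2 \<le> \<Lambda> * L * V * s\<^sup>2"
      using nbV l0 L_nonneg by (intro mult_right_mono mult_left_mono) auto
    moreover have "s * E = 6 * K * (s * V) * (X + m s + s * V) + \<Lambda> * L * V * s\<^sup>2"
      by (simp add: E_def X_def power2_eq_square algebra_simps)
    ultimately show ?thesis using low it by (simp add: right_diff_distrib)
  qed
  have "\<Phi> (norm (G x)) \<le> ((J h ^^ k) f x - R s f x + s * E) / s"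
  proof (rule conjugate_le[OF norm_ge_zero])
    show "v * norm (G x) - cost v \<le> ((J h ^^ k) f x - R s f x + s * E) / s" if "v \<in> dom" for v
      using main[OF that] s(2) by (simp add: pos_le_divide_eq mult.commute)
  qed
  then have "s * \<Phi> (norm (G x)) \<le> (J h ^^ k) f x - R s f x + s * E"
    using s(2) by (simp add: pos_le_divide_eq mult.commute)
  then show ?thesis unfolding E_def V_def by linarith
qed

lemma J_power_expansion:
  assumes f: "blip \<Lambda> f" and q: "quadratic_remainder K G f"
  obtains C where "0 \<le> C" "\<And>h k s x. 0 < h \<Longrightarrow> s = real k * h \<Longrightarrow> 0 < s \<Longrightarrow> s \<le> 1 \<Longrightarrow>
    \<bar>(J h ^^ k) f x - R s f x - s * \<Phi> (norm (G x))\<bar> \<le> s * (C * (s + s * norm x + m s))"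
proof -
  note fb = blip_bcontfun[OF f]
  note l0 = blip_nonneg[OF f]
  have K: "0 \<le> K" using q by (rule quadratic_remainderD)
  define \<gamma> where "\<gamma> x = \<Phi> (norm (G x))" for x
  define \<Lambda>\<gamma> where "\<Lambda>\<gamma> = 6 * K * vmax \<Lambda>"
  have \<gamma>: "blip \<Lambda>\<gamma> \<gamma>" unfolding \<gamma>_def \<Lambda>\<gamma>_def by (rule blip_conjugate_gradient[OF f q])
  note \<gamma>b = blip_bcontfun[OF \<gamma>]
  obtain C1 where C1: "0 \<le> C1" "\<And>h k x. 0 < h \<Longrightarrow> real k * h \<le> 1 \<Longrightarrow>
    (J h ^^ k) f x \<le> R (real k * h) (\<lambda>z. f z + (real k * h) * \<gamma> z) x + C1 * (real k * h)\<^sup>2"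
    using J_power_upper[OF f q] unfolding \<gamma>_def by blast
  define V where "V = vmax \<Lambda>"
  have V: "0 \<le> V" using vmax(1)[OF l0] by (simp add: V_def)
  have lg: "\<Lambda>\<gamma> = 6 * K * V" by (simp add: \<Lambda>\<gamma>_def V_def)
  define C where "C = C1 + 6 * K * V * (L + 1) + 6 * K * V * V + \<Lambda> * L * V"
  have nn: "0 \<le> K * V" "0 \<le> \<Lambda> * L * V" "0 \<le> K * V * V" "0 \<le> K * V * L" using K V l0 L_nonneg by auto
  have C: "0 \<le> C" using C1(1) nn L_nonneg by (simp add: C_def)
  have "\<bar>(J h ^^ k) f x - R s f x - s * \<gamma> x\<bar> \<le> s * (C * (s + s * norm x + m s))"
    if h: "0 < h" and s: "s = real k * h" "0 < s" "s \<le> 1" for h k s x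
  proof -
    note s0 = less_imp_le[OF s(2)]
    have ms: "0 \<le> m s" by (rule m_nonneg)
    have sx: "0 \<le> s * norm x" using s0 by simp
    have up: "C1 * s + 6 * K * V * (L * s * norm x + m s) \<le> C * (s + s * norm x + m s)"
    proof -
      have "C * (s + s * norm x + m s) - (C1 * s + 6 * K * V * (L * s * norm x + m s))
        = C1 * (s * norm x + m s) + 6 * (K * V * L) * (s + m s) + 6 * (K * V) * (s + s * norm x)
          + (6 * (K * V * V) + \<Lambda> * L * V) * (s + s * norm x + m s)"
        by (simp add: C_def algebra_simps)
      also have "\<dots> \<ge> 0" using C1(1) K V l0 L_nonneg ms sx s0 by (intro add_nonneg_nonneg mult_nonneg_nonneg) auto
      finally show ?thesis by simp
    qed
    have low: "6 * K * V * (L * s * norm x + m s + s * V) + \<Lambda> * L * V * s \<le> C * (s + s * norm x + m s)"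
    proof -
      have "C * (s + s * norm x + m s) - (6 * K * V * (L * s * norm x + m s + s * V) + \<Lambda> * L * V * s)
        = C1 * (s + s * norm x + m s) + 6 * (K * V * L) * (s + m s) + 6 * (K * V) * (s + s * norm x)
          + (6 * (K * V * V) + \<Lambda> * L * V) * (s * norm x + m s)"
        by (simp add: C_def algebra_simps)
      also have "\<dots> \<ge> 0" using C1(1) K V l0 L_nonneg ms sx s0 by (intro add_nonneg_nonneg mult_nonneg_nonneg) auto
      finally show ?thesis by simp
    qed
    have "(J h ^^ k) f x \<le> R s (\<lambda>z. f z + s * \<gamma> z) x + C1 * s\<^sup>2" using C1(2)[OF h, of k x] s by simp
    also have "R s (\<lambda>z. f z + s * \<gamma> z) x = R s f x + s * R s \<gamma> x"
      using R_add[OF s0 fb bcontfun_mult_left[OF \<gamma>b]] by (simp add: R_cmult)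
    finally have "(J h ^^ k) f x \<le> R s f x + s * R s \<gamma> x + C1 * s\<^sup>2" .
    \<comment> \<open>Replaces \<open>R s \<gamma>\<close> from the upper bound by
      \<open>\<gamma>\<close> itself, at the cost of the displacement by flow and noise.\<close>
    moreover have "s * R s \<gamma> x \<le> s * (\<gamma> x + 6 * K * V * (L * s * norm x + m s))"
      using R_minus_id[OF s0 s(3) \<gamma>, of x] s0 unfolding lg by (intro mult_left_mono) auto
    ultimately have "(J h ^^ k) f x - R s f x - s * \<gamma> x \<le> s * (C1 * s + 6 * K * V * (L * s * norm x + m s))"
      by (simp add: power2_eq_square algebra_simps)
    also have "\<dots> \<le> s * (C * (s + s * norm x + m s))" using up s0 by (rule mult_left_mono)
    finally have U: "(J h ^^ k) f x - R s f x - s * \<gamma> x \<le> s * (C * (s + s * norm x + m s))" .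
    have "R s f x + s * \<gamma> x - (J h ^^ k) f x \<le> s * (6 * K * V * (L * s * norm x + m s + s * V) + \<Lambda> * L * V * s)"
      using J_power_lower[OF f q h s, of x] unfolding \<gamma>_def V_def by linarith
    also have "\<dots> \<le> s * (C * (s + s * norm x + m s))" using low s0 by (rule mult_left_mono)
    finally show ?thesis using U by linarith
  qed
  then show ?thesis using that[OF C] unfolding \<gamma>_def by blast
qed

end

context wasserstein_scheme
begin

lemma S_expansion:
  assumes f: "blip \<Lambda> f" and q: "quadratic_remainder K G f" and \<epsilon>: "0 < \<epsilon>"
  obtains \<delta> where "0 < \<delta>" "\<forall>t x. 0 < t \<longrightarrow> t \<le> \<delta> \<longrightarrow> norm x \<le> M \<longrightarrow>
    \<bar>S t f x - R t f x - t * \<Phi> (norm (G x))\<bar> \<le> t * \<epsilon>"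
proof -
  note fb = blip_bcontfun[OF f]
  obtain C where C: "0 \<le> C" "\<And>h k s x. 0 < h \<Longrightarrow> s = real k * h \<Longrightarrow> 0 < s \<Longrightarrow> s \<le> 1 \<Longrightarrow>
    \<bar>(J h ^^ k) f x - R s f x - s * \<Phi> (norm (G x))\<bar> \<le> s * (C * (s + s * norm x + m s))"
    using J_power_expansion[OF f q] by blast
  define \<kappa> where "\<kappa> = \<epsilon> / (2 * (C + 1))"
  have \<kappa>: "0 < \<kappa>" using \<epsilon> C by (simp add: \<kappa>_def)
  obtain d where d: "0 < d" "d \<le> 1" "\<And>t. 0 < t \<Longrightarrow> t \<le> d \<Longrightarrow> m t \<le> \<kappa>" using m_small[OF \<kappa>] by blast
  define \<delta> where "\<delta> = min d (\<kappa> / (1 + \<bar>M\<bar>))"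
  have \<delta>: "0 < \<delta>" using d \<kappa> by (simp add: \<delta>_def add_pos_nonneg)
  have "\<bar>S t f x - R t f x - t * \<Phi> (norm (G x))\<bar> \<le> t * \<epsilon>" if t: "0 < t" "t \<le> \<delta>" and x: "norm x \<le> M" for t x
  proof -
    note t0 = less_imp_le[OF t(1)]
    have lim: "(\<lambda>n. \<bar>Jn n t f x - R (grid n t) f x - grid n t * \<Phi> (norm (G x))\<bar>) \<longlonglongrightarrow>
        \<bar>S t f x - R t f x - t * \<Phi> (norm (G x))\<bar>"
      by (intro tendsto_intros S_tendsto[OF fb t0] R_tendsto[OF f grid_nonneg grid_le[OF t0]] grid_tendsto[OF t0])
    \<comment> \<open>The expansion is stated for positive times, while a coarse grid may still
      round \<open>t\<close> down to 0.\<close>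
    have "\<forall>\<^sub>F n in sequentially. 0 < grid n t" using order_tendstoD(1)[OF grid_tendsto[OF t0] t(1)] .
    then have "\<forall>\<^sub>F n in sequentially. \<bar>Jn n t f x - R (grid n t) f x - grid n t * \<Phi> (norm (G x))\<bar> \<le> t * \<epsilon>"
    proof eventually_elim
      case (elim n)
      define s where "s = grid n t"
      have s: "0 < s" "s \<le> t" using elim grid_le[OF t0, of n] by (auto simp: s_def)
      have s1: "s \<le> 1" "s \<le> d" "s \<le> \<kappa> / (1 + \<bar>M\<bar>)" using s t d by (auto simp: \<delta>_def)
      have "\<bar>Jn n t f x - R s f x - s * \<Phi> (norm (G x))\<bar> \<le> s * (C * (s + s * norm x + m s))"
        unfolding Jn_def using s s1 by (intro C(2) h_pos) (auto simp: s_def grid_def)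
      also have "\<dots> \<le> t * \<epsilon>"
      proof (rule mult_mono)
        have "s * (1 + norm x) \<le> s * (1 + \<bar>M\<bar>)" using x s by (intro mult_left_mono) auto
        also have "\<dots> \<le> \<kappa>" using s1(3) by (simp add: pos_le_divide_eq add_pos_nonneg)
        finally have "s + s * norm x + m s \<le> 2 * \<kappa>" using d(3)[OF s(1) s1(2)] by (simp add: distrib_left)
        then have "C * (s + s * norm x + m s) \<le> C * (2 * \<kappa>)" using C(1) by (rule mult_left_mono)
        also have "\<dots> \<le> \<epsilon>" using C(1) \<epsilon> by (simp add: \<kappa>_def field_simps)
        finally show "C * (s + s * norm x + m s) \<le> \<epsilon>" .
      qed (use s C(1) m_nonneg[of s] in auto)
      finally show ?case by (simp add: s_def)
    qed
    then show ?thesis by (intro tendsto_upperbound[OF lim]) auto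
  qed
  then show ?thesis using that[OF \<delta>] by blast
qed

lemma S_generator_value:
  assumes f: "blip \<Lambda> f" and q: "quadratic_remainder K G f" and g: "has_generator_value R f g"
  shows "has_generator_value S f (\<lambda>x. g x + \<Phi> (norm (G x)))"
  unfolding has_generator_value_def mixed_lim_at_0_def
proof (intro allI impI)
  fix \<tau> :: "nat \<Rightarrow> real" assume a: "(\<forall>n. 0 < \<tau> n) \<and> \<tau> \<longlonglongrightarrow> 0"
  then have \<tau>: "\<And>n. 0 < \<tau> n" "\<tau> \<longlonglongrightarrow> 0" by auto
  note \<tau>0 = less_imp_le[OF \<tau>(1)]
  note fb = blip_bcontfun[OF f]
  note l0 = blip_nonneg[OF f]
  define \<gamma> where "\<gamma> x = \<Phi> (norm (G x))" for x
  have \<gamma>b: "\<gamma> \<in> bcontfun" unfolding \<gamma>_def by (rule blip_bcontfun[OF blip_conjugate_gradient[OF f q]])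
  have Rg: "mixed_lim (\<lambda>n x. (R (\<tau> n) f x - f x) / \<tau> n) g"
    using g a unfolding has_generator_value_def mixed_lim_at_0_def by blast
  have "\<exists>r. \<forall>n x. \<bar>(R (\<tau> n) f x - f x) / \<tau> n\<bar> \<le> r" by (rule mixed_lim_bound[OF Rg]) blast
  then obtain r where r: "\<forall>n x. \<bar>(R (\<tau> n) f x - f x) / \<tau> n\<bar> \<le> r" ..
  obtain B where B: "\<And>n. \<tau> n \<le> B"
    using convergent_imp_Bseq[OF convergentI[OF \<tau>(2)]] by (auto simp: Bseq_def abs_le_iff)
  have "mixed_lim (\<lambda>n x. (S (\<tau> n) f x - f x) / \<tau> n) (\<lambda>x. g x + \<gamma> x)"
  proof (rule mixed_limI)
    show "(\<lambda>x. (S (\<tau> n) f x - f x) / \<tau> n) \<in> bcontfun" for n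
      using bcontfun_mult_left[OF minus_cont[OF adm_bcontfun[OF adm_S[OF \<tau>0] fb] fb], of "1 / \<tau> n"] by simp
    show "(\<lambda>x. g x + \<gamma> x) \<in> bcontfun" by (rule plus_cont[OF mixed_lim_bcontfun(1)[OF Rg] \<gamma>b])
    \<comment> \<open>The quotient is split at \<open>R\<close>: the part \<open>S - R\<close> is
      trapped by the admissibility bounds, the part \<open>R - f\<close> is bounded because the
      generator value of \<open>R\<close> is a mixed limit.\<close>
    show "\<bar>(S (\<tau> n) f x - f x) / \<tau> n\<bar> \<le> r + \<Phi> (exp (L * B) * \<Lambda>)" for n x
    proof -
      have "exp (L * \<tau> n) * \<Lambda> \<le> exp (L * B) * \<Lambda>"
        using B[of n] l0 L_nonneg by (auto intro!: mult_right_mono mult_left_mono)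
      then have "\<Phi> (exp (L * \<tau> n) * \<Lambda>) \<le> \<Phi> (exp (L * B) * \<Lambda>)" using l0 by (intro conjugate_mono) auto
      then have "\<tau> n * \<Phi> (exp (L * \<tau> n) * \<Lambda>) \<le> \<tau> n * \<Phi> (exp (L * B) * \<Lambda>)" using \<tau>0[of n] by (rule mult_left_mono)
      then have "0 \<le> S (\<tau> n) f x - R (\<tau> n) f x" "S (\<tau> n) f x - R (\<tau> n) f x \<le> \<tau> n * \<Phi> (exp (L * B) * \<Lambda>)"
        using adm_ge_R[OF adm_S[OF \<tau>0] f, of n x] adm_le_R[OF adm_S[OF \<tau>0] f, of n x] by auto
      then have "\<bar>(S (\<tau> n) f x - R (\<tau> n) f x) / \<tau> n\<bar> \<le> \<Phi> (exp (L * B) * \<Lambda>)"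
        using \<tau>(1)[of n] by (simp add: pos_divide_le_eq mult.commute)
      moreover have "(S (\<tau> n) f x - f x) / \<tau> n = (S (\<tau> n) f x - R (\<tau> n) f x) / \<tau> n + (R (\<tau> n) f x - f x) / \<tau> n"
        by (simp add: diff_divide_distrib)
      ultimately show ?thesis using r[rule_format, of n x] by linarith
    qed
    fix M e :: real assume e: "0 < e"
    obtain \<delta> where \<delta>: "0 < \<delta>" "\<forall>t x. 0 < t \<longrightarrow> t \<le> \<delta> \<longrightarrow> norm x \<le> M \<longrightarrow>
      \<bar>S t f x - R t f x - t * \<Phi> (norm (G x))\<bar> \<le> t * (e / 2)" using S_expansion[OF f q half_gt_zero[OF e]] .
    show "\<forall>\<^sub>F n in sequentially. \<forall>x\<in>cball 0 M. \<bar>(S (\<tau> n) f x - f x) / \<tau> n - (g x + \<gamma> x)\<bar> \<le> e"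
      using order_tendstoD(2)[OF \<tau>(2) \<delta>(1)] mixed_limD[OF Rg half_gt_zero[OF e], of M]
    proof eventually_elim
      case (elim n)
      show ?case
      proof
        fix x :: 'a assume x: "x \<in> cball 0 M"
        have "\<bar>S (\<tau> n) f x - R (\<tau> n) f x - \<tau> n * \<gamma> x\<bar> \<le> \<tau> n * (e / 2)"
          using \<delta>(2) \<tau>(1)[of n] elim(1) x by (simp add: \<gamma>_def)
        then have "\<bar>(S (\<tau> n) f x - R (\<tau> n) f x - \<tau> n * \<gamma> x) / \<tau> n\<bar> \<le> e / 2"
          using \<tau>(1)[of n] by (simp add: pos_divide_le_eq mult.commute)
        moreover have "(S (\<tau> n) f x - f x) / \<tau> n - (g x + \<gamma> x)
          = (S (\<tau> n) f x - R (\<tau> n) f x - \<tau> n * \<gamma> x) / \<tau> n + ((R (\<tau> n) f x - f x) / \<tau> n - g x)"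
          using \<tau>(1)[of n] by (simp add: field_simps)
        ultimately show "\<bar>(S (\<tau> n) f x - f x) / \<tau> n - (g x + \<gamma> x)\<bar> \<le> e"
          using elim(2)[rule_format, OF x] by linarith
      qed
    qed
  qed
  then show "mixed_lim (\<lambda>n x. (S (\<tau> n) f x - f x) / \<tau> n) (\<lambda>x. g x + \<Phi> (norm (G x)))" by (simp add: \<gamma>_def)
qed

text \<open>Convergence is inherited from \<open>J\<close>: on Lipschitz functions the iterates of
  \<open>I\<close> are squeezed between those of \<open>J\<close> and the same plus
  \<open>e / 4\<close>. The other three quarters go to approximating \<open>f\<close> in both
  schemes and to the convergence for \<open>J\<close>.\<close>

lemma I_mixed_lim:
  assumes f: "f \<in> bcontfun" and t: "0 \<le> t"
  shows "mixed_lim (\<lambda>n. (I (h n) ^^ step_count (h n) t) f) (S t f)"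
proof -
  define In where "In n = I (h n) ^^ step_count (h n) t" for n
  have aI: "adm (grid n t) (In n)" for n
    unfolding In_def grid_def by (rule adm_power[OF adm_I[OF h_pos]])
  obtain r where r: "r \<ge> 0" "\<And>x. \<bar>f x\<bar> \<le> r" using bcontfun_bound[OF f] by blast
  have "mixed_lim (\<lambda>n. In n f) (S t f)"
  proof (rule mixed_limI)
    show "In n f \<in> bcontfun" for n by (rule adm_bcontfun[OF aI f])
    show "S t f \<in> bcontfun" by (rule adm_bcontfun[OF adm_S[OF t] f])
    show "\<bar>In n f x\<bar> \<le> r" for n x by (rule adm_abs_le[OF aI f r(2)])
    fix M0 e :: real assume e: "0 < e"
    then have e4: "0 < e / 4" by simp
    obtain M \<delta> where M: "equi_modulus t r M0 (e / 4) M \<delta>" using adm_equicontinuous[OF t e4 r(1)] .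
    obtain g \<Lambda> where g: "blip \<Lambda> g" "\<forall>x. \<bar>g x\<bar> \<le> r" "\<forall>x. norm x \<le> M \<longrightarrow> \<bar>f x - g x\<bar> \<le> \<delta>"
      using lipschitz_approx[OF f r(2) equi_modulusD(1)[OF M]] .
    note gb = blip_bcontfun[OF g(1)]
    obtain \<eta> where \<eta>: "0 < \<eta>" "\<forall>h k f x. 0 < h \<longrightarrow> h \<le> \<eta> \<longrightarrow> real k * h \<le> t \<longrightarrow> blip \<Lambda> f \<longrightarrow> (\<forall>x. \<bar>f x\<bar> \<le> r) \<longrightarrow>
      (I h ^^ k) f x \<le> (J h ^^ k) f x + e / 4" using I_power_le_J_power[OF blip_nonneg[OF g(1)] t e4] .
    show "\<forall>\<^sub>F n in sequentially. \<forall>x\<in>cball 0 M0. \<bar>In n f x - S t f x\<bar> \<le> e"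
      using order_tendstoD(2)[OF h_lim \<eta>(1)] mixed_limD[OF S_mixed_lim[OF f t] e4, of M0]
    proof eventually_elim
      case (elim n)
      show ?case
      proof
        fix x :: 'a assume x: "x \<in> cball 0 M0"
        have close: "\<bar>T f x - T g x\<bar> \<le> e / 4" if "adm (grid n t) T" for T
          by (rule equi_modulusD(2)[OF M that grid_le[OF t] f gb r(2)]) (use g x in auto)
        have "In n g x \<le> Jn n t g x + e / 4"
          using \<eta>(2) h_pos[of n] elim(1) grid_le[OF t, of n] g(1,2) by (auto simp: In_def Jn_def grid_def)
        moreover have "Jn n t g x \<le> In n g x"
          unfolding In_def Jn_def by (rule J_power_le_I_power[OF h_pos gb])
        ultimately show "\<bar>In n f x - S t f x\<bar> \<le> e"
          using close[OF aI] close[OF adm_Jn] elim(2)[rule_format, OF x] by linarith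
      qed
    qed
  qed
  then show ?thesis by (simp add: In_def)
qed

end

theorem theorem6p9:
  fixes p :: real
    and \<mu> :: "real \<Rightarrow> 'a::euclidean_space measure"
    and \<psi> :: "real \<Rightarrow> 'a \<Rightarrow> 'a"
    and \<phi> :: "real \<Rightarrow> ereal"
    and h :: "nat \<Rightarrow> real"
  assumes "1 < p"
    and "\<forall>t\<ge>0. \<mu> t \<in> P_space p"
    and "Cb_semigroup (R_op \<mu> \<psi>)"
    and "((\<lambda>t. \<integral>y. norm y powr p \<partial>\<mu> t) \<longlongrightarrow> 0) (at_right 0)"
    and "\<exists>r>0. \<exists>c\<ge>0. \<forall>t\<in>{0..1}. measure (\<mu> t) {y. norm y > r} \<le> c * t"
    and "\<forall>t\<ge>0. \<psi> t 0 = 0"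
    and "\<exists>L\<ge>0. \<forall>x y. \<forall>t\<in>{0..1}. norm (\<psi> t x - \<psi> t y - (x - y)) \<le> L * t * norm (x - y)"
    and "\<forall>f \<in> Cb_smooth \<inter> lipschitz_set (R_op \<mu> \<psi>). \<exists>g. has_generator_value (R_op \<mu> \<psi>) f g"
    and "Cc_smooth \<subseteq> lipschitz_set (R_op \<mu> \<psi>)"
    and "\<forall>v\<ge>0. 0 \<le> \<phi> v"
    and "ereal_convex_halfline \<phi>"
    and "ereal_lsc_halfline \<phi>"
    and "\<phi> 0 = 0"
    and "\<exists>v\<ge>0. \<phi> v > 0"
    and "ereal_convex_halfline (\<lambda>v. \<phi> (v powr (1 / p)))"
    and "\<forall>n. 0 < h n"
    and "h \<longlonglongrightarrow> 0"
    and "\<forall>n. range (\<lambda>k. real k * h n) \<subseteq> range (\<lambda>k. real k * h (Suc n))"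
  shows "\<exists>S. convex_monotone_semigroup S \<and> strongly_continuous S \<and>
    (\<forall>f\<in>bcontfun. \<forall>t\<ge>0.
       mixed_lim (\<lambda>n. (I_op p \<phi> \<mu> \<psi> (h n) ^^ step_count (h n) t) f) (S t f) \<and>
       mixed_lim (\<lambda>n. (J_op \<phi> \<mu> \<psi> (h n) ^^ step_count (h n) t) f) (S t f)) \<and>
    Cb_smooth \<inter> lipschitz_set (R_op \<mu> \<psi>) \<subseteq> generator_domain S \<and>
    (\<forall>f \<in> Cb_smooth \<inter> lipschitz_set (R_op \<mu> \<psi>).
       generator S f = (\<lambda>x. generator (R_op \<mu> \<psi>) f x + conjugate \<phi> (norm (grad f x))))"
proof -
  obtain L where L: "0 \<le> L" "\<forall>x y. \<forall>t\<in>{0..1}. norm (\<psi> t x - \<psi> t y - (x - y)) \<le> L * t * norm (x - y)"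
    using assms(7) by blast
  interpret wasserstein_scheme p \<phi> \<mu> \<psi> L h
    using assms L by unfold_locales auto
  have gen: "has_generator_value S f (\<lambda>x. generator R f x + \<Phi> (norm (grad f x)))"
    if f: "f \<in> Cb_smooth \<inter> lipschitz_set R" for f
  proof -
    obtain g where g: "has_generator_value R f g" using assms(8) f by blast
    have "f \<in> Cb_smooth" using f by simp
    then obtain \<Lambda> K where "blip \<Lambda> f" "quadratic_remainder K (grad f) f" by (rule Cb_smooth_quadratic)
    then show ?thesis using S_generator_value[OF _ _ g] generator_eqI[OF g] by simp
  qed
  show ?thesis
  proof (intro exI[of _ S] conjI ballI allI impI)
    show "convex_monotone_semigroup S" by (rule convex_monotone_semigroup_S)
    show "strongly_continuous S" by (rule strongly_continuous_S)
    fix f :: "'a \<Rightarrow> real" and t :: real assume "f \<in> bcontfun" "0 \<le> t"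
    then show "mixed_lim (\<lambda>n. (I (h n) ^^ step_count (h n) t) f) (S t f)"
      "mixed_lim (\<lambda>n. (J (h n) ^^ step_count (h n) t) f) (S t f)"
      using I_mixed_lim S_mixed_lim unfolding Jn_def by auto
  next
    show "Cb_smooth \<inter> lipschitz_set R \<subseteq> generator_domain S"
      using gen by (auto simp: generator_domain_def lipschitz_set_def)
    show "generator S f = (\<lambda>x. generator R f x + \<Phi> (norm (grad f x)))"
      if "f \<in> Cb_smooth \<inter> lipschitz_set R" for f by (rule generator_eqI[OF gen[OF that]])
  qed
qed

end
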